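(* Let $M$ be a sphere with a Euclidean polyhedral metric. Suppose that $P$ and $P'$ are two generalized convex polytopes with boundary $M$ represented by the couples $(T,r)$ and $(T',r')$, respectively. Then $r=r'$ implies $P=P'$.
   Context: A Euclidean polyhedral metric on the sphere $M$: every point has a neighborhood isometric to an open subset of $\mathbb{R}^2$ or, for the finitely many singular points (set $\Sigma$), to an open subset of a Euclidean cone of angle $\neq2\pi$ with the point at the apex. A geodesic triangulation $T$ of $M$ is a decomposition of $M$ into Euclidean triangles by geodesics with endpoints in $\Sigma$, with vertex set $\mathcal V(T)=\Sigma$, edge set $\mathcal E(T)$, face set $\mathcal F(T)$; loops, multiple edges and self-identifications of triangles on the boundary are allowed. Let $r=(r_i)_{i\in\Sigma}$ be positive numbers (radii) such that over every $ijk\in\mathcal F(T)$ there is a (non-degenerate) pyramid with base $ijk$ and side edges of lengths $r_i,r_j,r_k$. Gluing these pyramids following the gluing rules of $T$ gives the generalized polytope defined by $(T,r)$; all apices of pyramids become one point, the apex. A generalized polytope with boundary $M$ is an equivalence class of such couples, where two couples are equivalent if and only if there is an isometry between the resulting polyhedra which is the identity on the boundary and maps the apex to the apex. A generalized convex polytope is a generalized polytope such that for every edge $ij\in\mathcal E(T)$ the sum $\theta_{ij}$ of the dihedral angles of the pyramids at $ij$ is at most $\pi$, for some (and hence any) associated triangulation $T$. Equality $P=P'$ means equality as equivalence classes. *)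

theory Defs
  imports "HOL-Analysis.Analysis" "HOL-Library.Disjoint_Sets"
begin

section \<open>Euclidean polyhedral metrics\<close>

text \<open>
  Points of the Euclidean cone of angle \<open>\<alpha>\<close> in polar coordinates (distance to the apex, angle
  modulo \<open>\<alpha>\<close>). The apex has the single representative \<open>(0, 0)\<close>.
\<close>

definition cone_points :: "real \<Rightarrow> (real \<times> real) set" where
  "cone_points \<alpha> = insert (0, 0) {(\<rho>, \<phi>). 0 < \<rho> \<and> 0 \<le> \<phi> \<and> \<phi> < \<alpha>}"

text \<open>
  The law of cosines, applied to the smaller of the two angles between the rays. If that angle
  is at least \<open>\<pi>\<close>, the shortest path runs through the apex and has length \<open>\<rho> + \<rho>'\<close>, which is
  the value of the formula at \<open>\<pi>\<close>.
\<close>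

definition cone_dist :: "real \<Rightarrow> real \<times> real \<Rightarrow> real \<times> real \<Rightarrow> real" where
  "cone_dist \<alpha> = (\<lambda>(\<rho>, \<phi>) (\<rho>', \<phi>').
     sqrt (\<rho>\<^sup>2 + \<rho>'\<^sup>2 - 2 * \<rho> * \<rho>' * cos (min pi (min \<bar>\<phi> - \<phi>'\<bar> (\<alpha> - \<bar>\<phi> - \<phi>'\<bar>)))))"

definition cone_open :: "real \<Rightarrow> (real \<times> real) set \<Rightarrow> bool" where
  "cone_open \<alpha> V \<longleftrightarrow> V \<subseteq> cone_points \<alpha> \<and>
     (\<forall>c\<in>V. \<exists>e>0. \<forall>c'\<in>cone_points \<alpha>. cone_dist \<alpha> c c' < e \<longrightarrow> c' \<in> V)"

definition regular_point :: "'a::metric_space set \<Rightarrow> 'a \<Rightarrow> bool" where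
  "regular_point M p \<longleftrightarrow>
     (\<exists>U (h :: 'a \<Rightarrow> real^2). openin (top_of_set M) U \<and> p \<in> U \<and> open (h ` U) \<and>
        (\<forall>x\<in>U. \<forall>y\<in>U. dist (h x) (h y) = dist x y))"

definition cone_point :: "'a::metric_space set \<Rightarrow> real \<Rightarrow> 'a \<Rightarrow> bool" where
  "cone_point M \<alpha> p \<longleftrightarrow>
     (\<exists>U h. openin (top_of_set M) U \<and> p \<in> U \<and> cone_open \<alpha> (h ` U) \<and> h p = (0, 0) \<and>
        (\<forall>x\<in>U. \<forall>y\<in>U. cone_dist \<alpha> (h x) (h y) = dist x y))"

definition singular_points :: "'a::metric_space set \<Rightarrow> 'a set" where
  "singular_points M = {p \<in> M. \<exists>\<alpha>>0. \<alpha> \<noteq> 2 * pi \<and> cone_point M \<alpha> p}"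

text \<open>
  Only the metric near each point matters below, so \<open>dist\<close> restricted to \<open>M\<close> is not required to
  be a length metric on large scales.
\<close>

definition polyhedral_metric :: "'a::metric_space set \<Rightarrow> bool" where
  "polyhedral_metric M \<longleftrightarrow>
     (\<forall>p\<in>M. regular_point M p \<or> p \<in> singular_points M) \<and> finite (singular_points M)"


section \<open>Geodesic triangulations\<close>

text \<open>
  A face is a triangle in the plane together with its map to \<open>M\<close>. The map may identify
  boundary points of the triangle, so that loops, multiple edges and self-glued triangles occur.
  Corners are indexed cyclically by the type \<open>3\<close>; side \<open>k\<close> is opposite to corner \<open>k\<close>.
\<close>

record 'a face =
  corner :: "3 \<Rightarrow> real^2"
  place :: "real^2 \<Rightarrow> 'a"

definition base_triangle :: "'a face \<Rightarrow> (real^2) set" where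
  "base_triangle f = convex hull (range (corner f))"

definition open_side :: "'a face \<Rightarrow> 3 \<Rightarrow> (real^2) set" where
  "open_side f k = open_segment (corner f (k + 1)) (corner f (k + 2))"

definition open_edge :: "'a face \<Rightarrow> 3 \<Rightarrow> 'a set" where
  "open_edge f k = place f ` open_side f k"

definition open_face :: "'a face \<Rightarrow> 'a set" where
  "open_face f = place f ` interior (base_triangle f)"

definition vertices :: "'a face set \<Rightarrow> 'a set" where
  "vertices T = {place f (corner f k) | f k. f \<in> T}"

definition edges :: "'a face set \<Rightarrow> 'a set set" where
  "edges T = {open_edge f k | f k. f \<in> T}"

text \<open>
  The map is a local isometry on the triangle without its corners; in particular it maps the
  sides to geodesics. It need not be isometric near a corner: two sides meeting there may be
  glued to each other.
\<close>

definition geodesic_triangle :: "'a::metric_space set \<Rightarrow> 'a face \<Rightarrow> bool" where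
  "geodesic_triangle M f \<longleftrightarrow>
     inj (corner f) \<and> \<not> collinear (range (corner f)) \<and>
     place f ` base_triangle f \<subseteq> M \<and> continuous_on (base_triangle f) (place f) \<and>
     (\<forall>x \<in> base_triangle f - range (corner f). \<exists>e>0.
        \<forall>y \<in> base_triangle f \<inter> ball x e. \<forall>z \<in> base_triangle f \<inter> ball x e.
          dist (place f y) (place f z) = dist y z) \<and>
     inj_on (place f) (interior (base_triangle f)) \<and> (\<forall>k. inj_on (place f) (open_side f k))"

definition geodesic_triangulation :: "'a::metric_space set \<Rightarrow> 'a face set \<Rightarrow> bool" where
  "geodesic_triangulation M T \<longleftrightarrow>
     finite T \<and> (\<forall>f\<in>T. geodesic_triangle M f) \<and> vertices T = singular_points M \<and>
     inj_on open_face T \<and>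
     partition_on M ((\<lambda>v. {v}) ` vertices T \<union> edges T \<union> open_face ` T)"


section \<open>Pyramids and their gluing\<close>

text \<open>Euclidean 3-space is \<open>(real^2) \<times> real\<close>, with bases of pyramids in the plane of height \<open>0\<close>.\<close>

definition is_apex :: "('a \<Rightarrow> real) \<Rightarrow> 'a face \<Rightarrow> (real^2) \<times> real \<Rightarrow> bool" where
  "is_apex r f a \<longleftrightarrow> 0 < snd a \<and> (\<forall>k. dist a (corner f k, 0) = r (place f (corner f k)))"

definition apex :: "('a \<Rightarrow> real) \<Rightarrow> 'a face \<Rightarrow> (real^2) \<times> real" where
  "apex r f = (THE a. is_apex r f a)"

definition pyramid :: "('a \<Rightarrow> real) \<Rightarrow> 'a face \<Rightarrow> ((real^2) \<times> real) set" where
  "pyramid r f = convex hull (insert (apex r f) (range (\<lambda>k. (corner f k, 0))))"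

text \<open>The point dividing the segment from the apex to the base point \<open>x\<close> in the ratio \<open>t : 1 - t\<close>.\<close>

definition ray_point :: "('a \<Rightarrow> real) \<Rightarrow> 'a face \<Rightarrow> real^2 \<Rightarrow> real \<Rightarrow> (real^2) \<times> real" where
  "ray_point r f x t = (1 - t) *\<^sub>R apex r f + t *\<^sub>R (x, 0)"

definition pyramids :: "'a face set \<Rightarrow> ('a \<Rightarrow> real) \<Rightarrow> ('a face \<times> (real^2) \<times> real) set" where
  "pyramids T r = (SIGMA f:T. pyramid r f)"

text \<open>
  Two lateral faces over the same edge of \<open>T\<close> are congruent triangles, identified by the isometry
  that extends the gluing of their bases and matches the apices: base points that \<open>T\<close> glues
  together have their segments to the apex glued together. For \<open>t = 0\<close> all apices coincide.
\<close>

definition gluing ::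
    "'a face set \<Rightarrow> ('a \<Rightarrow> real) \<Rightarrow> (('a face \<times> (real^2) \<times> real) \<times> ('a face \<times> (real^2) \<times> real)) set"
  where
  "gluing T r = {((f, ray_point r f x t), (g, ray_point r g y t)) | f g x y t.
     f \<in> T \<and> g \<in> T \<and> x \<in> base_triangle f \<and> y \<in> base_triangle g \<and> 0 \<le> t \<and> t \<le> 1 \<and>
     (t = 0 \<or> place f x = place g y)}"

definition glued_polyhedron :: "'a face set \<Rightarrow> ('a \<Rightarrow> real) \<Rightarrow> ('a face \<times> (real^2) \<times> real) set set" where
  "glued_polyhedron T r = pyramids T r // gluing T r"

definition boundary_point ::
    "'a face set \<Rightarrow> ('a \<Rightarrow> real) \<Rightarrow> 'a \<Rightarrow> ('a face \<times> (real^2) \<times> real) set" where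
  "boundary_point T r x = {(f, (u, 0)) | f u. f \<in> T \<and> u \<in> base_triangle f \<and> place f u = x}"

definition apex_point :: "'a face set \<Rightarrow> ('a \<Rightarrow> real) \<Rightarrow> ('a face \<times> (real^2) \<times> real) set" where
  "apex_point T r = {(f, apex r f) | f. f \<in> T}"

text \<open>
  The metric of the glued space: the infimum of the lengths of polygonal chains each of whose
  segments lies in one pyramid.
\<close>

inductive chain_length ::
    "'a face set \<Rightarrow> ('a \<Rightarrow> real) \<Rightarrow> ('a face \<times> (real^2) \<times> real) set \<Rightarrow>
     ('a face \<times> (real^2) \<times> real) set \<Rightarrow> real \<Rightarrow> bool"
  for T r where
  start: "X \<in> glued_polyhedron T r \<Longrightarrow> chain_length T r X X 0"
| step: "chain_length T r X Y l \<Longrightarrow> Z \<in> glued_polyhedron T r \<Longrightarrow> (f, p) \<in> Y \<Longrightarrow> (f, q) \<in> Z \<Longrightarrow>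
    chain_length T r X Z (l + dist p q)"

definition glued_dist ::
    "'a face set \<Rightarrow> ('a \<Rightarrow> real) \<Rightarrow> ('a face \<times> (real^2) \<times> real) set \<Rightarrow>
     ('a face \<times> (real^2) \<times> real) set \<Rightarrow> real" where
  "glued_dist T r X Y = Inf {l. chain_length T r X Y l}"


section \<open>Generalized polytopes\<close>

text \<open>Families of radii are extensional functions, so their equality is equality on the singular points.\<close>

definition couples :: "'a::metric_space set \<Rightarrow> ('a face set \<times> ('a \<Rightarrow> real)) set" where
  "couples M = {(T, r). geodesic_triangulation M T \<and> r \<in> singular_points M \<rightarrow>\<^sub>E {0<..} \<and>
     (\<forall>f\<in>T. \<exists>a. is_apex r f a)}"

definition couple_equiv ::
    "'a::metric_space set \<Rightarrow>
     (('a face set \<times> ('a \<Rightarrow> real)) \<times> ('a face set \<times> ('a \<Rightarrow> real))) set" where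
  "couple_equiv M = {((T, r), (T', r')). (T, r) \<in> couples M \<and> (T', r') \<in> couples M \<and>
     (\<exists>\<Phi>. bij_betw \<Phi> (glued_polyhedron T r) (glued_polyhedron T' r') \<and>
        (\<forall>X \<in> glued_polyhedron T r. \<forall>Y \<in> glued_polyhedron T r.
           glued_dist T' r' (\<Phi> X) (\<Phi> Y) = glued_dist T r X Y) \<and>
        (\<forall>x\<in>M. \<Phi> (boundary_point T r x) = boundary_point T' r' x) \<and>
        \<Phi> (apex_point T r) = apex_point T' r')}"

definition generalized_polytopes ::
    "'a::metric_space set \<Rightarrow> ('a face set \<times> ('a \<Rightarrow> real)) set set" where
  "generalized_polytopes M = couples M // couple_equiv M"

definition vec_angle :: "'b::real_inner \<Rightarrow> 'b \<Rightarrow> real" where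
  "vec_angle x y = arccos ((x \<bullet> y) / (norm x * norm y))"

definition orth_part :: "'b::real_inner \<Rightarrow> 'b \<Rightarrow> 'b" where
  "orth_part u x = x - ((x \<bullet> u) / (u \<bullet> u)) *\<^sub>R u"

text \<open>The angle along the line \<open>ab\<close> between the half-planes containing \<open>c\<close> and \<open>d\<close>.\<close>

definition dihedral_angle :: "'b::real_inner \<Rightarrow> 'b \<Rightarrow> 'b \<Rightarrow> 'b \<Rightarrow> real" where
  "dihedral_angle a b c d = vec_angle (orth_part (b - a) (c - a)) (orth_part (b - a) (d - a))"

definition base_angle :: "('a \<Rightarrow> real) \<Rightarrow> 'a face \<Rightarrow> 3 \<Rightarrow> real" where
  "base_angle r f k =
     dihedral_angle (corner f (k + 1), 0) (corner f (k + 2), 0) (corner f k, 0) (apex r f)"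

text \<open>A face of which two sides are glued to the edge \<open>e\<close> contributes two angles.\<close>

definition edge_angle :: "'a face set \<Rightarrow> ('a \<Rightarrow> real) \<Rightarrow> 'a set \<Rightarrow> real" where
  "edge_angle T r e = (\<Sum>(f, k) \<in> {(f, k). f \<in> T \<and> open_edge f k = e}. base_angle r f k)"

definition generalized_convex_polytope ::
    "'a::metric_space set \<Rightarrow> ('a face set \<times> ('a \<Rightarrow> real)) set \<Rightarrow> bool" where
  "generalized_convex_polytope M P \<longleftrightarrow> P \<in> generalized_polytopes M \<and>
     (\<exists>(T, r) \<in> P. \<forall>e \<in> edges T. edge_angle T r e \<le> pi)"


section \<open>The relations defining the quotients are equivalences\<close>

lemma apex_ex1:
  assumes f: "geodesic_triangle M f" and a: "is_apex r f a" and b: "is_apex r f b"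
  shows "a = b"
proof -
  define c where "c = (\<lambda>k. (corner f k, 0::real))"
  have d: "dist a (c k) = dist b (c k)" for k using a b by (auto simp: is_apex_def c_def)
  have n: "(a - c k) \<bullet> (a - c k) = (b - c k) \<bullet> (b - c k)" for k
    using d[of k] by (simp add: dist_norm norm_eq)
  have lin: "2 * ((a - b) \<bullet> c k) = a \<bullet> a - b \<bullet> b" for k
    using n[of k] by (simp add: inner_diff inner_commute algebra_simps)
  have lin2: "2 * (fst (a - b) \<bullet> corner f k) = a \<bullet> a - b \<bullet> b" for k
    using lin[of k] by (simp add: c_def inner_prod_def)
  define w where "w = fst (a - b)"
  have w: "w \<bullet> (corner f k - corner f 0) = 0" for k
    using lin2[of k] lin2[of 0] by (simp add: w_def inner_diff_right)
  have "w = 0"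
  proof (rule ccontr)
    assume "w \<noteq> 0"
    define s where "s = corner f 1 - corner f 0"
    have "inj (corner f)" using f by (simp add: geodesic_triangle_def)
    hence s0: "s \<noteq> 0" using injD[of "corner f" 1 0] by (auto simp: s_def)
    have w2: "w$1 * s$1 + w$2 * s$2 = 0" using w[of 1] by (simp add: s_def inner_vec_def sum_2)
    have "\<exists>c. corner f k - corner f 0 = c *\<^sub>R s" for k
    proof -
      define t where "t = corner f k - corner f 0"
      have t2: "w$1 * t$1 + w$2 * t$2 = 0" using w[of k] by (simp add: t_def inner_vec_def sum_2)
      have "w$1 \<noteq> 0 \<or> w$2 \<noteq> 0" using \<open>w \<noteq> 0\<close> by (simp add: vec_eq_iff forall_2)
      moreover have "w$1 * (s$1 * t$2 - s$2 * t$1) = 0" "w$2 * (s$1 * t$2 - s$2 * t$1) = 0"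
        using w2 t2 by algebra+
      ultimately have det: "s$1 * t$2 = s$2 * t$1" by auto
      have "s$1 \<noteq> 0 \<or> s$2 \<noteq> 0" using s0 by (simp add: vec_eq_iff forall_2)
      hence "\<exists>c. t = c *\<^sub>R s"
      proof
        assume "s$1 \<noteq> 0" thus ?thesis using det by (intro exI[of _ "t$1 / s$1"]) (auto simp: vec_eq_iff forall_2 field_simps)
      next
        assume "s$2 \<noteq> 0" thus ?thesis using det by (intro exI[of _ "t$2 / s$2"]) (auto simp: vec_eq_iff forall_2 field_simps)
      qed
      thus ?thesis by (simp add: t_def)
    qed
    then obtain c where c: "\<And>k. corner f k - corner f 0 = c k *\<^sub>R s" by metis
    have "corner f i - corner f j = (c i - c j) *\<^sub>R s" for i j
      using c[of i] c[of j] by (simp add: algebra_simps)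
    hence "collinear (range (corner f))" unfolding collinear_def by (intro exI[of _ s]) auto
    thus False using f by (simp add: geodesic_triangle_def)
  qed
  hence fst: "fst a = fst b" by (simp add: w_def)
  have "(snd a)\<^sup>2 = (snd b)\<^sup>2" using n[of 0] fst by (simp add: c_def inner_prod_def power2_eq_square)
  hence "snd a = snd b" using a b by (simp add: is_apex_def power2_eq_iff_nonneg)
  thus ?thesis using fst by (simp add: prod_eq_iff)
qed

lemma is_apex_apex:
  assumes "(T, r) \<in> couples M" "f \<in> T"
  shows "is_apex r f (apex r f)"
proof -
  have "geodesic_triangle M f" "\<exists>a. is_apex r f a"
    using assms by (auto simp: couples_def geodesic_triangulation_def)
  hence "\<exists>!a. is_apex r f a" using apex_ex1 by blast
  thus ?thesis unfolding apex_def by (rule theI')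
qed

lemma base_hull: "convex hull (range (\<lambda>k. (corner f k, 0::real))) = (\<lambda>x. (x, 0)) ` base_triangle f"
proof -
  have "linear (\<lambda>x::real^2. (x, 0::real))" by (auto intro!: linearI)
  from convex_hull_linear_image[OF this, of "range (corner f)"]
  show ?thesis by (simp add: base_triangle_def image_image)
qed

lemma pyramid_eq: "pyramid r f = {ray_point r f x t | x t. x \<in> base_triangle f \<and> 0 \<le> t \<and> t \<le> 1}"
proof -
  have "pyramid r f = {p. \<exists>u\<ge>0. \<exists>v\<ge>0. \<exists>b. u + v = 1 \<and> b \<in> (\<lambda>x. (x, 0)) ` base_triangle f \<and>
      p = u *\<^sub>R apex r f + v *\<^sub>R b}"
    unfolding pyramid_def base_hull[symmetric] by (rule convex_hull_insert) blast
  also have "\<dots> = {ray_point r f x t | x t. x \<in> base_triangle f \<and> 0 \<le> t \<and> t \<le> 1}" (is "?A = ?B")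
  proof (intro equalityI subsetI)
    fix p assume "p \<in> ?A"
    then obtain u v x where "0 \<le> u" "0 \<le> v" "u + v = 1" "x \<in> base_triangle f"
      "p = u *\<^sub>R apex r f + v *\<^sub>R (x, 0)" by blast
    moreover from this have "u = 1 - v" "v \<le> 1" by auto
    ultimately show "p \<in> ?B" unfolding ray_point_def by blast
  next
    fix p assume "p \<in> ?B"
    then obtain x t where p: "p = ray_point r f x t" "x \<in> base_triangle f" "0 \<le> t" "t \<le> 1" by blast
    have "0 \<le> 1 - t" "1 - t + t = 1" using p by auto
    thus "p \<in> ?A" using p unfolding ray_point_def by blast
  qed
  finally show ?thesis .
qed

lemma gluingI:
  assumes "f \<in> T" "g \<in> T" "x \<in> base_triangle f" "y \<in> base_triangle g" "0 \<le> t" "t \<le> 1"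
    "t = 0 \<or> place f x = place g y"
  shows "((f, ray_point r f x t), (g, ray_point r g y t)) \<in> gluing T r"
  using assms unfolding gluing_def by blast

lemma pyramidsI:
  assumes "f \<in> T" "x \<in> base_triangle f" "0 \<le> t" "t \<le> 1"
  shows "(f, ray_point r f x t) \<in> pyramids T r"
  using assms unfolding pyramids_def pyramid_eq by blast

lemma equiv_gluing:
  assumes "(T, r) \<in> couples M"
  shows "equiv (pyramids T r) (gluing T r)"
proof (rule equivI)
  show "gluing T r \<subseteq> pyramids T r \<times> pyramids T r"
    unfolding gluing_def pyramids_def pyramid_eq by blast
  show "refl_on (pyramids T r) (gluing T r)"
    unfolding gluing_def pyramids_def pyramid_eq refl_on_def by blast
  show "sym (gluing T r)"
  proof (rule symI)
    fix p q assume "(p, q) \<in> gluing T r"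
    then obtain f g x y t where "p = (f, ray_point r f x t)" "q = (g, ray_point r g y t)" "f \<in> T" "g \<in> T"
      "x \<in> base_triangle f" "y \<in> base_triangle g" "0 \<le> t" "t \<le> 1" "t = 0 \<or> place f x = place g y"
      unfolding gluing_def by blast
    thus "(q, p) \<in> gluing T r" by (metis gluingI)
  qed
  show "trans (gluing T r)"
  proof (rule transI)
    fix p q s assume "(p,q) \<in> gluing T r" "(q,s) \<in> gluing T r"
    then obtain f g h x y z w t u where
      1: "p = (f, ray_point r f x t)" "q = (g, ray_point r g y t)" "f \<in> T" "g \<in> T" "x \<in> base_triangle f"
         "y \<in> base_triangle g" "0 \<le> t" "t \<le> 1" "t = 0 \<or> place f x = place g y" and
      2: "q = (g, ray_point r g z u)" "s = (h, ray_point r h w u)" "h \<in> T" "z \<in> base_triangle g"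
         "w \<in> base_triangle h" "0 \<le> u" "u \<le> 1" "u = 0 \<or> place g z = place h w"
      unfolding gluing_def by blast
    have eq: "ray_point r g y t = ray_point r g z u" using 1 2 by simp
    have "snd (apex r g) > 0" using is_apex_apex[OF assms 1(4)] by (simp add: is_apex_def)
    moreover have "(1 - t) * snd (apex r g) = (1 - u) * snd (apex r g)"
      using arg_cong[OF eq, of snd] by (simp add: ray_point_def)
    ultimately have tu: "t = u" by simp
    have "t = 0 \<or> y = z" using arg_cong[OF eq, of fst] tu by (auto simp: ray_point_def)
    hence "t = 0 \<or> place f x = place h w" using 1 2 tu by auto
    moreover have "p = (f, ray_point r f x t)" "s = (h, ray_point r h w t)" using 1 2 tu by auto
    ultimately show "(p, s) \<in> gluing T r" using 1(3,5,7,8) 2(3,5) by (metis gluingI)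
  qed
qed

lemma boundary_point_in:
  assumes TR: "(T, r) \<in> couples M" and x: "x \<in> M"
  shows "boundary_point T r x \<in> glued_polyhedron T r"
proof -
  have tr: "geodesic_triangulation M T" using TR by (simp add: couples_def)
  then obtain A where A: "x \<in> A" "A \<in> (\<lambda>v. {v}) ` vertices T \<union> edges T \<union> open_face ` T"
    using x unfolding geodesic_triangulation_def partition_on_def by blast
  have *: "\<exists>f\<in>T. \<exists>u\<in>base_triangle f. place f u = x"
  proof -
    have "corner f k \<in> base_triangle f" for f :: "'a face" and k by (simp add: base_triangle_def hull_inc)
    moreover have "open_side f k \<subseteq> base_triangle f" for f :: "'a face" and k
      unfolding open_side_def base_triangle_def
      by (meson convex_convex_hull hull_inc rangeI segment_open_subset_closed closed_segment_subset subset_trans)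
    moreover have "interior (base_triangle f) \<subseteq> base_triangle f" for f :: "'a face" by (rule interior_subset)
    ultimately show ?thesis using A unfolding vertices_def edges_def open_edge_def open_face_def by blast
  qed
  then obtain f u where f: "f \<in> T" "u \<in> base_triangle f" "place f u = x" by blast
  have "boundary_point T r x = gluing T r `` {(f, ray_point r f u 1)}"
  proof
    have "(g, (v, 0)) \<in> gluing T r `` {(f, ray_point r f u 1)}"
      if "g \<in> T" "v \<in> base_triangle g" "place g v = x" for g v
    proof -
      have "ray_point r g v 1 = (v, 0)" by (simp add: ray_point_def)
      moreover have "((f, ray_point r f u 1), (g, ray_point r g v 1)) \<in> gluing T r"
        using that f by (intro gluingI) auto
      ultimately show ?thesis by (simp only: Image_singleton_iff)
    qed
    thus "boundary_point T r x \<subseteq> gluing T r `` {(f, ray_point r f u 1)}" unfolding boundary_point_def by blast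
    show "gluing T r `` {(f, ray_point r f u 1)} \<subseteq> boundary_point T r x"
    proof
      fix q assume "q \<in> gluing T r `` {(f, ray_point r f u 1)}"
      hence "((f, ray_point r f u 1), q) \<in> gluing T r" by simp
      then obtain g y z t where q: "q = (g, ray_point r g y t)" "ray_point r f u 1 = ray_point r f z t"
        "g \<in> T" "y \<in> base_triangle g" "t = 0 \<or> place f z = place g y" unfolding gluing_def by blast
      have "snd (apex r f) > 0" using is_apex_apex[OF TR f(1)] by (simp add: is_apex_def)
      hence t: "t = 1" using arg_cong[OF q(2), of snd] by (simp add: ray_point_def)
      hence "z = u" using q(2) by (simp add: ray_point_def)
      have "q = (g, (y, 0))" using q(1) t by (simp add: ray_point_def)
      moreover have "place g y = x" using q(5) t f(3) \<open>z = u\<close> by simp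
      ultimately show "q \<in> boundary_point T r x" using q(3,4) unfolding boundary_point_def by blast
    qed
  qed
  moreover have "(f, ray_point r f u 1) \<in> pyramids T r"
    using f by (intro pyramidsI) auto
  ultimately show ?thesis unfolding glued_polyhedron_def by (simp add: quotientI)
qed

lemma apex_point_in:
  assumes TR: "(T, r) \<in> couples M" and "M \<noteq> {}"
  shows "apex_point T r \<in> glued_polyhedron T r"
proof -
  obtain x where "x \<in> M" using assms by blast
  hence "boundary_point T r x \<in> glued_polyhedron T r" by (rule boundary_point_in[OF TR])
  then obtain p where "p \<in> pyramids T r" unfolding glued_polyhedron_def by (rule quotientE)
  hence f: "fst p \<in> T" by (cases p) (simp add: pyramids_def)
  define f where "f = fst p"
  note f = f[folded f_def]
  have ne: "\<exists>u. u \<in> base_triangle g" for g :: "'a face"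
    unfolding base_triangle_def by (rule exI, rule hull_inc, rule rangeI)
  have r0: "ray_point r g u 0 = apex r g" for g u by (rule prod_eqI) (simp_all add: ray_point_def)
  obtain u where u: "u \<in> base_triangle f" using ne by blast
  have "apex_point T r = gluing T r `` {(f, apex r f)}"
  proof
    show "apex_point T r \<subseteq> gluing T r `` {(f, apex r f)}"
    proof
      fix q assume "q \<in> apex_point T r"
      then obtain g where g: "g \<in> T" "q = (g, apex r g)" by (auto simp: apex_point_def)
      obtain v where v: "v \<in> base_triangle g" using ne by blast
      have "((f, ray_point r f u 0), (g, ray_point r g v 0)) \<in> gluing T r"
        using f g u v by (intro gluingI) auto
      thus "q \<in> gluing T r `` {(f, apex r f)}" using g by (simp add: r0)
    qed
    show "gluing T r `` {(f, apex r f)} \<subseteq> apex_point T r"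
    proof
      fix q assume "q \<in> gluing T r `` {(f, apex r f)}"
      hence "((f, apex r f), q) \<in> gluing T r" by simp
      then obtain g y z t where q: "q = (g, ray_point r g y t)" "apex r f = ray_point r f z t"
        "g \<in> T" "y \<in> base_triangle g" unfolding gluing_def by blast
      have "snd (apex r f) > 0" using is_apex_apex[OF TR f(1)] by (simp add: is_apex_def)
      moreover have "snd (ray_point r f z t) = (1 - t) * snd (apex r f)" by (simp add: ray_point_def)
      hence "t * snd (apex r f) = 0" unfolding q(2)[symmetric] by (simp only: left_diff_distrib)
      ultimately have t: "t = 0" by simp
      have "q = (g, apex r g)" using q(1) t by (simp add: r0)
      thus "q \<in> apex_point T r" using q(3) unfolding apex_point_def by blast
    qed
  qed
  moreover have "(f, ray_point r f u 0) \<in> pyramids T r"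
    using f u by (intro pyramidsI) auto
  ultimately show ?thesis unfolding glued_polyhedron_def by (simp add: quotientI r0)
qed

lemma equiv_couple_equiv:
  assumes "M \<noteq> {}"
  shows "equiv (couples M) (couple_equiv M)"
proof (rule equivI)
  show "couple_equiv M \<subseteq> couples M \<times> couples M" by (auto simp: couple_equiv_def)
  show "refl_on (couples M) (couple_equiv M)"
    by (auto simp: refl_on_def couple_equiv_def intro!: exI[of _ id])
  show "sym (couple_equiv M)"
  proof (rule symI)
    fix p q assume "(p, q) \<in> couple_equiv M"
    then obtain T r T' r' \<Phi> where pq: "p = (T, r)" "q = (T', r')" and
      c: "(T, r) \<in> couples M" "(T', r') \<in> couples M" and
      b: "bij_betw \<Phi> (glued_polyhedron T r) (glued_polyhedron T' r')" and
      d: "\<forall>X \<in> glued_polyhedron T r. \<forall>Y \<in> glued_polyhedron T r.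
           glued_dist T' r' (\<Phi> X) (\<Phi> Y) = glued_dist T r X Y" and
      e: "\<forall>x\<in>M. \<Phi> (boundary_point T r x) = boundary_point T' r' x" and
      a: "\<Phi> (apex_point T r) = apex_point T' r'" unfolding couple_equiv_def by blast
    define \<Psi> where "\<Psi> = inv_into (glued_polyhedron T r) \<Phi>"
    have 1: "bij_betw \<Psi> (glued_polyhedron T' r') (glued_polyhedron T r)"
      unfolding \<Psi>_def by (rule bij_betw_inv_into[OF b])
    have 2: "\<Psi> (\<Phi> X) = X" if "X \<in> glued_polyhedron T r" for X
      unfolding \<Psi>_def by (rule bij_betw_inv_into_left[OF b that])
    have 3: "\<Phi> (\<Psi> X) = X" if "X \<in> glued_polyhedron T' r'" for X
      unfolding \<Psi>_def by (rule bij_betw_inv_into_right[OF b that])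
    have 4: "\<Psi> X \<in> glued_polyhedron T r" if "X \<in> glued_polyhedron T' r'" for X
      using 1 that by (rule bij_betwE[THEN bspec])
    have "\<forall>X \<in> glued_polyhedron T' r'. \<forall>Y \<in> glued_polyhedron T' r'.
           glued_dist T r (\<Psi> X) (\<Psi> Y) = glued_dist T' r' X Y" using d 3 4 by metis
    moreover have "\<forall>x\<in>M. \<Psi> (boundary_point T' r' x) = boundary_point T r x"
      using e 2 boundary_point_in[OF c(1)] by metis
    moreover have "\<Psi> (apex_point T' r') = apex_point T r"
      using a 2 apex_point_in[OF c(1) assms] by metis
    ultimately show "(q, p) \<in> couple_equiv M" using 1 c unfolding pq couple_equiv_def by blast
  qed
  show "trans (couple_equiv M)"
  proof (rule transI)
    fix p q s assume "(p, q) \<in> couple_equiv M" "(q, s) \<in> couple_equiv M"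
    then obtain T r T' r' T'' r'' \<Phi> \<Psi> where pq: "p = (T, r)" "s = (T'', r'')" and
      c: "(T, r) \<in> couples M" "(T'', r'') \<in> couples M" and
      b: "bij_betw \<Phi> (glued_polyhedron T r) (glued_polyhedron T' r')" "bij_betw \<Psi> (glued_polyhedron T' r') (glued_polyhedron T'' r'')" and
      d: "\<forall>X \<in> glued_polyhedron T r. \<forall>Y \<in> glued_polyhedron T r.
           glued_dist T' r' (\<Phi> X) (\<Phi> Y) = glued_dist T r X Y"
         "\<forall>X \<in> glued_polyhedron T' r'. \<forall>Y \<in> glued_polyhedron T' r'.
           glued_dist T'' r'' (\<Psi> X) (\<Psi> Y) = glued_dist T' r' X Y" and
      e: "\<forall>x\<in>M. \<Phi> (boundary_point T r x) = boundary_point T' r' x"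
         "\<forall>x\<in>M. \<Psi> (boundary_point T' r' x) = boundary_point T'' r'' x" and
      a: "\<Phi> (apex_point T r) = apex_point T' r'" "\<Psi> (apex_point T' r') = apex_point T'' r''"
      unfolding couple_equiv_def by blast
    have "bij_betw (\<Psi> \<circ> \<Phi>) (glued_polyhedron T r) (glued_polyhedron T'' r'')" using b by (rule bij_betw_trans)
    moreover have "\<forall>X \<in> glued_polyhedron T r. \<forall>Y \<in> glued_polyhedron T r.
           glued_dist T'' r'' ((\<Psi> \<circ> \<Phi>) X) ((\<Psi> \<circ> \<Phi>) Y) = glued_dist T r X Y"
      using d bij_betwE[OF b(1)] by simp
    moreover have "\<forall>x\<in>M. (\<Psi> \<circ> \<Phi>) (boundary_point T r x) = boundary_point T'' r'' x"
      using e by simp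
    moreover have "(\<Psi> \<circ> \<Phi>) (apex_point T r) = apex_point T'' r''" using a by simp
    ultimately show "(p, s) \<in> couple_equiv M" using c unfolding pq couple_equiv_def by blast
  qed
qed

end

theory Submission
  imports Defs
begin

text \<open>
  Let \<open>q\<^sub>T\<close> be the function on \<open>M\<close> that assigns to a boundary point the square of its distance
  to the apex of the polytope \<open>(T, r)\<close>. On each face it is \<open>|x - p|\<^sup>2 + h\<^sup>2\<close> in plane coordinates, and
  across an edge the condition \<open>\<theta> \<le> \<pi>\<close> says exactly that its slope jumps downwards. So for a convex
  polytope \<open>q\<^sub>T - |x|\<^sup>2\<close> is concave along every geodesic that avoids the singular points. On a face of
  \<open>T'\<close> the difference \<open>q\<^sub>T - q\<^sub>T\<^sub>'\<close> is therefore concave, and it vanishes at the corners if the radii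
  agree; hence \<open>q\<^sub>T \<ge> q\<^sub>T\<^sub>'\<close>, and by symmetry \<open>q\<^sub>T = q\<^sub>T\<^sub>'\<close>. The map that sends the segment from the apex
  to a boundary point of one polytope linearly to the corresponding segment of the other is then
  isometric.
\<close>

section \<open>Plane triangles\<close>

text \<open>The edges of \<open>T\<close> and \<open>T'\<close> may cross in a complicated way, so
  no common refinement is built. Concavity enters only as a midpoint inequality at each non-vertex
  point, phrased in distances of \<open>M\<close>; it is proved with the faces of \<open>T\<close>
  and applied to segments in a face of \<open>T'\<close>. For this, charts must show that a point of
  an edge has exactly two preimages, around which the faces unfold to complementary half-discs. Both
  may lie in one face, so preimages are pairs of a face and a point.

  Two sides over one edge are matched by \<open>place\<close> as sets and only locally
  isometrically, so that q_T is single-valued on edges needs a proof, again by midpoints. Convexity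
  of \<open>P\<close> is known for some couple in it, perhaps not the given one; the radii carry
  over because \<open>r v\<close> is the glued distance from the apex to the boundary point of
  \<open>v\<close>.

  For the isometry, the pieces cut from a segment by the other triangulation are not enumerated: a
  local Lipschitz bound is added up along the segment, and its ends, which may lie over vertices,
  are reached by continuity.\<close>

definition rot :: "real^2 \<Rightarrow> real^2" where
  "rot v = vector [- v$2, v$1]"

lemma rot_nth [simp]: "rot v $ 1 = - v$2" "rot v $ 2 = v$1"
  by (simp_all add: rot_def)

lemma inner_vec2: "(u::real^2) \<bullet> v = u$1 * v$1 + u$2 * v$2"
  by (simp add: inner_vec_def sum_2)

lemma vec2_eq_iff: "(u::real^2) = v \<longleftrightarrow> u$1 = v$1 \<and> u$2 = v$2"
  by (simp add: vec_eq_iff forall_2)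

lemma inner_rot_self [simp]: "v \<bullet> rot v = 0" "rot v \<bullet> v = 0"
  by (simp_all add: inner_vec2)

lemma inner_rot_rot [simp]: "rot u \<bullet> rot v = u \<bullet> v"
  by (simp add: inner_vec2)

lemma norm_rot [simp]: "norm (rot v) = norm v"
  by (simp add: norm_eq_sqrt_inner)

lemma rot_scaleR: "rot (c *\<^sub>R v) = c *\<^sub>R rot v"
  by (simp add: vec2_eq_iff)

lemma orthonormal_expansion:
  assumes "norm n = 1"
  shows "v = (v \<bullet> n) *\<^sub>R n + (v \<bullet> rot n) *\<^sub>R rot n"
proof -
  have "n$1 * n$1 + n$2 * n$2 = 1"
    using assms by (simp add: norm_eq_1 inner_vec2)
  then show ?thesis
    by (simp add: vec2_eq_iff inner_vec2; intro conjI; algebra)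
qed

lemma orthonormal_inner:
  assumes "norm n = 1"
  shows "u \<bullet> v = (u \<bullet> n) * (v \<bullet> n) + (u \<bullet> rot n) * (v \<bullet> rot n)"
proof -
  have "n$1 * n$1 + n$2 * n$2 = 1"
    using assms by (simp add: norm_eq_1 inner_vec2)
  then show ?thesis
    by (simp add: inner_vec2) algebra
qed

section \<open>Barycentric coordinates of a triangle\<close>

definition double_area :: "'a face \<Rightarrow> real" where
  "double_area f = rot (corner f 2 - corner f 1) \<bullet> (corner f 3 - corner f 1)"

text \<open>The gradient of the barycentric coordinate of corner \<open>k\<close>. Since
  \<open>double_area\<close> carries a sign, the vector points into the triangle for either
  orientation of the corners.\<close>

definition grad :: "'a face \<Rightarrow> 3 \<Rightarrow> real^2" where
  "grad f k = (1 / double_area f) *\<^sub>R rot (corner f (k + 2) - corner f (k + 1))"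

definition bary :: "'a face \<Rightarrow> 3 \<Rightarrow> real^2 \<Rightarrow> real" where
  "bary f k y = grad f k \<bullet> (y - corner f (k + 1))"

lemma double_area_nonzero:
  assumes "\<not> collinear (range (corner f))"
  shows "double_area f \<noteq> 0"
proof
  assume 0: "double_area f = 0"
  define u v where "u = corner f 2 - corner f 1" and "v = corner f 3 - corner f 1"
  have det: "u$1 * v$2 = u$2 * v$1"
    using 0 by (simp add: double_area_def inner_vec2 u_def v_def) (simp add: algebra_simps)
  have r: "range (corner f) = {corner f 2, corner f 1, corner f 3}"
    by (auto simp: image_iff) (metis exhaust_3)
  have "u \<noteq> 0"
  proof
    assume "u = 0"
    then have "range (corner f) = {corner f 1, corner f 3}"
      unfolding r by (auto simp: u_def)
    then show False using assms by simp
  qed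
  have "\<exists>c. v = c *\<^sub>R u"
  proof (cases "u$1 = 0")
    case True
    then have "u$2 \<noteq> 0" using \<open>u \<noteq> 0\<close> by (simp add: vec2_eq_iff)
    then show ?thesis using det True
      by (intro exI[of _ "v$2 / u$2"]) (simp add: vec2_eq_iff)
  next
    case False
    then show ?thesis using det
      by (intro exI[of _ "v$1 / u$1"]) (simp add: vec2_eq_iff field_simps)
  qed
  then have "collinear {0, u, v}" using collinear_lemma by blast
  then have "collinear (range (corner f))"
    unfolding r u_def v_def by (subst collinear_3) (simp_all add: NO_MATCH_def)
  then show False using assms by simp
qed

lemma bary_add: "bary f k (x + v) = bary f k x + grad f k \<bullet> v"
  by (simp add: bary_def inner_diff_right inner_add_right)

lemma bary_diff: "bary f k y - bary f k x = grad f k \<bullet> (y - x)"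
  by (simp add: bary_def inner_diff_right)

lemma continuous_bary [continuous_intros]:
  "continuous_on S g \<Longrightarrow> continuous_on S (\<lambda>x. bary f k (g x))"
  unfolding bary_def by (intro continuous_intros)

lemma grad_edge [simp]: "grad f k \<bullet> (corner f (k + 2) - corner f (k + 1)) = 0"
  by (simp add: grad_def)

lemma three_shift_cases: "l \<in> {k, k + 1, k + 2 :: 3}"
  using exhaust_3[of k] exhaust_3[of l] by auto

lemma UNIV_3_shift: "UNIV = {k, k + 1, k + 2 :: 3}"
  using three_shift_cases by blast

lemma three_numerals [simp]: "(4::3) = 1" "(5::3) = 2"
  by simp_all

lemma three_shift_neq [simp]: "k + 1 \<noteq> (k::3)" "k + 2 \<noteq> k" "k + 1 \<noteq> k + 2"
  using exhaust_3[of k] by auto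

context
  fixes f :: "'a face"
  assumes nc: "\<not> collinear (range (corner f))"
begin

lemma bary_corner: "bary f k (corner f j) = (if j = k then 1 else 0)"
proof -
  have d: "double_area f \<noteq> 0" by (rule double_area_nonzero[OF nc])
  have "bary f k (corner f j) = 
      rot (corner f (k + 2) - corner f (k + 1)) \<bullet> (corner f j - corner f (k + 1)) / double_area f"
    by (simp add: bary_def grad_def)
  also have "rot (corner f (k + 2) - corner f (k + 1)) \<bullet> (corner f j - corner f (k + 1))
      = (if j = k then double_area f else 0)"
    using exhaust_3[of k] exhaust_3[of j] unfolding double_area_def
    by (auto simp: inner_vec2 algebra_simps)
  finally show ?thesis using d by simp
qed

lemma grad_nonzero: "grad f k \<noteq> 0"
  using bary_corner[of k k] by (auto simp: bary_def)

text \<open>The three side vectors close up, so the gradients add up to zero; the sum of the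
  coordinates is therefore constant and can be read off at a corner.\<close>

lemma bary_sum: "bary f 1 y + bary f 2 y + bary f 3 y = 1"
proof -
  have "grad f 1 + grad f 2 + grad f 3 = 0"
    unfolding grad_def by (simp add: vec2_eq_iff flip: scaleR_add_right)
  moreover have "bary f k y = bary f k (corner f 1) + grad f k \<bullet> (y - corner f 1)" for k
    using bary_diff[of f k y "corner f 1"] by simp
  ultimately show ?thesis
    by (simp add: bary_corner add.assoc flip: inner_add_left)
qed

lemma bary_expansion:
  "y = bary f 1 y *\<^sub>R corner f 1 + bary f 2 y *\<^sub>R corner f 2 + bary f 3 y *\<^sub>R corner f 3"
proof -
  have d: "double_area f \<noteq> 0" by (rule double_area_nonzero[OF nc])
  \<comment> \<open>Multiplying by the area clears the denominators and leaves a polynomial identity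
    in the coordinates.\<close>
  have "double_area f *\<^sub>R y = (double_area f * bary f 1 y) *\<^sub>R corner f 1
    + (double_area f * bary f 2 y) *\<^sub>R corner f 2 + (double_area f * bary f 3 y) *\<^sub>R corner f 3"
    using d by (simp add: bary_def grad_def)
      (simp add: vec2_eq_iff double_area_def inner_vec2; intro conjI; algebra)
  also have "\<dots> = double_area f *\<^sub>R (bary f 1 y *\<^sub>R corner f 1 + bary f 2 y *\<^sub>R corner f 2
    + bary f 3 y *\<^sub>R corner f 3)"
    by (simp add: scaleR_add_right)
  finally show ?thesis using d by simp
qed

lemma bary_expansion_shift:
  "y = bary f k y *\<^sub>R corner f k + bary f (k + 1) y *\<^sub>R corner f (k + 1)
    + bary f (k + 2) y *\<^sub>R corner f (k + 2)"
  using bary_expansion[of y] exhaust_3[of k] by (auto simp: add_ac)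

lemma bary_sum_shift: "bary f k y + bary f (k + 1) y + bary f (k + 2) y = 1"
  using bary_sum[of y] exhaust_3[of k] by (auto simp: add_ac)

lemma range_corner: "range (corner f) = {corner f k, corner f (k + 1), corner f (k + 2)}"
  using UNIV_3_shift[of k] by (metis image_empty image_insert)

lemma base_triangle_bary: "base_triangle f = {y. \<forall>k. 0 \<le> bary f k y}"
proof (intro equalityI subsetI)
  fix y assume "y \<in> base_triangle f"
  then obtain u v w where uvw: "0 \<le> u" "0 \<le> v" "0 \<le> w" "u + v + w = 1"
    "y = u *\<^sub>R corner f 1 + v *\<^sub>R corner f 2 + w *\<^sub>R corner f 3"
    unfolding base_triangle_def range_corner[of 1] convex_hull_3 by auto
  have "bary f k y = u * bary f k (corner f 1) + v * bary f k (corner f 2) + w * bary f k (corner f 3)"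
    for k
  proof -
    have "y - corner f (k + 1) = y - (u + v + w) *\<^sub>R corner f (k + 1)" using uvw by simp
    also have "\<dots> = u *\<^sub>R (corner f 1 - corner f (k + 1)) + v *\<^sub>R (corner f 2 - corner f (k + 1))
        + w *\<^sub>R (corner f 3 - corner f (k + 1))"
      unfolding uvw(5) by (simp add: algebra_simps)
    finally show ?thesis unfolding bary_def by (simp add: inner_add_right)
  qed
  then show "y \<in> {y. \<forall>k. 0 \<le> bary f k y}" using uvw by (simp add: bary_corner)
next
  fix y assume "y \<in> {y. \<forall>k. 0 \<le> bary f k y}"
  then show "y \<in> base_triangle f"
    unfolding base_triangle_def range_corner[of 1] convex_hull_3
    using bary_expansion[of y] bary_sum[of y] by auto
qed

lemma interior_base_triangle: "interior (base_triangle f) = {y. \<forall>k. 0 < bary f k y}"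
proof -
  define H where "H = (\<lambda>k. {y. grad f k \<bullet> corner f (k + 1) \<le> grad f k \<bullet> y})"
  have "base_triangle f = H 1 \<inter> (H 2 \<inter> H 3)"
    by (auto simp: base_triangle_bary H_def bary_def inner_diff_right forall_3)
  then have "interior (base_triangle f) = interior (H 1) \<inter> (interior (H 2) \<inter> interior (H 3))"
    by simp
  also have "\<dots> = {y. \<forall>k. 0 < bary f k y}"
    unfolding H_def interior_halfspace_ge[OF grad_nonzero]
    by (auto simp: bary_def inner_diff_right forall_3)
  finally show ?thesis .
qed

lemma corner_inj: "corner f i = corner f j \<longleftrightarrow> i = j"
  using bary_corner[of i i] bary_corner[of i j] by (auto split: if_splits)

lemma open_side_bary:
  "open_side f k = {y. bary f k y = 0 \<and> 0 < bary f (k + 1) y \<and> 0 < bary f (k + 2) y}"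
proof (intro equalityI subsetI)
  fix y assume "y \<in> open_side f k"
  then obtain s where s: "0 < s" "s < 1" and
    y: "y = (1 - s) *\<^sub>R corner f (k + 1) + s *\<^sub>R corner f (k + 2)"
    unfolding open_side_def in_segment by blast
  have "y = corner f (k + 1) + s *\<^sub>R (corner f (k + 2) - corner f (k + 1))"
    unfolding y by (simp add: algebra_simps)
  then have "bary f j y = bary f j (corner f (k + 1)) +
      s * (bary f j (corner f (k + 2)) - bary f j (corner f (k + 1)))" for j
    using bary_diff[of f j "corner f (k + 2)" "corner f (k + 1)"] by (simp add: bary_add)
  then show "y \<in> {y. bary f k y = 0 \<and> 0 < bary f (k + 1) y \<and> 0 < bary f (k + 2) y}"
    using s by (simp add: bary_corner three_shift_neq[symmetric])
next
  fix y assume y: "y \<in> {y. bary f k y = 0 \<and> 0 < bary f (k + 1) y \<and> 0 < bary f (k + 2) y}"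
  then have 1: "bary f (k + 1) y = 1 - bary f (k + 2) y" using bary_sum_shift[of k y] by simp
  have "y = (1 - bary f (k + 2) y) *\<^sub>R corner f (k + 1) + bary f (k + 2) y *\<^sub>R corner f (k + 2)"
    using bary_expansion_shift[of y k] y unfolding 1 by simp
  moreover have "corner f (k + 1) \<noteq> corner f (k + 2)" by (simp add: corner_inj)
  ultimately show "y \<in> open_side f k"
    using y 1 unfolding open_side_def in_segment by (auto intro!: exI[of _ "bary f (k + 2) y"])
qed

lemma corner_mem: "corner f k \<in> base_triangle f"
  by (simp add: base_triangle_def hull_inc)

lemma open_side_subset: "open_side f k \<subseteq> base_triangle f"
proof
  fix y assume "y \<in> open_side f k"
  then have "\<forall>j\<in>{k, k + 1, k + 2}. 0 \<le> bary f j y" by (auto simp: open_side_bary)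
  then show "y \<in> base_triangle f"
    unfolding UNIV_3_shift[of k, symmetric] by (simp add: base_triangle_bary)
qed

lemma open_side_unique:
  assumes "y \<in> open_side f k" "y \<in> open_side f l"
  shows "k = l"
proof (rule ccontr)
  assume "k \<noteq> l"
  then have "l \<in> {k + 1, k + 2}" using three_shift_cases[of l k] by blast
  then show False using assms by (auto simp: open_side_bary)
qed

lemma open_side_not_corner: "open_side f k \<inter> range (corner f) = {}"
proof -
  have "corner f j \<notin> open_side f k" for j
  proof -
    have "j \<in> {k, k + 1, k + 2}" by (rule three_shift_cases)
    then show ?thesis by (auto simp: open_side_bary bary_corner)
  qed
  then show ?thesis by blast
qed

lemma interior_not_corner: "interior (base_triangle f) \<inter> range (corner f) = {}"
proof -
  have "\<not> 0 < bary f (j + 1) (corner f j)" for j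
    by (simp add: bary_corner three_shift_neq[symmetric])
  then show ?thesis unfolding interior_base_triangle by blast
qed

lemma base_triangle_cases:
  assumes "y \<in> base_triangle f"
  obtains (corner) k where "y = corner f k"
  | (side) k where "y \<in> open_side f k"
  | (interior) "y \<in> interior (base_triangle f)"
proof (cases "\<forall>k. 0 < bary f k y")
  case True
  then show ?thesis using interior by (simp add: interior_base_triangle)
next
  case False
  have nonneg: "0 \<le> bary f k y" for k using assms by (simp add: base_triangle_bary)
  then obtain k where k: "bary f k y = 0" using False by (metis order_le_less)
  consider "bary f (k + 1) y = 0" | "bary f (k + 2) y = 0"
    | "0 < bary f (k + 1) y" "0 < bary f (k + 2) y"
    using nonneg by (metis order_le_less)
  then show ?thesis
  proof cases
    case 1
    then have "y = corner f (k + 2)"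
      using bary_expansion_shift[of y k] bary_sum_shift[of k y] k by simp
    then show ?thesis by (rule corner)
  next
    case 2
    then have "y = corner f (k + 1)"
      using bary_expansion_shift[of y k] bary_sum_shift[of k y] k by simp
    then show ?thesis by (rule corner)
  next
    case 3
    then show ?thesis using side k by (simp add: open_side_bary)
  qed
qed

text \<open>Near a point of the open side \<open>k\<close> the other two coordinates stay positive,
  so the sign of coordinate \<open>k\<close> alone decides membership.\<close>

lemma open_side_nhd:
  assumes "x \<in> open_side f k"
  obtains e where "0 < e"
    "base_triangle f \<inter> ball x e = {y \<in> ball x e. 0 \<le> (y - x) \<bullet> grad f k}"
    "interior (base_triangle f) \<inter> ball x e = {y \<in> ball x e. 0 < (y - x) \<bullet> grad f k}"
proof -
  have x: "bary f k x = 0" "0 < bary f (k + 1) x" "0 < bary f (k + 2) x"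
    using assms by (auto simp: open_side_bary)
  have "open {y. 0 < bary f (k + 1) y \<and> 0 < bary f (k + 2) y}"
    by (intro open_Collect_conj open_Collect_less continuous_intros)
  then obtain e where e: "e > 0" "ball x e \<subseteq> {y. 0 < bary f (k + 1) y \<and> 0 < bary f (k + 2) y}"
    using x open_contains_ball by blast
  have all: "(\<forall>j. P j) \<longleftrightarrow> P k \<and> P (k + 1) \<and> P (k + 2)" for P :: "3 \<Rightarrow> bool"
  proof -
    have "(\<forall>j. P j) \<longleftrightarrow> (\<forall>j\<in>{k, k + 1, k + 2}. P j)" unfolding UNIV_3_shift[of k, symmetric] by simp
    then show ?thesis by simp
  qed
  have 1: "bary f k y = (y - x) \<bullet> grad f k" for y
    using bary_diff[of f k y x] x by (simp add: inner_commute)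
  have 2: "0 < bary f (k + 1) y \<and> 0 < bary f (k + 2) y" if "y \<in> ball x e" for y
    using e that by blast
  show ?thesis
  proof (rule that[OF e(1)])
    show "base_triangle f \<inter> ball x e = {y \<in> ball x e. 0 \<le> (y - x) \<bullet> grad f k}"
      unfolding base_triangle_bary all using 1 2 by (auto simp: less_imp_le)
    show "interior (base_triangle f) \<inter> ball x e = {y \<in> ball x e. 0 < (y - x) \<bullet> grad f k}"
      unfolding interior_base_triangle all using 1 2 by auto
  qed
qed

text \<open>Extreme points of a convex hull are among its generators, so a point that is no corner
  lies inside a segment of the triangle. This supplies the symmetric pairs of points that the
  midpoint argument needs.\<close>

lemma non_corner_segment:
  assumes "x \<in> base_triangle f - range (corner f)"
  obtains v where "v \<noteq> 0" "\<And>t. \<bar>t\<bar> \<le> 1 \<Longrightarrow> x + t *\<^sub>R v \<in> base_triangle f"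
proof -
  have conv: "convex (base_triangle f)" by (simp add: base_triangle_def)
  have "\<not> x extreme_point_of base_triangle f"
    using assms extreme_point_of_convex_hull[of x "range (corner f)"] by (auto simp: base_triangle_def)
  then obtain a b where ab: "a \<in> base_triangle f" "b \<in> base_triangle f" "x \<in> open_segment a b"
    using assms by (auto simp: extreme_point_of_def)
  then obtain s where s: "a \<noteq> b" "0 < s" "s < 1" "x = (1 - s) *\<^sub>R a + s *\<^sub>R b"
    by (auto simp: in_segment)
  \<comment> \<open>The point divides the segment from \<open>a\<close> to \<open>b\<close> at
    parameter \<open>s\<close>; the smaller of \<open>s\<close> and \<open>1 - s\<close> is the
    largest step that stays in the segment in both directions.\<close>
  define v where "v = min s (1 - s) *\<^sub>R (b - a)"
  show ?thesis
  proof (rule that)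
    show "v \<noteq> 0" using s by (auto simp: v_def min_def)
    fix t :: real assume t: "\<bar>t\<bar> \<le> 1"
    define c where "c = s + t * min s (1 - s)"
    have "\<bar>t * min s (1 - s)\<bar> \<le> min s (1 - s)"
      using t s mult_left_le_one_le[of "min s (1 - s)" "\<bar>t\<bar>"] by (simp only: abs_mult) auto
    then have "0 \<le> c" "c \<le> 1" unfolding c_def by linarith+
    moreover have "x + t *\<^sub>R v = (1 - c) *\<^sub>R a + c *\<^sub>R b"
      by (simp add: s v_def c_def algebra_simps)
    ultimately show "x + t *\<^sub>R v \<in> base_triangle f"
      using convexD[OF conv ab(1,2), of "1 - c" c] by simp
  qed
qed

lemma compact_base_triangle: "compact (base_triangle f)"
  unfolding base_triangle_def by (intro compact_convex_hull finite_imp_compact) simp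

end

text \<open>
  Subtracting \<open>\<epsilon> |x|\<^sup>2\<close> makes the midpoint inequality strict, which excludes a minimum outside \<open>E\<close>.
\<close>

lemma midpoint_concave_nonneg:
  fixes F :: "'b::real_inner \<Rightarrow> real"
  assumes K: "compact K" and cont: "continuous_on K F" and E: "\<And>x. x \<in> E \<inter> K \<Longrightarrow> 0 \<le> F x"
    and mid: "\<And>x. x \<in> K - E \<Longrightarrow> \<exists>v. v \<noteq> 0 \<and> x + v \<in> K \<and> x - v \<in> K \<and> F (x + v) + F (x - v) \<le> 2 * F x"
    and x: "x \<in> K"
  shows "0 \<le> F x"
proof (rule ccontr)
  assume neg: "\<not> 0 \<le> F x"
  obtain B where B: "B > 0" "\<And>y. y \<in> K \<Longrightarrow> norm y \<le> B"
    using compact_imp_bounded[OF K] bounded_pos by blast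
  \<comment> \<open>With this value the perturbation is at most \<open>- F x / 2\<close> on
    \<open>K\<close>. On \<open>E\<close> the perturbed function is then at least
    \<open>F x / 2\<close>, still above its value at \<open>x\<close>, so its minimum lies outside
    \<open>E\<close>.\<close>
  define \<epsilon> where "\<epsilon> = - F x / (2 * B\<^sup>2)"
  have \<epsilon>: "\<epsilon> > 0" "\<epsilon> * B\<^sup>2 = - F x / 2" using neg B by (auto simp: \<epsilon>_def divide_neg_pos field_simps)
  define G where "G = (\<lambda>y. F y - \<epsilon> * (y \<bullet> y))"
  have "continuous_on K G" unfolding G_def by (intro continuous_intros cont)
  then obtain y where y: "y \<in> K" "\<And>z. z \<in> K \<Longrightarrow> G y \<le> G z"
    using continuous_attains_inf[OF K] x by blast
  show False
  proof (cases "y \<in> E")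
    case True
    then have "F y \<ge> 0" using E y by blast
    moreover have "y \<bullet> y \<le> B\<^sup>2"
      using B(2)[OF y(1)] by (simp add: power2_norm_eq_inner[symmetric] power_mono)
    then have "\<epsilon> * (y \<bullet> y) \<le> \<epsilon> * B\<^sup>2" using \<epsilon>(1) by (intro mult_left_mono) auto
    ultimately have "G y \<ge> F x / 2" using \<epsilon> by (simp add: G_def)
    moreover have "G x \<le> F x" using \<epsilon> by (simp add: G_def)
    ultimately show False using y(2)[OF x] neg by linarith
  next
    case False
    then obtain v where v: "v \<noteq> 0" "y + v \<in> K" "y - v \<in> K" "F (y + v) + F (y - v) \<le> 2 * F y"
      using mid y by blast
    have "G (y + v) + G (y - v) \<le> 2 * G y - 2 * (\<epsilon> * (v \<bullet> v))"
      using v(4) by (simp add: G_def inner_add_left inner_add_right inner_diff_left inner_diff_right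
        inner_commute algebra_simps)
    moreover have "\<epsilon> * (v \<bullet> v) > 0" using \<epsilon> v by simp
    ultimately show False using y(2)[OF v(2)] y(2)[OF v(3)] by linarith
  qed
qed

text \<open>The points of \<open>K\<close> at distance at least \<open>e\<close> from the fibre over
  \<open>m\<close> form a compact set on which the distance of the image to \<open>m\<close> has a
  positive minimum.\<close>

lemma nearby_preimage:
  fixes p :: "'b::metric_space \<Rightarrow> 'c::metric_space"
  assumes K: "compact K" and p: "continuous_on K p" and e: "0 < e"
  obtains d where "0 < d" "\<And>y. y \<in> K \<Longrightarrow> dist (p y) m < d \<Longrightarrow> \<exists>x\<in>K. p x = m \<and> dist x y < e"
proof -
  define L where "L = {y\<in>K. \<forall>x\<in>K. p x = m \<longrightarrow> e \<le> dist x y}"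
  have "L = K \<inter> (\<Inter>x\<in>{x\<in>K. p x = m}. - ball x e)"
    unfolding L_def by (intro set_eqI) (auto simp: not_less)
  moreover have "closed (\<Inter>x\<in>{x\<in>K. p x = m}. - ball x e)" by (intro closed_INT) auto
  ultimately have L: "compact L" using K by (simp add: compact_Int_closed)
  have near: "\<exists>x\<in>K. p x = m \<and> dist x y < e" if "y \<in> K" "y \<notin> L" for y
    using that unfolding L_def mem_Collect_eq by (metis not_le)
  show ?thesis
  proof (cases "L = {}")
    case True
    then show ?thesis using near by (intro that[of 1]) auto
  next
    case False
    have "continuous_on L (\<lambda>y. dist (p y) m)"
      by (intro continuous_intros continuous_on_subset[OF p]) (auto simp: L_def)
    then obtain y where y: "y \<in> L" "\<And>z. z \<in> L \<Longrightarrow> dist (p y) m \<le> dist (p z) m"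
      using continuous_attains_inf[OF L False] by blast
    show ?thesis
    proof (rule that)
      show "0 < dist (p y) m" using y(1) e by (force simp: L_def)
      show "\<exists>x\<in>K. p x = m \<and> dist x z < e" if "z \<in> K" "dist (p z) m < dist (p y) m" for z
        using y(2)[of z] near[of z] that by linarith
    qed
  qed
qed

text \<open>A continuous map from a compact space to a Hausdorff space is closed, so continuity on
  the image may be tested on the source. This carries functions from the triangles over to
  \<open>M\<close>.\<close>

lemma continuous_on_compact_image:
  fixes p :: "'b::topological_space \<Rightarrow> 'c::t2_space" and Q :: "'c \<Rightarrow> 'd::topological_space"
  assumes K: "compact K" and p: "continuous_on K p" and Qp: "continuous_on K (\<lambda>x. Q (p x))"
  shows "continuous_on (p ` K) Q"
  unfolding continuous_on_closed_vimage[OF compact_imp_closed[OF compact_continuous_image[OF p K]]]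
proof (intro allI impI)
  fix B :: "'d set" assume B: "closed B"
  have "Q -` B \<inter> p ` K = p ` (K \<inter> (\<lambda>x. Q (p x)) -` B)" by auto
  moreover have "compact (K \<inter> (\<lambda>x. Q (p x)) -` B)"
    using continuous_closedin_preimage[OF Qp B] closedin_compact[OF K] by auto
  then have "compact (p ` (K \<inter> (\<lambda>x. Q (p x)) -` B))"
    by (intro compact_continuous_image continuous_on_subset[OF p]) auto
  ultimately show "closed (Q -` B \<inter> p ` K)" by (simp add: compact_imp_closed)
qed

section \<open>The local structure of a geodesic triangulation\<close>

lemma finite_uniform_radius:
  fixes P :: "'b \<Rightarrow> real \<Rightarrow> bool"
  assumes "finite S" and "\<And>s. s \<in> S \<Longrightarrow> \<exists>d>0. P s d"
    and mono: "\<And>s d d'. P s d \<Longrightarrow> 0 < d' \<Longrightarrow> d' \<le> d \<Longrightarrow> P s d'"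
  obtains d where "0 < d" "\<And>s. s \<in> S \<Longrightarrow> P s d"
proof -
  have "\<exists>d>0. \<forall>s\<in>S. P s d"
    using assms(1,2)
  proof (induction S rule: finite_induct)
    case empty
    then show ?case by (auto intro!: exI[of _ 1])
  next
    case (insert s S)
    then obtain d1 d2 where d: "d1 > 0" "\<forall>s\<in>S. P s d1" "d2 > 0" "P s d2" by (metis insertCI)
    then have "\<forall>t\<in>insert s S. P t (min d1 d2)"
      using mono[of _ d1 "min d1 d2"] mono[of _ d2 "min d1 d2"] by simp
    then show ?case using d by (intro exI[of _ "min d1 d2"]) simp
  qed
  then show ?thesis using that by blast
qed

text \<open>A distance-preserving map on a half-disc is the restriction of a rigid motion. The set
  \<open>S\<close> may be larger than the half-disc, so one statement serves side points and
  interior points of a face.\<close>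

lemma half_disc_isometry:
  fixes \<phi> :: "real^2 \<Rightarrow> real^2"
  assumes e: "0 < e" and n: "norm n = 1" and S: "{y \<in> ball x e. 0 \<le> (y - x) \<bullet> n} \<subseteq> S"
    and iso: "\<And>y z. y \<in> S \<inter> ball x e \<Longrightarrow> z \<in> S \<inter> ball x e \<Longrightarrow> dist (\<phi> y) (\<phi> z) = dist y z"
  obtains N \<sigma> where "norm N = 1" "\<sigma> = 1 \<or> \<sigma> = (-1::real)"
    "\<And>y. y \<in> S \<inter> ball x e \<Longrightarrow>
      \<phi> y = \<phi> x + ((y - x) \<bullet> n) *\<^sub>R N + (\<sigma> * ((y - x) \<bullet> rot n)) *\<^sub>R rot N"
proof -
  define c where "c = e / 2"
  have c: "c > 0" "c < e" using e by (auto simp: c_def)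
  define \<psi> where "\<psi> = (\<lambda>y. \<phi> y - \<phi> x)"
  have xS: "x \<in> S \<inter> ball x e" using S e by auto
  \<comment> \<open>Polarization: with \<open>x\<close> as origin, preserved distances give
    preserved inner products.\<close>
  have inner: "\<psi> y \<bullet> \<psi> z = (y - x) \<bullet> (z - x)" if y: "y \<in> S \<inter> ball x e" and z: "z \<in> S \<inter> ball x e" for y z
  proof -
    have "norm (\<psi> y) = norm (y - x)" "norm (\<psi> z) = norm (z - x)" "norm (\<psi> y - \<psi> z) = norm (y - z)"
      using iso[OF y xS] iso[OF z xS] iso[OF y z] by (simp_all add: \<psi>_def dist_norm)
    moreover have "y - z = (y - x) - (z - x)" by simp
    ultimately show ?thesis unfolding dot_norm_neg by metis
  qed
  \<comment> \<open>One point on the inner normal and one on the bounding diameter; both belong to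
    the closed half-disc, and their images fix the motion. Halving \<open>e\<close> keeps them in
    the open ball.\<close>
  define u v where "u = x + c *\<^sub>R n" and "v = x + c *\<^sub>R rot n"
  have uv: "u - x = c *\<^sub>R n" "v - x = c *\<^sub>R rot n" by (simp_all add: u_def v_def)
  have nn: "n \<bullet> n = 1" using n by (simp add: norm_eq_1)
  have u: "u \<in> S \<inter> ball x e" and v: "v \<in> S \<inter> ball x e"
    using S c n by (auto simp: u_def v_def dist_norm nn intro!: subsetD[OF S])
  define N W where "N = (1 / c) *\<^sub>R \<psi> u" and "W = (1 / c) *\<^sub>R \<psi> v"
  have NN: "N \<bullet> N = 1" and WW: "W \<bullet> W = 1" and WN: "W \<bullet> N = 0"
    using inner[OF u u] inner[OF v v] inner[OF v u] c nn unfolding N_def W_def uv by simp_all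
  have N1: "norm N = 1" using NN by (simp add: norm_eq_1)
  define \<sigma> where "\<sigma> = W \<bullet> rot N"
  have W: "W = \<sigma> *\<^sub>R rot N" using orthonormal_expansion[OF N1, of W] WN by (simp add: \<sigma>_def)
  have "\<sigma> * \<sigma> = 1" using WW NN by (simp add: W)
  then have \<sigma>: "\<sigma> = 1 \<or> \<sigma> = -1" by (simp add: square_eq_1_iff)
  show ?thesis
  proof (rule that[OF N1 \<sigma>])
    fix y assume y: "y \<in> S \<inter> ball x e"
    have "\<psi> y \<bullet> N = (y - x) \<bullet> n" using inner[OF y u] c unfolding N_def uv by simp
    moreover have "\<psi> y \<bullet> W = (y - x) \<bullet> rot n" using inner[OF y v] c unfolding W_def uv by simp
    then have "\<sigma> * (\<psi> y \<bullet> rot N) = (y - x) \<bullet> rot n" by (simp add: W)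
    then have "\<psi> y \<bullet> rot N = \<sigma> * ((y - x) \<bullet> rot n)" using \<sigma> by auto
    ultimately have "\<psi> y = ((y - x) \<bullet> n) *\<^sub>R N + (\<sigma> * ((y - x) \<bullet> rot n)) *\<^sub>R rot N"
      using orthonormal_expansion[OF N1, of "\<psi> y"] by simp
    moreover have "\<phi> y = \<phi> x + \<psi> y" by (simp add: \<psi>_def)
    ultimately show "\<phi> y = \<phi> x + ((y - x) \<bullet> n) *\<^sub>R N + (\<sigma> * ((y - x) \<bullet> rot n)) *\<^sub>R rot N"
      by (simp only: add.assoc)
  qed
qed

lemma Int_ball_mono:
  assumes "S \<inter> ball x e = {y \<in> ball x e. P y}" "e' \<le> e"
  shows "S \<inter> ball x e' = {y \<in> ball x e'. P y}"
proof -
  have "ball x e' \<subseteq> ball x e" using assms(2) by (rule subset_ball)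
  then show ?thesis using assms(1) unfolding set_eq_iff Int_iff mem_Collect_eq subset_iff by metis
qed

text \<open>The inner unit normal of the side.\<close>

definition side_normal :: "'a face \<Rightarrow> 3 \<Rightarrow> real^2" where
  "side_normal f k = sgn (grad f k)"

lemma side_normal_props:
  assumes nc: "\<not> collinear (range (corner f))"
  shows norm_side_normal: "norm (side_normal f k) = 1"
    and side_normal_edge: "side_normal f k \<bullet> (corner f (k + 2) - corner f (k + 1)) = 0"
    and side_normal_apex: "0 < side_normal f k \<bullet> (corner f k - corner f (k + 1))"
proof -
  have g: "grad f k \<noteq> 0" by (rule grad_nonzero[OF nc])
  then show "norm (side_normal f k) = 1" by (simp add: side_normal_def norm_sgn)
  show "side_normal f k \<bullet> (corner f (k + 2) - corner f (k + 1)) = 0"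
    by (simp add: side_normal_def sgn_div_norm)
  have "grad f k \<bullet> (corner f k - corner f (k + 1)) = 1"
    using bary_corner[OF nc, of k k] by (simp add: bary_def)
  then show "0 < side_normal f k \<bullet> (corner f k - corner f (k + 1))"
    using g by (simp add: side_normal_def sgn_div_norm)
qed

lemma open_side_half_disc:
  assumes nc: "\<not> collinear (range (corner f))" and x: "x \<in> open_side f k"
  obtains e where "0 < e"
    "base_triangle f \<inter> ball x e = {y \<in> ball x e. 0 \<le> (y - x) \<bullet> side_normal f k}"
    "interior (base_triangle f) \<inter> ball x e = {y \<in> ball x e. 0 < (y - x) \<bullet> side_normal f k}"
proof -
  have "0 < inverse (norm (grad f k))" using grad_nonzero[OF nc] by simp
  then have "0 \<le> v \<bullet> side_normal f k \<longleftrightarrow> 0 \<le> v \<bullet> grad f k" "0 < v \<bullet> side_normal f k \<longleftrightarrow> 0 < v \<bullet> grad f k" for v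
    by (simp_all add: side_normal_def sgn_div_norm zero_le_mult_iff zero_less_mult_iff)
  then show ?thesis using open_side_nhd[OF nc x] that by auto
qed

section \<open>Cells, faces and the preimages of a point of M\<close>

locale polyhedral_triangulation =
  fixes M :: "'a::metric_space set" and T :: "'a face set"
  assumes metric: "polyhedral_metric M" and tri: "geodesic_triangulation M T"
begin

text \<open>Pairs rather than points: different faces may overlap as triangles of the plane, and one
  face may meet \<open>m\<close> in several points.\<close>

definition preimages :: "'a \<Rightarrow> ('a face \<times> (real^2)) set" where
  "preimages m = {(f, x). f \<in> T \<and> x \<in> base_triangle f \<and> place f x = m}"

lemma finite_T: "finite T"
  using tri by (simp add: geodesic_triangulation_def)

lemma face_props:
  assumes "f \<in> T"
  shows noncollinear: "\<not> collinear (range (corner f))"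
    and place_in: "x \<in> base_triangle f \<Longrightarrow> place f x \<in> M"
    and place_cont: "continuous_on (base_triangle f) (place f)"
    and place_inj_interior: "inj_on (place f) (interior (base_triangle f))"
    and place_inj_side: "inj_on (place f) (open_side f k)"
proof -
  have "geodesic_triangle M f" using assms tri by (simp add: geodesic_triangulation_def)
  then show "\<not> collinear (range (corner f))" "x \<in> base_triangle f \<Longrightarrow> place f x \<in> M"
    "continuous_on (base_triangle f) (place f)" "inj_on (place f) (interior (base_triangle f))"
    "inj_on (place f) (open_side f k)"
    unfolding geodesic_triangle_def by blast+
qed

lemma place_local_isometry:
  assumes "f \<in> T" "x \<in> base_triangle f - range (corner f)"
  obtains e where "0 < e" "\<And>y z. y \<in> base_triangle f \<inter> ball x e \<Longrightarrow> z \<in> base_triangle f \<inter> ball x e \<Longrightarrow>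
    dist (place f y) (place f z) = dist y z"
proof -
  have "geodesic_triangle M f" using assms(1) tri by (simp add: geodesic_triangulation_def)
  then have "\<exists>e>0. \<forall>y\<in>base_triangle f \<inter> ball x e. \<forall>z\<in>base_triangle f \<inter> ball x e.
      dist (place f y) (place f z) = dist y z"
    unfolding geodesic_triangle_def using assms(2) by blast
  then show ?thesis using that by blast
qed

definition cells :: "'a set set" where
  "cells = (\<lambda>v. {v}) ` vertices T \<union> edges T \<union> open_face ` T"

lemma cell_eq:
  assumes "A \<in> cells" "B \<in> cells" "m \<in> A" "m \<in> B"
  shows "A = B"
proof -
  have "partition_on M cells" using tri unfolding geodesic_triangulation_def cells_def by blast
  then show ?thesis using assms partition_onD2 disjointD by blast
qed

lemma corner_vertex: "f \<in> T \<Longrightarrow> place f (corner f k) \<in> vertices T"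
  by (auto simp: vertices_def)

text \<open>A vertex is a cell of the partition by itself. If a side point or an interior point were
  sent to it, the whole open edge or open face would shrink to one point, against injectivity of
  \<open>place\<close> on the side or the interior.\<close>

lemma vertex_preimage:
  assumes f: "f \<in> T" and x: "x \<in> base_triangle f" and v: "place f x \<in> vertices T"
  shows "x \<in> range (corner f)"
proof (cases rule: base_triangle_cases[OF noncollinear[OF f] x])
  case (1 k)
  then show ?thesis by simp
next
  case (2 k)
  have "open_edge f k = {place f x}"
    by (rule cell_eq[of _ _ "place f x"]) (use f 2 v in \<open>auto simp: cells_def edges_def open_edge_def\<close>)
  then have "finite (open_side f k)"
    using place_inj_side[OF f, of k] by (metis finite.emptyI finite.insertI finite_imageD open_edge_def)
  then show ?thesis
    unfolding open_side_def using corner_inj[OF noncollinear[OF f]] by simp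
next
  case 3
  have "open_face f = {place f x}"
    by (rule cell_eq[of _ _ "place f x"]) (use f 3 v in \<open>auto simp: cells_def open_face_def\<close>)
  then have "interior (base_triangle f) = {x}"
    using place_inj_interior[OF f] 3 unfolding open_face_def inj_on_def by blast
  then show ?thesis by (metis open_interior not_open_singleton)
qed

lemma non_vertex_iff:
  assumes "f \<in> T" "x \<in> base_triangle f"
  shows "place f x \<notin> vertices T \<longleftrightarrow> x \<notin> range (corner f)"
  using vertex_preimage[OF assms] corner_vertex[OF assms(1)] by blast

lemma preimages_nonempty:
  assumes "m \<in> M"
  obtains f x where "f \<in> T" "x \<in> base_triangle f" "place f x = m"
proof -
  have "partition_on M cells" using tri unfolding geodesic_triangulation_def cells_def by blast
  then have "M = \<Union>cells" by (rule partition_onD1)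
  then obtain A where A: "A \<in> cells" "m \<in> A" using assms by blast
  then consider (v) f k where "f \<in> T" "m = place f (corner f k)"
    | (e) f k where "f \<in> T" "m \<in> open_edge f k" | (i) f where "f \<in> T" "m \<in> open_face f"
    unfolding cells_def vertices_def edges_def by blast
  then show ?thesis
  proof cases
    case v
    then show ?thesis using that corner_mem[OF noncollinear[OF v(1)]] by metis
  next
    case e
    then show ?thesis using that open_side_subset[OF noncollinear[OF e(1)]] by (force simp: open_edge_def)
  next
    case i
    then show ?thesis using that interior_subset by (force simp: open_face_def)
  qed
qed

lemma interiors_disjoint:
  assumes "f \<in> T" "g \<in> T" "x \<in> interior (base_triangle f)" "y \<in> interior (base_triangle g)"
    "place f x = place g y"
  shows "f = g \<and> x = y"
proof -
  have "open_face f = open_face g"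
  proof (rule cell_eq)
    show "open_face f \<in> cells" "open_face g \<in> cells" using assms by (auto simp: cells_def)
    show "place f x \<in> open_face f" using assms(3) by (simp add: open_face_def)
    show "place f x \<in> open_face g" using assms(4) unfolding assms(5) by (simp add: open_face_def)
  qed
  then have "f = g" using tri assms(1,2) by (auto simp: geodesic_triangulation_def inj_on_def)
  then show ?thesis using place_inj_interior[OF assms(1)] assms by (auto simp: inj_on_def)
qed

lemma open_edge_eq:
  assumes "f \<in> T" "g \<in> T" "x \<in> open_side f k" "y \<in> open_side g l" "place f x = place g y"
  shows "open_edge f k = open_edge g l"
proof (rule cell_eq)
  show "open_edge f k \<in> cells" "open_edge g l \<in> cells" using assms by (auto simp: cells_def edges_def)
  show "place f x \<in> open_edge f k" using assms(3) by (simp add: open_edge_def)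
  show "place f x \<in> open_edge g l" using assms(4) unfolding assms(5) by (simp add: open_edge_def)
qed

text \<open>By compactness of the finitely many triangles, a point close to \<open>m\<close> is
  seen, in some face, close to a preimage of \<open>m\<close>.\<close>

lemma cover_nearby:
  assumes e: "0 < e"
  obtains d where "0 < d" "\<And>m'. m' \<in> M \<Longrightarrow> dist m' m < d \<Longrightarrow>
    \<exists>f x x'. (f, x) \<in> preimages m \<and> (f, x') \<in> preimages m' \<and> dist x x' < e"
proof -
  define P where "P = (\<lambda>f d. \<forall>y\<in>base_triangle f. dist (place f y) m < d \<longrightarrow>
    (\<exists>x\<in>base_triangle f. place f x = m \<and> dist x y < e))"
  obtain d where d: "d > 0" "\<And>f. f \<in> T \<Longrightarrow> P f d"
  proof (rule finite_uniform_radius[OF finite_T, of P])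
    fix f assume f: "f \<in> T"
    show "\<exists>d>0. P f d"
      using nearby_preimage[OF compact_base_triangle[OF noncollinear[OF f]] place_cont[OF f] e, of m]
      unfolding P_def by metis
  qed (auto simp: P_def)
  show ?thesis
  proof (rule that[OF d(1)])
    fix m' assume m': "m' \<in> M" "dist m' m < d"
    then obtain f y where "f \<in> T" "y \<in> base_triangle f" "place f y = m'" using preimages_nonempty by blast
    then show "\<exists>f x x'. (f, x) \<in> preimages m \<and> (f, x') \<in> preimages m' \<and> dist x x' < e"
      using d(2)[of f] m' unfolding P_def preimages_def by blast
  qed
qed

section \<open>Faces seen in a chart around a non-vertex point\<close>

definition chart :: "'a set \<Rightarrow> ('a \<Rightarrow> real^2) \<Rightarrow> bool" where
  "chart U h \<longleftrightarrow> openin (top_of_set M) U \<and> open (h ` U) \<and> (\<forall>x\<in>U. \<forall>y\<in>U. dist (h x) (h y) = dist x y)"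

lemma chart_exists:
  assumes "m \<in> M" "m \<notin> vertices T"
  obtains U h where "chart U h" "m \<in> U"
proof -
  have "regular_point M m"
    using assms metric tri by (auto simp: polyhedral_metric_def geodesic_triangulation_def)
  then show ?thesis using that unfolding regular_point_def chart_def by blast
qed

lemma chart_inj: "chart U h \<Longrightarrow> x \<in> U \<Longrightarrow> y \<in> U \<Longrightarrow> h x = h y \<Longrightarrow> x = y"
  unfolding chart_def by (metis dist_eq_0_iff)

text \<open>
  In the chart, the face \<open>f\<close> near its point \<open>x\<close> is the half-disc with inner normal \<open>N\<close>, or contains
  it; \<open>\<sigma>\<close> tells whether the chart preserves the orientation.
\<close>

definition piece where
  "piece U h f x e n N \<sigma> \<longleftrightarrow> 0 < e \<and> norm n = 1 \<and> norm N = 1 \<and> (\<sigma> = 1 \<or> \<sigma> = (-1::real)) \<and>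
     {y \<in> ball x e. 0 \<le> (y - x) \<bullet> n} \<subseteq> base_triangle f \<and>
     {y \<in> ball x e. 0 < (y - x) \<bullet> n} \<subseteq> interior (base_triangle f) \<and>
     (\<forall>y \<in> base_triangle f \<inter> ball x e. place f y \<in> U \<and>
        h (place f y) = h (place f x) + ((y - x) \<bullet> n) *\<^sub>R N + (\<sigma> * ((y - x) \<bullet> rot n)) *\<^sub>R rot N)"

text \<open>On a small enough ball \<open>place\<close> is isometric and stays in the domain of the
  chart, so \<open>h\<close> after \<open>place\<close> preserves distances and
  \<open>half_disc_isometry\<close> describes it.\<close>

lemma piece_exists:
  assumes ch: "chart U h" and f: "f \<in> T" and x: "x \<in> base_triangle f - range (corner f)"
    and U: "place f x \<in> U" and n: "norm n = 1" and e0: "0 < e0"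
    and "{y \<in> ball x e0. 0 \<le> (y - x) \<bullet> n} \<subseteq> base_triangle f"
    and "{y \<in> ball x e0. 0 < (y - x) \<bullet> n} \<subseteq> interior (base_triangle f)"
  obtains e N \<sigma> where "e \<le> e0" "piece U h f x e n N \<sigma>"
proof -
  obtain e1 where e1: "0 < e1" "\<And>y z. y \<in> base_triangle f \<inter> ball x e1 \<Longrightarrow> z \<in> base_triangle f \<inter> ball x e1 \<Longrightarrow>
      dist (place f y) (place f z) = dist y z"
    using place_local_isometry[OF f x] by metis
  have "U \<subseteq> M" "\<exists>d>0. \<forall>m'\<in>M. dist m' (place f x) < d \<longrightarrow> m' \<in> U"
    using ch U unfolding chart_def openin_euclidean_subtopology_iff by blast+
  then obtain d where d: "d > 0" "\<forall>m'\<in>M. dist m' (place f x) < d \<longrightarrow> m' \<in> U" by blast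
  define e where "e = min e0 (min e1 d)"
  have e: "0 < e" "e \<le> e0" "e \<le> e1" "e \<le> d" using e0 e1 d by (auto simp: e_def)
  have sub: "ball x e \<subseteq> ball x e0" "ball x e \<subseteq> ball x e1" using e by (auto simp: subset_ball)
  have xin: "x \<in> base_triangle f \<inter> ball x e1" using x e1 by simp
  have inU: "place f y \<in> U" if y: "y \<in> base_triangle f \<inter> ball x e" for y
  proof -
    have "y \<in> base_triangle f \<inter> ball x e1" using y sub by blast
    then have "dist (place f y) (place f x) = dist y x" using e1(2) xin by blast
    also have "\<dots> < d" using y e by (simp add: dist_commute)
    finally show ?thesis using d(2) y place_in[OF f] by blast
  qed
  have iso: "dist (h (place f y)) (h (place f z)) = dist y z"
    if "y \<in> base_triangle f \<inter> ball x e" "z \<in> base_triangle f \<inter> ball x e" for y z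
  proof -
    have "dist (place f y) (place f z) = dist y z" using e1(2) that sub by blast
    then show ?thesis using ch inU that unfolding chart_def by metis
  qed
  have half: "{y \<in> ball x e. 0 \<le> (y - x) \<bullet> n} \<subseteq> base_triangle f" using assms(7) sub by blast
  obtain N \<sigma> where N: "norm N = 1" "\<sigma> = 1 \<or> \<sigma> = (-1::real)"
    "\<And>y. y \<in> base_triangle f \<inter> ball x e \<Longrightarrow> h (place f y) =
      h (place f x) + ((y - x) \<bullet> n) *\<^sub>R N + (\<sigma> * ((y - x) \<bullet> rot n)) *\<^sub>R rot N"
    by (rule half_disc_isometry[where \<phi> = "\<lambda>y. h (place f y)", OF e(1) n half iso]) blast+
  have "{y \<in> ball x e. 0 < (y - x) \<bullet> n} \<subseteq> interior (base_triangle f)" using assms(8) sub by blast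
  then have "piece U h f x e n N \<sigma>"
    unfolding piece_def using N(1,2) half e(1) n
    by (intro conjI ballI) (assumption | rule inU N(3))+
  then show ?thesis by (rule that[OF e(2)])
qed

lemma piece_side:
  assumes ch: "chart U h" and f: "f \<in> T" and x: "x \<in> open_side f k" and U: "place f x \<in> U"
  obtains e N \<sigma> where "piece U h f x e (side_normal f k) N \<sigma>"
    "base_triangle f \<inter> ball x e = {y \<in> ball x e. 0 \<le> (y - x) \<bullet> side_normal f k}"
proof -
  note nc = noncollinear[OF f]
  obtain e0 where e0: "0 < e0"
    "base_triangle f \<inter> ball x e0 = {y \<in> ball x e0. 0 \<le> (y - x) \<bullet> side_normal f k}"
    "interior (base_triangle f) \<inter> ball x e0 = {y \<in> ball x e0. 0 < (y - x) \<bullet> side_normal f k}"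
    by (rule open_side_half_disc[OF nc x])
  have "x \<in> base_triangle f - range (corner f)"
    using open_side_subset[OF nc] open_side_not_corner[OF nc] x by blast
  moreover have "{y \<in> ball x e0. 0 \<le> (y - x) \<bullet> side_normal f k} \<subseteq> base_triangle f"
    "{y \<in> ball x e0. 0 < (y - x) \<bullet> side_normal f k} \<subseteq> interior (base_triangle f)"
    unfolding e0(2)[symmetric] e0(3)[symmetric] by (rule Int_lower1)+
  ultimately obtain e N \<sigma> where e: "e \<le> e0" "piece U h f x e (side_normal f k) N \<sigma>"
    by (rule piece_exists[OF ch f _ U norm_side_normal[OF nc] e0(1)])
  have "base_triangle f \<inter> ball x e = {y \<in> ball x e. 0 \<le> (y - x) \<bullet> side_normal f k}"
    using e0(2) e(1) by (rule Int_ball_mono)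
  with e(2) show ?thesis by (rule that)
qed

text \<open>At an interior point the face fills a whole disc, which is presented as two half-discs
  with opposite normals. Their coexistence will exclude any further preimage.\<close>

lemma piece_interior:
  assumes ch: "chart U h" and f: "f \<in> T" and x: "x \<in> interior (base_triangle f)" and U: "place f x \<in> U"
  obtains e n N \<sigma> where "piece U h f x e n N \<sigma>" "piece U h f x e (- n) (- N) \<sigma>"
proof -
  obtain e0 where e0: "0 < e0" "ball x e0 \<subseteq> interior (base_triangle f)"
    using open_contains_ball_eq[OF open_interior, THEN iffD1, OF x] by blast
  \<comment> \<open>Any unit vector may serve; no direction is distinguished at an interior
    point.\<close>
  define n :: "real^2" where "n = axis 1 1"
  have n: "norm n = 1" by (simp add: n_def)
  have "x \<in> base_triangle f - range (corner f)"
    using interior_subset[of "base_triangle f"] interior_not_corner[OF noncollinear[OF f]] x by blast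
  moreover have "{y \<in> ball x e0. 0 \<le> (y - x) \<bullet> n} \<subseteq> base_triangle f"
    "{y \<in> ball x e0. 0 < (y - x) \<bullet> n} \<subseteq> interior (base_triangle f)"
    using e0(2) interior_subset[of "base_triangle f"] by blast+
  ultimately obtain e N \<sigma> where e: "e \<le> e0" "piece U h f x e n N \<sigma>"
    by (rule piece_exists[OF ch f _ U n e0(1)])
  have "ball x e \<subseteq> interior (base_triangle f)" using e0(2) subset_ball[OF e(1), of x] by (rule order_trans[rotated])
  then have sub: "{y \<in> ball x e. 0 \<le> (y - x) \<bullet> - n} \<subseteq> base_triangle f"
    "{y \<in> ball x e. 0 < (y - x) \<bullet> - n} \<subseteq> interior (base_triangle f)"
    using interior_subset[of "base_triangle f"] by blast+
  have "rot (- v) = - rot v" for v by (simp add: vec2_eq_iff)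
  then have "piece U h f x e (- n) (- N) \<sigma>"
    using e(2) sub unfolding piece_def
    by (elim conjE, intro conjI) simp_all
  with e(2) show ?thesis by (rule that)
qed

text \<open>Two open half-planes with inner normals \<open>N\<close> and \<open>N'\<close> at the
  same point overlap unless the normals are opposite: both contain the direction
  \<open>N + N'\<close>. An overlap in the chart would give a point of \<open>M\<close> with two
  interior preimages.\<close>

lemma piece_opposite:
  assumes ch: "chart U h" and p: "piece U h f x e n N \<sigma>" and q: "piece U h g y e' n' N' \<sigma>'"
    and fg: "f \<in> T" "g \<in> T" and m: "place f x = place g y" and ne: "(f, x) \<noteq> (g, y)"
  shows "N' = - N"
proof (rule ccontr)
  assume neg: "N' \<noteq> - N"
  \<comment> \<open>The last bound separates the balls around \<open>x\<close> and \<open>y\<close>.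
    It is needed if \<open>f = g\<close>, when disjointness of different open faces says
    nothing.\<close>
  define \<epsilon> where "\<epsilon> = min (min e e') (if x = y then 1 else dist x y / 2)"
  have \<epsilon>: "\<epsilon> > 0" "\<epsilon> \<le> e" "\<epsilon> \<le> e'" "x \<noteq> y \<Longrightarrow> 2 * \<epsilon> \<le> dist x y"
    using p q by (auto simp: \<epsilon>_def piece_def)
  have N: "norm N = 1" "norm N' = 1" using p q by (auto simp: piece_def)
  \<comment> \<open>Scales \<open>N + N'\<close> to length \<open>\<epsilon> / 2\<close>.\<close>
  define c where "c = \<epsilon> / (2 * norm (N + N'))"
  define w where "w = c *\<^sub>R (N + N')"
  have NN': "N + N' \<noteq> 0" using neg by (metis add.commute eq_neg_iff_add_eq_0)
  then have c: "c > 0" using \<epsilon> by (simp add: c_def)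
  have w: "norm w < \<epsilon>" using c \<epsilon> NN' by (simp add: w_def c_def)
  have "(N + N') \<bullet> (N + N') > 0" using NN' by simp
  then have "0 < (N + N') \<bullet> N" "0 < (N + N') \<bullet> N'"
    using N by (simp_all add: norm_eq_1 inner_add_left inner_add_right inner_commute)
  then have pos: "0 < w \<bullet> N" "0 < w \<bullet> N'" using c by (simp_all add: w_def)
  have preim: "\<exists>z. z \<in> interior (base_triangle f') \<and> z \<in> ball x' \<epsilon> \<and> place f' z \<in> U \<and>
      h (place f' z) = h (place f' x') + w"
    if p: "piece U h f' x' e' n N \<sigma>" and e': "\<epsilon> \<le> e'" and pos: "0 < w \<bullet> N" for f' x' e' n N \<sigma>
  proof -
    have nN: "norm n = 1" "norm N = 1" and \<sigma>: "\<sigma> * \<sigma> = 1" using p by (auto simp: piece_def)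
    \<comment> \<open>The motion of the piece inverted: \<open>v\<close> is the displacement in the
      triangle whose image in the chart is \<open>w\<close>; the inverse of the sign
      \<open>\<sigma>\<close> is \<open>\<sigma>\<close> itself.\<close>
    define v where "v = (w \<bullet> N) *\<^sub>R n + (\<sigma> * (w \<bullet> rot N)) *\<^sub>R rot n"
    have vn: "v \<bullet> n = w \<bullet> N" "v \<bullet> rot n = \<sigma> * (w \<bullet> rot N)"
      using nN by (simp_all add: v_def inner_add_left norm_eq_1)
    have "v \<bullet> v = w \<bullet> w"
      using orthonormal_inner[OF nN(1), of v v] orthonormal_inner[OF nN(2), of w w] \<sigma>
      by (simp add: vn)
    then have v: "norm v < \<epsilon>" using w by (simp add: norm_eq_sqrt_inner)
    have mem: "x' + v \<in> {y \<in> ball x' e'. 0 < (y - x') \<bullet> n}"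
      using v e' pos by (simp add: vn dist_norm)
    then have int: "x' + v \<in> interior (base_triangle f')" using p by (auto simp: piece_def)
    then have "x' + v \<in> base_triangle f' \<inter> ball x' e'" using mem interior_subset by blast
    then have "place f' (x' + v) \<in> U \<and> h (place f' (x' + v)) =
        h (place f' x') + (w \<bullet> N) *\<^sub>R N + (\<sigma> * (\<sigma> * (w \<bullet> rot N))) *\<^sub>R rot N"
      using p vn unfolding piece_def by simp
    moreover have "(w \<bullet> N) *\<^sub>R N + (\<sigma> * (\<sigma> * (w \<bullet> rot N))) *\<^sub>R rot N = w"
      using orthonormal_expansion[OF nN(2), of w] \<sigma> by (simp add: mult.assoc[symmetric])
    ultimately show ?thesis using int v by (intro exI[of _ "x' + v"]) (simp add: dist_norm add.assoc)
  qed
  obtain u where u: "u \<in> interior (base_triangle f)" "u \<in> ball x \<epsilon>" "place f u \<in> U"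
      "h (place f u) = h (place f x) + w" using preim[OF p \<epsilon>(2) pos(1)] by blast
  obtain v where v: "v \<in> interior (base_triangle g)" "v \<in> ball y \<epsilon>" "place g v \<in> U"
      "h (place g v) = h (place g y) + w" using preim[OF q \<epsilon>(3) pos(2)] by blast
  have "place f u = place g v" using chart_inj[OF ch] u v m by metis
  then have "f = g \<and> u = v" using interiors_disjoint fg u v by blast
  then have "x \<noteq> y" and "u = v" using ne by auto
  moreover have "dist x y < \<epsilon> + \<epsilon>" using u(2) v(2) dist_triangle_less_add[of x u \<epsilon> y \<epsilon>] \<open>u = v\<close>
    by (simp add: dist_commute)
  ultimately show False using \<epsilon>(4) by simp
qed

text \<open>The normal of a half-disc at another preimage would have to be opposite to both
  \<open>N\<close> and \<open>- N\<close>.\<close>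

lemma preimages_interior:
  assumes f: "f \<in> T" and x: "x \<in> interior (base_triangle f)"
  shows "preimages (place f x) = {(f, x)}"
proof -
  note nc = noncollinear[OF f]
  have xb: "x \<in> base_triangle f" "x \<notin> range (corner f)"
    using x interior_subset interior_not_corner[OF nc] by blast+
  then have nv: "place f x \<notin> vertices T" using non_vertex_iff[OF f] by blast
  then obtain U h where ch: "chart U h" "place f x \<in> U"
    using chart_exists place_in[OF f xb(1)] by blast
  obtain e n N \<sigma> where p: "piece U h f x e n N \<sigma>" "piece U h f x e (- n) (- N) \<sigma>"
    by (rule piece_interior[OF ch(1) f x ch(2)])
  have "(g, y) = (f, x)" if g: "g \<in> T" and y: "y \<in> base_triangle g" and m: "place g y = place f x" for g y
  proof (rule ccontr)
    assume ne: "(g, y) \<noteq> (f, x)"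
    have U: "place g y \<in> U" using ch m by simp
    have "y \<notin> range (corner g)" using non_vertex_iff[OF g y] nv m by simp
    then consider k where "y \<in> open_side g k" | "y \<in> interior (base_triangle g)"
      using base_triangle_cases[OF noncollinear[OF g] y] by blast
    then obtain e' n' N' \<sigma>' where q: "piece U h g y e' n' N' \<sigma>'"
    proof cases
      case 1
      then show ?thesis by (rule piece_side[OF ch(1) g _ U]) (rule that)
    next
      case 2
      then show ?thesis by (rule piece_interior[OF ch(1) g _ U]) (rule that)
    qed
    have "N' = - N" "N' = - (- N)"
      using piece_opposite[OF ch(1) p(1) q] piece_opposite[OF ch(1) p(2) q] f g m ne by auto
    then have "N + N = 0" by (metis add.inverse_inverse add.right_inverse)
    moreover have "norm N = 1" using p by (simp add: piece_def)
    ultimately show False by (simp flip: scaleR_2)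
  qed
  then show ?thesis using f xb by (auto simp: preimages_def)
qed

text \<open>A point of an edge is covered exactly twice. One half-disc cannot fill an open set of
  the plane, and a third would have to be opposite to two half-discs that are already opposite to
  each other. The second preimage may lie in the same face.\<close>

lemma preimages_side:
  assumes f: "f \<in> T" and x: "x \<in> open_side f k"
  obtains g l y where "g \<in> T" "y \<in> open_side g l" "place g y = place f x" "(g, y) \<noteq> (f, x)"
    "preimages (place f x) = {(f, x), (g, y)}"
proof -
  note nc = noncollinear[OF f]
  define m where "m = place f x"
  have xb: "x \<in> base_triangle f" "x \<notin> range (corner f)"
    using x open_side_subset[OF nc] open_side_not_corner[OF nc] by blast+
  then have nv: "m \<notin> vertices T" and mM: "m \<in> M"
    using non_vertex_iff[OF f] place_in[OF f] by (auto simp: m_def)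
  then obtain U h where ch: "chart U h" "m \<in> U" using chart_exists by blast
  obtain e N \<sigma> where p: "piece U h f x e (side_normal f k) N \<sigma>"
    "base_triangle f \<inter> ball x e = {y \<in> ball x e. 0 \<le> (y - x) \<bullet> side_normal f k}"
    using ch(2) unfolding m_def by (rule piece_side[OF ch(1) f x])
  have N: "norm N = 1" "N \<bullet> N = 1" and e: "e > 0" using p by (auto simp: piece_def norm_eq_1)
  have side: "\<exists>l. y \<in> open_side g l" if "(g, y) \<in> preimages m" for g y
  proof -
    have gy: "g \<in> T" "y \<in> base_triangle g" "place g y = m" using that by (auto simp: preimages_def)
    have "y \<notin> interior (base_triangle g)"
    proof
      assume y: "y \<in> interior (base_triangle g)"
      have "(f, x) \<in> preimages m" using f xb by (simp add: preimages_def m_def)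
      then have "(f, x) = (g, y)" using preimages_interior[OF gy(1) y] gy(3) by simp
      then have "\<forall>j. 0 < bary f j x" using y interior_base_triangle[OF nc] by simp
      then show False using x open_side_bary[OF nc] by (metis (mono_tags, lifting) less_irrefl mem_Collect_eq)
    qed
    moreover have "y \<notin> range (corner g)" using non_vertex_iff[OF gy(1,2)] nv gy(3) by simp
    ultimately show ?thesis using base_triangle_cases[OF noncollinear[OF gy(1)] gy(2)] by blast
  qed
  have opp: "\<exists>e' n' \<sigma>'. piece U h g y e' n' (- N) \<sigma>'"
    if gy: "(g, y) \<in> preimages m" "(g, y) \<noteq> (f, x)" for g y
  proof -
    have g: "g \<in> T" "place g y = m" using gy by (auto simp: preimages_def)
    obtain l where "y \<in> open_side g l" using side[OF gy(1)] by blast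
    then obtain e' N' \<sigma>' where q: "piece U h g y e' (side_normal g l) N' \<sigma>'"
      by (rule piece_side[OF ch(1) g(1)]) (use ch(2) g(2) in simp)
    then have "N' = - N" using piece_opposite[OF ch(1) p(1) q f g(1)] g gy by (auto simp: m_def)
    then show ?thesis using q by blast
  qed
  \<comment> \<open>The image of the chart is open and so contains points just beyond the edge, in
    direction \<open>- N\<close>. If \<open>(f, x)\<close> were the only preimage,
    \<open>cover_nearby\<close> would put such a point into the half-disc on the side of
    \<open>N\<close>.\<close>
  have "preimages m \<noteq> {(f, x)}"
  proof
    assume only: "preimages m = {(f, x)}"
    obtain d where d: "0 < d" "\<And>m'. m' \<in> M \<Longrightarrow> dist m' m < d \<Longrightarrow>
      \<exists>g z z'. (g, z) \<in> preimages m \<and> (g, z') \<in> preimages m' \<and> dist z z' < e"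
      using cover_nearby[OF e, of m] by blast
    have "open (h ` U)" "h m \<in> h ` U" using ch by (auto simp: chart_def)
    then obtain d' where d': "d' > 0" "ball (h m) d' \<subseteq> h ` U" using open_contains_ball by blast
    define t where "t = min d d' / 2"
    have t: "0 < t" "t < d" "t < d'" using d d' by (auto simp: t_def)
    have "h m - t *\<^sub>R N \<in> ball (h m) d'" using t N by (simp add: dist_norm)
    then have "h m - t *\<^sub>R N \<in> h ` U" using d'(2) by (rule subsetD[rotated])
    then obtain m' where m': "m' \<in> U" "h m' = h m - t *\<^sub>R N" by auto
    have "dist m' m = dist (h m') (h m)" using ch m'(1) unfolding chart_def by metis
    also have "\<dots> = t" using t N by (simp add: m'(2) dist_norm)
    finally have "dist m' m < d" using t by simp
    moreover have "m' \<in> M" using ch m'(1) openin_subset unfolding chart_def by fastforce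
    ultimately obtain g z z' where gz: "(g, z) \<in> preimages m" "(g, z') \<in> preimages m'" "dist z z' < e"
      using d(2)[of m'] by blast
    then have z': "z' \<in> base_triangle f" "place f z' = m'" "dist x z' < e"
      using only by (auto simp: preimages_def)
    then have zb: "z' \<in> base_triangle f \<inter> ball x e" by simp
    then have ge: "0 \<le> (z' - x) \<bullet> side_normal f k" using p(2) by blast
    have "\<forall>y \<in> base_triangle f \<inter> ball x e. h (place f y) = h m + ((y - x) \<bullet> side_normal f k) *\<^sub>R N +
        (\<sigma> * ((y - x) \<bullet> rot (side_normal f k))) *\<^sub>R rot N"
      using p(1) by (simp add: piece_def m_def)
    from bspec[OF this zb] have "h m' = h m + ((z' - x) \<bullet> side_normal f k) *\<^sub>R N + (\<sigma> * ((z' - x) \<bullet> rot (side_normal f k))) *\<^sub>R rot N"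
      unfolding z'(2) .
    then have "(h m' - h m) \<bullet> N = (z' - x) \<bullet> side_normal f k" using N by (simp add: inner_add_left)
    moreover have "(h m' - h m) \<bullet> N = - t" using N by (simp add: m'(2))
    ultimately show False using ge t by simp
  qed
  moreover have fx: "(f, x) \<in> preimages m" using f xb by (simp add: preimages_def m_def)
  ultimately obtain g y where gy: "(g, y) \<in> preimages m" "(g, y) \<noteq> (f, x)" by auto
  obtain l where l: "y \<in> open_side g l" using side[OF gy(1)] by blast
  \<comment> \<open>Like \<open>(g, y)\<close>, a third preimage would have the normal
    \<open>- N\<close>, but distinct preimages have opposite normals.\<close>
  have "c \<in> {(f, x), (g, y)}" if "c \<in> preimages m" for c
  proof (rule ccontr)
    assume c: "c \<notin> {(f, x), (g, y)}"
    obtain g' y' where g': "c = (g', y')" by (cases c)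
    then have c': "(g', y') \<in> preimages m" "(g', y') \<noteq> (f, x)" "(g', y') \<noteq> (g, y)" using c that by auto
    obtain e1 n1 \<sigma>1 where 1: "piece U h g y e1 n1 (- N) \<sigma>1" using opp[OF gy] by blast
    obtain e2 n2 \<sigma>2 where 2: "piece U h g' y' e2 n2 (- N) \<sigma>2" using opp[OF c'(1,2)] by blast
    have "- N = - (- N)"
      using piece_opposite[OF ch(1) 1 2] gy(1) c' by (auto simp: preimages_def)
    then have "N + N = 0" by (metis add.inverse_inverse add.right_inverse)
    then show False using N(1) by (simp flip: scaleR_2)
  qed
  then have "preimages m = {(f, x), (g, y)}" using fx gy by blast
  then show ?thesis using that[OF _ l] gy unfolding m_def by (auto simp: preimages_def)
qed

text \<open>Two faces unfolded into the plane across a common edge. The formula is the theorem of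
  Pythagoras in the chart: the inner normals are opposite, so the distances from the edge add up,
  while the positions along the edge are compared after a possible change of direction
  \<open>\<sigma>\<close>.\<close>

lemma edge_development:
  assumes f: "f \<in> T" and x: "x \<in> open_side f k" and g: "g \<in> T" and y: "y \<in> open_side g l"
    and m: "place f x = place g y" and ne: "(f, x) \<noteq> (g, y)"
  obtains e \<sigma> where "0 < e" "\<sigma> = 1 \<or> \<sigma> = (-1::real)"
    "base_triangle f \<inter> ball x e = {u \<in> ball x e. 0 \<le> (u - x) \<bullet> side_normal f k}"
    "base_triangle g \<inter> ball y e = {v \<in> ball y e. 0 \<le> (v - y) \<bullet> side_normal g l}"
    "\<And>u v. u \<in> base_triangle f \<inter> ball x e \<Longrightarrow> v \<in> base_triangle g \<inter> ball y e \<Longrightarrow>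
      (dist (place f u) (place g v))\<^sup>2 =
      ((u - x) \<bullet> side_normal f k + (v - y) \<bullet> side_normal g l)\<^sup>2 +
      ((u - x) \<bullet> rot (side_normal f k) - \<sigma> * ((v - y) \<bullet> rot (side_normal g l)))\<^sup>2"
proof -
  note nc = noncollinear[OF f]
  have xb: "x \<in> base_triangle f" "x \<notin> range (corner f)"
    using x open_side_subset[OF nc] open_side_not_corner[OF nc] by blast+
  then obtain U h where ch: "chart U h" "place f x \<in> U" "place g y \<in> U"
    using chart_exists[of "place f x"] non_vertex_iff[OF f] place_in[OF f] m by metis
  obtain e1 N \<sigma>1 where p: "piece U h f x e1 (side_normal f k) N \<sigma>1"
    "base_triangle f \<inter> ball x e1 = {y \<in> ball x e1. 0 \<le> (y - x) \<bullet> side_normal f k}"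
    by (rule piece_side[OF ch(1) f x ch(2)])
  obtain e2 N' \<sigma>2 where q: "piece U h g y e2 (side_normal g l) N' \<sigma>2"
    "base_triangle g \<inter> ball y e2 = {v \<in> ball y e2. 0 \<le> (v - y) \<bullet> side_normal g l}"
    by (rule piece_side[OF ch(1) g y ch(3)])
  have N': "N' = - N" by (rule piece_opposite[OF ch(1) p(1) q(1) f g m ne])
  have N: "norm N = 1" "N \<bullet> N = 1" using p by (auto simp: piece_def norm_eq_1)
  have rotN: "rot (- N) = - rot N" by (simp add: vec2_eq_iff)
  define e where "e = min e1 e2"
  have sub: "ball x e \<subseteq> ball x e1" "ball y e \<subseteq> ball y e2" by (auto simp: e_def)
  show ?thesis
  \<comment> \<open>Turning the normal from \<open>N\<close> to \<open>- N\<close> also turns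
    \<open>rot N\<close> around; this is the extra minus sign in the value of
    \<open>\<sigma>\<close>.\<close>
  proof (rule that[of e "- (\<sigma>1 * \<sigma>2)"])
    show "0 < e" using p q by (auto simp: e_def piece_def)
    show "- (\<sigma>1 * \<sigma>2) = 1 \<or> - (\<sigma>1 * \<sigma>2) = -1" using p q by (auto simp: piece_def)
    show "base_triangle f \<inter> ball x e = {u \<in> ball x e. 0 \<le> (u - x) \<bullet> side_normal f k}"
      using p(2) by (rule Int_ball_mono) (simp add: e_def)
    show "base_triangle g \<inter> ball y e = {v \<in> ball y e. 0 \<le> (v - y) \<bullet> side_normal g l}"
      using q(2) by (rule Int_ball_mono) (simp add: e_def)
    fix u v assume u: "u \<in> base_triangle f \<inter> ball x e" and v: "v \<in> base_triangle g \<inter> ball y e"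
    define \<beta> where "\<beta> = (u - x) \<bullet> side_normal f k"
    define \<alpha> where "\<alpha> = (u - x) \<bullet> rot (side_normal f k)"
    define \<beta>' where "\<beta>' = (v - y) \<bullet> side_normal g l"
    define \<alpha>' where "\<alpha>' = (v - y) \<bullet> rot (side_normal g l)"
    note defs = \<beta>_def \<alpha>_def \<beta>'_def \<alpha>'_def
    have u': "place f u \<in> U" "h (place f u) = h (place f x) + \<beta> *\<^sub>R N + (\<sigma>1 * \<alpha>) *\<^sub>R rot N"
      using p(1) u sub unfolding piece_def defs by blast+
    have v': "place g v \<in> U" "h (place g v) = h (place f x) + \<beta>' *\<^sub>R N' + (\<sigma>2 * \<alpha>') *\<^sub>R rot N'"
      using q(1) v sub m unfolding piece_def defs by auto
    have "h (place f u) - h (place g v) = (\<beta> + \<beta>') *\<^sub>R N + (\<sigma>1 * \<alpha> + \<sigma>2 * \<alpha>') *\<^sub>R rot N"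
      unfolding u' v' N' rotN by (simp add: algebra_simps)
    then have "(dist (place f u) (place g v))\<^sup>2 =
        ((\<beta> + \<beta>') *\<^sub>R N + (\<sigma>1 * \<alpha> + \<sigma>2 * \<alpha>') *\<^sub>R rot N) \<bullet> ((\<beta> + \<beta>') *\<^sub>R N + (\<sigma>1 * \<alpha> + \<sigma>2 * \<alpha>') *\<^sub>R rot N)"
      using ch(1) u'(1) v'(1) unfolding chart_def by (metis dist_norm power2_norm_eq_inner)
    also have "\<dots> = (\<beta> + \<beta>')\<^sup>2 + (\<sigma>1 * \<alpha> + \<sigma>2 * \<alpha>')\<^sup>2"
      using N by (simp add: inner_add_left inner_add_right power2_eq_square)
    also have "(\<sigma>1 * \<alpha> + \<sigma>2 * \<alpha>')\<^sup>2 = (\<alpha> - (- (\<sigma>1 * \<sigma>2)) * \<alpha>')\<^sup>2"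
      using p(1) q(1) by (auto simp: piece_def power2_eq_square algebra_simps)
    finally show "(dist (place f u) (place g v))\<^sup>2 =
      ((u - x) \<bullet> side_normal f k + (v - y) \<bullet> side_normal g l)\<^sup>2 +
      ((u - x) \<bullet> rot (side_normal f k) - (- (\<sigma>1 * \<sigma>2)) * ((v - y) \<bullet> rot (side_normal g l)))\<^sup>2"
      unfolding defs .
  qed
qed

lemma finite_preimages:
  assumes "m \<in> M" "m \<notin> vertices T"
  shows "finite (preimages m)"
proof -
  obtain f x where f: "f \<in> T" "x \<in> base_triangle f" "place f x = m"
    using preimages_nonempty[OF assms(1)] by blast
  have "x \<notin> range (corner f)" using non_vertex_iff[OF f(1,2)] f(3) assms(2) by simp
  then consider k where "x \<in> open_side f k" | "x \<in> interior (base_triangle f)"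
    using base_triangle_cases[OF noncollinear[OF f(1)] f(2)] by blast
  then show ?thesis
  proof cases
    case 1
    obtain g l y where "preimages (place f x) = {(f, x), (g, y)}"
      by (rule preimages_side[OF f(1) 1])
    then show ?thesis using f(3) by simp
  next
    case 2
    then show ?thesis using preimages_interior[OF f(1) 2] f(3) by simp
  qed
qed

text \<open>Away from the vertices \<open>cover_nearby\<close> becomes exact: \<open>m\<close> has
  finitely many preimages, so they share a radius within which \<open>place\<close> preserves the
  distance from the preimage.\<close>

lemma isometric_nearby:
  assumes m: "m \<in> M" "m \<notin> vertices T" and e: "0 < e"
  obtains d where "0 < d" "\<And>m'. m' \<in> M \<Longrightarrow> dist m' m < d \<Longrightarrow>
    \<exists>f x x'. (f, x) \<in> preimages m \<and> (f, x') \<in> preimages m' \<and> dist x x' = dist m m' \<and> dist x x' < e"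
proof -
  define P where "P = (\<lambda>(f :: 'a face, x) d. \<forall>y\<in>base_triangle f \<inter> ball x d. dist (place f x) (place f y) = dist x y)"
  obtain e' where e': "e' > 0" "\<And>c. c \<in> preimages m \<Longrightarrow> P c e'"
  proof (rule finite_uniform_radius[OF finite_preimages[OF m], of P])
    fix c assume c: "c \<in> preimages m"
    obtain f x where cf: "c = (f, x)" by (cases c)
    have f: "f \<in> T" "x \<in> base_triangle f" "place f x = m" using c by (simp_all add: preimages_def cf)
    then have "x \<in> base_triangle f - range (corner f)" using non_vertex_iff[OF f(1,2)] m(2) by simp
    then obtain d where d: "0 < d" "\<And>y z. y \<in> base_triangle f \<inter> ball x d \<Longrightarrow> z \<in> base_triangle f \<inter> ball x d \<Longrightarrow>
      dist (place f y) (place f z) = dist y z"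
      by (rule place_local_isometry[OF f(1)]) blast
    have "x \<in> base_triangle f \<inter> ball x d" using f(2) d(1) by simp
    then have "P c d" unfolding P_def cf prod.case using d(2) by blast
    then show "\<exists>d>0. P c d" using d(1) by blast
  qed (auto simp: P_def)
  have "0 < min e e'" using e e'(1) by simp
  then obtain d where d: "0 < d" "\<And>m'. m' \<in> M \<Longrightarrow> dist m' m < d \<Longrightarrow>
    \<exists>f x x'. (f, x) \<in> preimages m \<and> (f, x') \<in> preimages m' \<and> dist x x' < min e e'"
    by (rule cover_nearby[where m = m]) blast
  show ?thesis
  proof (rule that[OF d(1)])
    fix m' assume "m' \<in> M" "dist m' m < d"
    then obtain f x x' where f: "(f, x) \<in> preimages m" "(f, x') \<in> preimages m'" "dist x x' < min e e'"
      using d(2) by blast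
    moreover have "dist m m' = dist x x'"
    proof -
      have "x' \<in> base_triangle f \<inter> ball x e'" using f by (simp add: preimages_def)
      then have "dist (place f x) (place f x') = dist x x'"
        using e'(2)[OF f(1)] unfolding P_def prod.case by blast
      then show ?thesis using f by (simp add: preimages_def)
    qed
    ultimately show "\<exists>f x x'. (f, x) \<in> preimages m \<and> (f, x') \<in> preimages m' \<and> dist x x' = dist m m' \<and> dist x x' < e"
      by (intro exI[of _ f] exI[of _ x] exI[of _ x']) simp
  qed
qed

end

section \<open>The distance to the apex as a function on the boundary\<close>

definition apex_sqdist :: "('a \<Rightarrow> real) \<Rightarrow> 'a face \<Rightarrow> real^2 \<Rightarrow> real" where
  "apex_sqdist r f x = (dist (apex r f) (x, 0))\<^sup>2"

lemma apex_sqdist_eq: "apex_sqdist r f x = (fst (apex r f) - x) \<bullet> (fst (apex r f) - x) + (snd (apex r f))\<^sup>2"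
  unfolding apex_sqdist_def dist_norm power2_norm_eq_inner inner_prod_def by (simp add: power2_eq_square)

lemma apex_sqdist_add:
  "apex_sqdist r f (x + v) = apex_sqdist r f x + v \<bullet> v - 2 * (v \<bullet> (fst (apex r f) - x))"
  by (simp add: apex_sqdist_eq inner_diff_left inner_diff_right inner_add_left inner_add_right inner_commute)

text \<open>The second difference does not depend on the apex, so it cancels when two such functions
  are compared.\<close>

lemma apex_sqdist_parallelogram:
  "apex_sqdist r f (x + v) + apex_sqdist r f (x - v) = 2 * apex_sqdist r f x + 2 * (v \<bullet> v)"
  using apex_sqdist_add[of r f x v] apex_sqdist_add[of r f x "- v"] by simp

lemma continuous_apex_sqdist [continuous_intros]:
  "continuous_on S g \<Longrightarrow> continuous_on S (\<lambda>x. apex_sqdist r f (g x))"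
  unfolding apex_sqdist_eq by (intro continuous_intros)

lemma closed_side_subset_open_side:
  "closed_segment (corner f (k + 1)) (corner f (k + 2)) \<subseteq> open_side f k \<union> range (corner f)"
  by (auto simp: open_side_def open_segment_def)

lemma closed_side_subset:
  assumes nc: "\<not> collinear (range (corner f))"
  shows "closed_segment (corner f (k + 1)) (corner f (k + 2)) \<subseteq> base_triangle f"
  using closed_side_subset_open_side[of f k] open_side_subset[OF nc, of k] corner_mem[OF nc] by blast

lemma edge_vector:
  assumes nc: "\<not> collinear (range (corner f))"
  shows "corner f (k + 2) - corner f (k + 1) =
    ((corner f (k + 2) - corner f (k + 1)) \<bullet> rot (side_normal f k)) *\<^sub>R rot (side_normal f k)"
  using orthonormal_expansion[OF norm_side_normal[OF nc], of "corner f (k + 2) - corner f (k + 1)" k]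
    side_normal_edge[OF nc, of k] by (simp add: inner_commute)

lemma open_side_inner_normal:
  assumes nc: "\<not> collinear (range (corner f))" and x: "x \<in> open_side f k"
  shows "(x - corner f (k + 1)) \<bullet> side_normal f k = 0"
proof -
  obtain s where "x = (1 - s) *\<^sub>R corner f (k + 1) + s *\<^sub>R corner f (k + 2)"
    using x unfolding open_side_def in_segment by blast
  then have "x - corner f (k + 1) = s *\<^sub>R (corner f (k + 2) - corner f (k + 1))"
    by (simp add: algebra_simps)
  then show ?thesis using side_normal_edge[OF nc, of k] by (simp add: inner_commute)
qed

text \<open>Orthogonally to the side, the pyramid is seen as the angle at the origin between the
  first axis and the point with coordinates \<open>d\<close> and the height of the apex. Here
  \<open>d\<close> is the signed distance of the foot of the apex from the line of the side,
  positive on the side of the triangle.\<close>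

lemma base_angle_eq:
  fixes f :: "'a face" and r :: "'a \<Rightarrow> real"
  assumes nc: "\<not> collinear (range (corner f))" and x: "x \<in> open_side f k"
  defines "d \<equiv> (fst (apex r f) - x) \<bullet> side_normal f k"
  shows "base_angle r f k = arccos (d / sqrt (d\<^sup>2 + (snd (apex r f))\<^sup>2))"
proof -
  define n where "n = side_normal f k"
  define c where "c = corner f (k + 1)"
  define a where "a = apex r f"
  define \<epsilon> where "\<epsilon> = (corner f (k + 2) - c) \<bullet> rot n"
  define H where "H = (corner f k - c) \<bullet> n"
  have n: "norm n = 1" "n \<bullet> n = 1" using norm_side_normal[OF nc] by (simp_all add: n_def norm_eq_1)
  have E: "corner f (k + 2) - c = \<epsilon> *\<^sub>R rot n" using edge_vector[OF nc] by (simp add: n_def c_def \<epsilon>_def)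
  have "corner f (k + 2) \<noteq> c" using corner_inj[OF nc] by (simp add: c_def)
  then have \<epsilon>: "\<epsilon> \<noteq> 0" using E by auto
  have H: "H > 0" using side_normal_apex[OF nc, of k] by (simp add: H_def n_def c_def inner_commute)
  \<comment> \<open>Removing the component along the side leaves the normal component and the
    height.\<close>
  have orth: "orth_part (\<epsilon> *\<^sub>R rot n, 0::real) (v, h) = ((v \<bullet> n) *\<^sub>R n, h)" for v h
  proof -
    have "v - (v \<bullet> rot n) *\<^sub>R rot n = (v \<bullet> n) *\<^sub>R n"
      using orthonormal_expansion[OF n(1), of v] by (metis add_diff_cancel_right')
    then show ?thesis using \<epsilon> n by (simp add: orth_part_def inner_prod_def)
  qed
  have d: "(fst a - c) \<bullet> n = d"
    using open_side_inner_normal[OF nc x] by (simp add: d_def n_def c_def a_def inner_diff_left)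
  have "base_angle r f k = vec_angle (orth_part (\<epsilon> *\<^sub>R rot n, 0::real) (corner f k - c, 0))
      (orth_part (\<epsilon> *\<^sub>R rot n, 0) (fst a - c, snd a))"
    unfolding base_angle_def dihedral_angle_def
    by (simp add: E[symmetric] c_def[symmetric] a_def[symmetric] minus_prod_def)
  also have "\<dots> = vec_angle (H *\<^sub>R n, 0::real) (d *\<^sub>R n, snd a)"
    unfolding orth d H_def ..
  also have "\<dots> = arccos ((H * d) / (H * sqrt (d\<^sup>2 + (snd a)\<^sup>2)))"
    using n H by (simp add: vec_angle_def norm_prod_def inner_prod_def)
  finally show ?thesis using H by (simp add: a_def)
qed

text \<open>Read off in a single pyramid instead of from \<open>glued_dist\<close>, so that it is a
  quadratic polynomial on each face. The value does not depend on the chosen preimage, by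
  \<open>apex_sqdist_well_defined\<close>.\<close>

definition boundary_sqdist :: "'a face set \<Rightarrow> ('a \<Rightarrow> real) \<Rightarrow> 'a \<Rightarrow> real" where
  "boundary_sqdist T r m =
     (case (SOME (f, x). f \<in> T \<and> x \<in> base_triangle f \<and> place f x = m) of (f, x) \<Rightarrow> apex_sqdist r f x)"

section \<open>The squared distance to the apex is single-valued on M\<close>

locale polyhedral_couple = polyhedral_triangulation M T
  for M :: "'a::metric_space set" and T :: "'a face set" +
  fixes r :: "'a \<Rightarrow> real"
  assumes couple: "(T, r) \<in> couples M"
begin

lemma is_apex: "f \<in> T \<Longrightarrow> is_apex r f (apex r f)"
  using is_apex_apex[OF couple] .

lemma apex_height: "f \<in> T \<Longrightarrow> 0 < snd (apex r f)"
  using is_apex by (simp add: is_apex_def)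

lemma apex_sqdist_corner: "f \<in> T \<Longrightarrow> apex_sqdist r f (corner f k) = (r (place f (corner f k)))\<^sup>2"
  using is_apex by (simp add: is_apex_def apex_sqdist_def)

lemma apex_sqdist_pos: "f \<in> T \<Longrightarrow> 0 < apex_sqdist r f x"
  using apex_height[of f] by (simp add: apex_sqdist_eq add_nonneg_pos)

lemma apex_sqdist_vertex:
  assumes "f \<in> T" "x \<in> base_triangle f" "place f x \<in> vertices T"
  shows "apex_sqdist r f x = (r (place f x))\<^sup>2"
  using vertex_preimage[OF assms] apex_sqdist_corner[OF assms(1)] by blast

text \<open>Along the edge the difference of the two squared distances has vanishing second
  differences at every non-corner point, because corresponding steps on the two sides have equal
  length. It vanishes at the ends, where both values are the squared radius of the same vertex.
  Hence the midpoint argument applies to it and to its negative.\<close>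

lemma apex_sqdist_side:
  assumes f: "f \<in> T" and x: "x \<in> open_side f k" and g: "g \<in> T" and y: "y \<in> open_side g l"
    and m: "place f x = place g y"
  shows "apex_sqdist r f x = apex_sqdist r g y"
proof (cases "(f, x) = (g, y)")
  case False
  note ncf = noncollinear[OF f] and ncg = noncollinear[OF g]
  define K where "K = closed_segment (corner f (k + 1)) (corner f (k + 2))"
  define K' where "K' = closed_segment (corner g (l + 1)) (corner g (l + 2))"
  have sub: "K \<subseteq> base_triangle f" "K' \<subseteq> base_triangle g"
    unfolding K_def K'_def using closed_side_subset[OF ncf] closed_side_subset[OF ncg] by auto
  have os: "open_side f k \<subseteq> K" "open_side g l \<subseteq> K'"
    by (auto simp: K_def K'_def open_side_def open_segment_def)
  have edge: "open_edge f k = open_edge g l" by (rule open_edge_eq[OF f g x y m])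
  have contf: "continuous_on K (place f)" and contg: "continuous_on K' (place g)"
    using place_cont[OF f] place_cont[OF g] sub by (auto intro: continuous_on_subset)
  \<comment> \<open>Two sides that meet over one point at distinct preimages stay distinct along the
    whole edge: equality at some point would make them the same side of the same face, on which
    \<open>place\<close> is injective.\<close>
  have ndiff: "(f, u) \<noteq> (g, w)" if "u \<in> open_side f k" "w \<in> open_side g l" for u w
  proof
    assume eq: "(f, u) = (g, w)"
    then have "k = l" using open_side_unique[OF ncf that(1)] that(2) by simp
    then have "x = y" using inj_onD[OF place_inj_side[OF f, of k], of x y] x y eq m by auto
    then show False using False eq by simp
  qed
  \<comment> \<open>The squared distance taken from \<open>g\<close>, as a function on the edge in
    \<open>M\<close>. The choice is ambiguous only at the ends, if a loop sends both to one vertex,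
    and there the radius determines the value.\<close>
  define Q where "Q = (\<lambda>m. apex_sqdist r g (SOME w. w \<in> K' \<and> place g w = m))"
  have Q: "Q (place g w) = apex_sqdist r g w" if w: "w \<in> K'" for w
  proof -
    define w' where "w' = (SOME v. v \<in> K' \<and> place g v = place g w)"
    have w': "w' \<in> K'" "place g w' = place g w"
      using someI[of "\<lambda>v. v \<in> K' \<and> place g v = place g w" w] w by (auto simp: w'_def)
    have wb: "w \<in> base_triangle g" "w' \<in> base_triangle g" using w w' sub by auto
    have "apex_sqdist r g w' = apex_sqdist r g w"
    proof (cases "place g w \<in> vertices T")
      case True
      then show ?thesis using apex_sqdist_vertex[OF g wb(1)] apex_sqdist_vertex[OF g wb(2)] w'(2) by simp
    next
      case False
      then have "w \<notin> range (corner g)" "w' \<notin> range (corner g)"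
        using non_vertex_iff[OF g wb(1)] non_vertex_iff[OF g wb(2)] w'(2) by auto
      then have "w \<in> open_side g l" "w' \<in> open_side g l"
        using w w'(1) closed_side_subset_open_side[of g l] unfolding K'_def by blast+
      then have "w' = w" using inj_onD[OF place_inj_side[OF g] w'(2)] by blast
      then show ?thesis by simp
    qed
    then show ?thesis by (simp add: Q_def w'_def)
  qed
  have contQ: "continuous_on (place g ` K') Q"
  proof (rule continuous_on_compact_image[OF _ contg])
    show "compact K'" by (simp add: K'_def)
    have "continuous_on K' (apex_sqdist r g)" by (rule continuous_apex_sqdist[OF continuous_on_id])
    then show "continuous_on K' (\<lambda>w. Q (place g w))" by (subst continuous_on_cong[OF refl Q]) auto
  qed
  have img: "place f ` K \<subseteq> place g ` K'"
  proof -
    have cl: "K = closure (open_side f k)"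
      using corner_inj[OF ncf] by (simp add: K_def open_side_def closure_open_segment)
    have "closed (place g ` K')"
      using compact_continuous_image[OF contg] by (simp add: K'_def compact_imp_closed)
    moreover have "place f ` open_side f k \<subseteq> place g ` K'"
      using edge os(2) unfolding open_edge_def by blast
    ultimately show ?thesis
      using image_closure_subset[of "open_side f k" "place f"] contf unfolding cl by blast
  qed
  define F where "F = (\<lambda>u. apex_sqdist r f u - Q (place f u))"
  have contF: "continuous_on K F"
    unfolding F_def
    by (intro continuous_intros continuous_on_compose2[OF contQ contf] img)
  have F_end: "F u = 0" if u: "u \<in> K" "u \<in> range (corner f)" for u
  proof -
    obtain w where w: "w \<in> K'" "place g w = place f u" using img u(1) by (metis imageE imageI subsetD)
    have "place f u \<in> vertices T" using corner_vertex[OF f] u(2) by blast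
    then have "apex_sqdist r g w = (r (place f u))\<^sup>2" "apex_sqdist r f u = (r (place f u))\<^sup>2"
      using apex_sqdist_vertex[OF g, of w] apex_sqdist_vertex[OF f, of u] w u(1) sub by auto
    then show ?thesis using Q[OF w(1)] w(2) by (simp add: F_def)
  qed
  have mid: "\<exists>v. v \<noteq> 0 \<and> u + v \<in> K \<and> u - v \<in> K \<and> F (u + v) + F (u - v) = 2 * F u"
    if u: "u \<in> K - range (corner f)" for u
  proof -
    have uo: "u \<in> open_side f k" using u closed_side_subset_open_side[of f k] unfolding K_def by blast
    then obtain w where w: "w \<in> open_side g l" "place f u = place g w"
      using edge unfolding open_edge_def by blast
    obtain e \<sigma> where e: "0 < e" "\<sigma> = 1 \<or> \<sigma> = (-1::real)"
      "base_triangle f \<inter> ball u e = {z \<in> ball u e. 0 \<le> (z - u) \<bullet> side_normal f k}"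
      "base_triangle g \<inter> ball w e = {z \<in> ball w e. 0 \<le> (z - w) \<bullet> side_normal g l}"
      "\<And>z z'. z \<in> base_triangle f \<inter> ball u e \<Longrightarrow> z' \<in> base_triangle g \<inter> ball w e \<Longrightarrow>
      (dist (place f z) (place g z'))\<^sup>2 =
      ((z - u) \<bullet> side_normal f k + (z' - w) \<bullet> side_normal g l)\<^sup>2 +
      ((z - u) \<bullet> rot (side_normal f k) - \<sigma> * ((z' - w) \<bullet> rot (side_normal g l)))\<^sup>2"
      by (rule edge_development[OF f uo g w(1) w(2) ndiff[OF uo w(1)]]) blast
    define n n' where "n = side_normal f k" and "n' = side_normal g l"
    have n: "norm n = 1" "n \<bullet> n = 1" "norm n' = 1" "n' \<bullet> n' = 1"
      using norm_side_normal[OF ncf] norm_side_normal[OF ncg] by (simp_all add: n_def n'_def norm_eq_1)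
    define E where "E = corner f (k + 2) - corner f (k + 1)"
    have E0: "E \<noteq> 0" using corner_inj[OF ncf] by (simp add: E_def)
    have En: "E \<bullet> n = 0" using side_normal_edge[OF ncf, of k] by (simp add: E_def n_def inner_commute)
    obtain s where s: "0 < s" "s < 1" "u = (1 - s) *\<^sub>R corner f (k + 1) + s *\<^sub>R corner f (k + 2)"
      using uo unfolding open_side_def in_segment by blast
    \<comment> \<open>Steps below this bound stay inside the side and inside the ball of
      \<open>edge_development\<close>; \<open>c\<close> is half of it to get strict
      inequalities.\<close>
    define \<mu> where "\<mu> = min (min s (1 - s)) (e / norm E)"
    define c where "c = \<mu> / 2"
    have c: "0 < c" "c < s" "c < 1 - s" "c * norm E < e"
    proof -
      have "0 < \<mu>" using e(1) E0 s by (simp add: \<mu>_def)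
      moreover have "\<mu> \<le> s" "\<mu> \<le> 1 - s" "\<mu> \<le> e / norm E" by (auto simp: \<mu>_def)
      ultimately show "0 < c" "c < s" "c < 1 - s" by (simp_all add: c_def)
      have "c < e / norm E" using \<open>0 < \<mu>\<close> \<open>\<mu> \<le> e / norm E\<close> unfolding c_def by linarith
      then show "c * norm E < e" using E0 by (simp add: field_simps)
    qed
    define v where "v = c *\<^sub>R E"
    define \<alpha> where "\<alpha> = v \<bullet> rot n"
    have v: "v \<bullet> n = 0" "v \<noteq> 0" "norm v < e"
      using En c E0 by (simp_all add: v_def)
    have \<alpha>: "v \<bullet> v = \<alpha> * \<alpha>"
      using orthonormal_inner[OF n(1), of v v] v(1) by (simp add: \<alpha>_def)
    then have "\<bar>\<alpha>\<bar> = norm v" by (simp add: norm_eq_sqrt_inner)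
    \<comment> \<open>The step on the other side that cancels both squares in
      \<open>edge_development\<close>, so that \<open>u + v\<close> and \<open>w + v'\<close> lie
      over the same point of \<open>M\<close>.\<close>
    define v' where "v' = (\<sigma> * \<alpha>) *\<^sub>R rot n'"
    have v': "norm v' < e" "v' \<bullet> v' = \<alpha> * \<alpha>"
      using n e(2) \<open>\<bar>\<alpha>\<bar> = norm v\<close> v(3) by (auto simp: v'_def)
    have vn: "v \<bullet> n = 0" "v \<bullet> rot n = \<alpha>" "v' \<bullet> n' = 0" "v' \<bullet> rot n' = \<sigma> * \<alpha>"
      using n v(1) by (simp_all add: v'_def \<alpha>_def)
    have pt: "u + t *\<^sub>R v \<in> open_side f k" if "\<bar>t\<bar> = 1" for t
    proof -
      have "u + t *\<^sub>R v = (1 - (s + t * c)) *\<^sub>R corner f (k + 1) + (s + t * c) *\<^sub>R corner f (k + 2)"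
        by (simp add: s(3) v_def E_def algebra_simps)
      moreover have "0 < s + t * c" "s + t * c < 1" using c that s by (auto simp: abs_if split: if_splits)
      moreover have "corner f (k + 1) \<noteq> corner f (k + 2)" using E0 by (auto simp: E_def)
      ultimately show ?thesis unfolding open_side_def in_segment by blast
    qed
    have Ft: "F (u + t *\<^sub>R v) = apex_sqdist r f (u + t *\<^sub>R v) - apex_sqdist r g (w + t *\<^sub>R v')"
      if t: "\<bar>t\<bar> = 1" for t
    proof -
      have 1: "u + t *\<^sub>R v \<in> base_triangle f \<inter> ball u e"
        using pt[OF t] open_side_subset[OF ncf] v(3) t by (auto simp: dist_norm)
      have 2: "w + t *\<^sub>R v' \<in> base_triangle g \<inter> ball w e"
        unfolding e(4) using v'(1) t vn(3) by (simp add: dist_norm flip: n'_def)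
      have "(dist (place f (u + t *\<^sub>R v)) (place g (w + t *\<^sub>R v')))\<^sup>2 =
          (t * \<alpha> - \<sigma> * (t * (\<sigma> * \<alpha>)))\<^sup>2"
        using e(5)[OF 1 2] by (simp add: vn flip: n_def n'_def)
      also have "\<dots> = 0" using e(2) by auto
      finally have eq: "place f (u + t *\<^sub>R v) = place g (w + t *\<^sub>R v')" by simp
      have "u + t *\<^sub>R v \<notin> range (corner f)" using pt[OF t] open_side_not_corner[OF ncf, of k] by blast
      then have "w + t *\<^sub>R v' \<notin> range (corner g)"
        using non_vertex_iff[OF f, of "u + t *\<^sub>R v"] non_vertex_iff[OF g, of "w + t *\<^sub>R v'"] 1 2 eq by auto
      \<comment> \<open>The step is parallel to side \<open>l\<close>, so the moved point stays on
        the line of that side; a point of the triangle on this line that is no corner belongs to the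
        open side.\<close>
      moreover have "bary g l (w + t *\<^sub>R v') = 0"
      proof -
        have "grad g l \<bullet> v' = 0"
          by (simp add: v'_def n'_def side_normal_def sgn_div_norm rot_scaleR)
        then show ?thesis using w(1) open_side_bary[OF ncg] by (simp add: bary_add)
      qed
      ultimately have "w + t *\<^sub>R v' \<in> open_side g l"
      proof (cases rule: base_triangle_cases[OF ncg IntD1[OF 2]])
        case (2 j)
        then have "j = l"
          using \<open>bary g l (w + t *\<^sub>R v') = 0\<close> three_shift_cases[of l j] open_side_bary[OF ncg, of j] by auto
        then show ?thesis using 2 by simp
      next
        case 3
        then show ?thesis
          using \<open>bary g l (w + t *\<^sub>R v') = 0\<close> interior_base_triangle[OF ncg] by (metis less_irrefl mem_Collect_eq)
      qed blast
      then show ?thesis using Q os(2) eq by (simp add: F_def subset_iff)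
    qed
    have "F (u + v) + F (u - v) = 2 * F u"
    proof -
      have "F u = apex_sqdist r f u - apex_sqdist r g w"
        using Q[of w] w os(2) by (simp add: F_def subset_iff)
      moreover have "F (u + v) = apex_sqdist r f (u + v) - apex_sqdist r g (w + v')"
        "F (u - v) = apex_sqdist r f (u - v) - apex_sqdist r g (w - v')"
        using Ft[of 1] Ft[of "-1"] by simp_all
      ultimately show ?thesis
        using apex_sqdist_parallelogram[of r f u v] apex_sqdist_parallelogram[of r g w v'] \<alpha> v'(2)
        by linarith
    qed
    moreover have "u + v \<in> K" "u - v \<in> K" using pt[of 1] pt[of "-1"] os(1) by auto
    ultimately show ?thesis using v(2) by blast
  qed
  have "0 \<le> F x"
  proof (rule midpoint_concave_nonneg[of K F "range (corner f)"])
    show "\<exists>v. v \<noteq> 0 \<and> u + v \<in> K \<and> u - v \<in> K \<and> F (u + v) + F (u - v) \<le> 2 * F u"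
      if "u \<in> K - range (corner f)" for u using mid[OF that] by (metis order_refl)
  qed (use contF F_end x os in \<open>auto simp: K_def\<close>)
  moreover have "0 \<le> - F x"
  proof (rule midpoint_concave_nonneg[of K "\<lambda>u. - F u" "range (corner f)"])
    show "\<exists>v. v \<noteq> 0 \<and> u + v \<in> K \<and> u - v \<in> K \<and> - F (u + v) + - F (u - v) \<le> 2 * - F u"
      if u: "u \<in> K - range (corner f)" for u
    proof -
      obtain v where v: "v \<noteq> 0" "u + v \<in> K" "u - v \<in> K" "F (u + v) + F (u - v) = 2 * F u"
        using mid[OF u] by blast
      then have "- F (u + v) + - F (u - v) \<le> 2 * - F u" by linarith
      then show ?thesis using v by blast
    qed
    show "continuous_on K (\<lambda>u. - F u)" by (intro continuous_intros contF)
  qed (use F_end x os in \<open>auto simp: K_def\<close>)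
  ultimately have "F x = 0" by simp
  then show ?thesis using Q[of y] y os(2) m by (simp add: F_def subset_iff)
qed auto

lemma apex_sqdist_well_defined:
  assumes f: "f \<in> T" "x \<in> base_triangle f" and g: "g \<in> T" "y \<in> base_triangle g"
    and m: "place f x = place g y"
  shows "apex_sqdist r f x = apex_sqdist r g y"
proof (cases "place f x \<in> vertices T")
  case True
  then show ?thesis using apex_sqdist_vertex[OF f] apex_sqdist_vertex[OF g] m by simp
next
  case False
  then have nc: "x \<notin> range (corner f)" "y \<notin> range (corner g)"
    using non_vertex_iff[OF f] non_vertex_iff[OF g] m by auto
  have mem: "(f, x) \<in> preimages (place f x)" "(g, y) \<in> preimages (place f x)"
    using f g m by (auto simp: preimages_def)
  show ?thesis
  proof (cases rule: base_triangle_cases[OF noncollinear[OF f(1)] f(2)])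
    case (2 k)
    note x = 2
    show ?thesis
    proof (cases rule: base_triangle_cases[OF noncollinear[OF g(1)] g(2)])
      case (2 l)
      then show ?thesis using apex_sqdist_side[OF f(1) x g(1) _ m] by blast
    next
      case 3
      then have "preimages (place f x) = {(g, y)}" using preimages_interior[OF g(1) 3] m by simp
      then show ?thesis using mem by simp
    qed (use nc in auto)
  next
    case 3
    then show ?thesis using preimages_interior[OF f(1) 3] mem by simp
  qed (use nc in auto)
qed

lemma boundary_sqdist_place:
  assumes "f \<in> T" "x \<in> base_triangle f"
  shows "boundary_sqdist T r (place f x) = apex_sqdist r f x"
proof -
  define c where "c = (SOME (g, y). g \<in> T \<and> y \<in> base_triangle g \<and> place g y = place f x)"
  have "case c of (g, y) \<Rightarrow> g \<in> T \<and> y \<in> base_triangle g \<and> place g y = place f x"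
    unfolding c_def by (rule someI[of _ "(f, x)"]) (use assms in simp)
  then obtain g y where c: "c = (g, y)" and g: "g \<in> T" "y \<in> base_triangle g" "place g y = place f x"
    by (cases c) auto
  have "boundary_sqdist T r (place f x) = apex_sqdist r g y"
    unfolding boundary_sqdist_def c_def[symmetric] c by simp
  then show ?thesis using apex_sqdist_well_defined[OF g(1,2) assms g(3)] by simp
qed

lemma boundary_sqdist_vertex:
  assumes "v \<in> vertices T"
  shows "boundary_sqdist T r v = (r v)\<^sup>2"
proof -
  obtain f k where f: "f \<in> T" "v = place f (corner f k)" using assms by (auto simp: vertices_def)
  then show ?thesis
    using boundary_sqdist_place[OF f(1) corner_mem[OF noncollinear[OF f(1)]], of k] apex_sqdist_corner[OF f(1)]
    by simp
qed

lemma place_image: "M = (\<Union>f\<in>T. place f ` base_triangle f)"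
proof
  show "M \<subseteq> (\<Union>f\<in>T. place f ` base_triangle f)"
  proof
    fix m assume "m \<in> M"
    then obtain f x where "f \<in> T" "x \<in> base_triangle f" "place f x = m" by (rule preimages_nonempty)
    then show "m \<in> (\<Union>f\<in>T. place f ` base_triangle f)" by auto
  qed
  show "(\<Union>f\<in>T. place f ` base_triangle f) \<subseteq> M" by (auto intro: place_in)
qed

lemma continuous_boundary_sqdist: "continuous_on M (boundary_sqdist T r)"
  unfolding place_image
proof (rule continuous_on_closed_Union[OF finite_T])
  fix f assume f: "f \<in> T"
  note K = compact_base_triangle[OF noncollinear[OF f]]
  show "closed (place f ` base_triangle f)"
    by (intro compact_imp_closed compact_continuous_image place_cont[OF f] K)
  show "continuous_on (place f ` base_triangle f) (boundary_sqdist T r)"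
  proof (rule continuous_on_compact_image[OF K place_cont[OF f]])
    have "continuous_on (base_triangle f) (apex_sqdist r f)"
      by (rule continuous_apex_sqdist[OF continuous_on_id])
    then show "continuous_on (base_triangle f) (\<lambda>x. boundary_sqdist T r (place f x))"
      by (subst continuous_on_cong[OF refl boundary_sqdist_place[OF f]]) auto
  qed
qed

end

section \<open>Concavity of the squared distance to the apex\<close>

context polyhedral_couple
begin

lemma preimages_pair:
  assumes f: "f \<in> T" and x: "x \<in> open_side f k" and g: "g \<in> T" "y \<in> base_triangle g"
    and m: "place f x = place g y" and ne: "(f, x) \<noteq> (g, y)"
  shows "preimages (place f x) = {(f, x), (g, y)}"
proof -
  obtain g' l' y' where p: "preimages (place f x) = {(f, x), (g', y')}"
    by (rule preimages_side[OF f x])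
  moreover have "(g, y) \<in> preimages (place f x)" using g m by (simp add: preimages_def)
  ultimately show ?thesis using ne by auto
qed

text \<open>The squared distances from the two faces agree at \<open>x\<close> and at a second point
  of the edge. Comparing the increments shows that, after unfolding, the feet of the two apices have
  the same position along the edge.\<close>

lemma apex_tangential_match:
  assumes f: "f \<in> T" and x: "x \<in> open_side f k" and g: "g \<in> T" and y: "y \<in> open_side g l"
    and m: "place f x = place g y" and e: "0 < e" and \<sigma>: "\<sigma> = 1 \<or> \<sigma> = (-1::real)"
    and bf: "base_triangle f \<inter> ball x e = {u \<in> ball x e. 0 \<le> (u - x) \<bullet> side_normal f k}"
    and bg: "base_triangle g \<inter> ball y e = {v \<in> ball y e. 0 \<le> (v - y) \<bullet> side_normal g l}"
    and dev: "\<And>u v. u \<in> base_triangle f \<inter> ball x e \<Longrightarrow> v \<in> base_triangle g \<inter> ball y e \<Longrightarrow>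
      (dist (place f u) (place g v))\<^sup>2 =
      ((u - x) \<bullet> side_normal f k + (v - y) \<bullet> side_normal g l)\<^sup>2 +
      ((u - x) \<bullet> rot (side_normal f k) - \<sigma> * ((v - y) \<bullet> rot (side_normal g l)))\<^sup>2"
  shows "(fst (apex r f) - x) \<bullet> rot (side_normal f k) = \<sigma> * ((fst (apex r g) - y) \<bullet> rot (side_normal g l))"
proof -
  note ncf = noncollinear[OF f] and ncg = noncollinear[OF g]
  define n n' where "n = side_normal f k" and "n' = side_normal g l"
  have n: "norm n = 1" "n \<bullet> n = 1" "norm n' = 1" "n' \<bullet> n' = 1"
    using norm_side_normal[OF ncf] norm_side_normal[OF ncg] by (simp_all add: n_def n'_def norm_eq_1)
  define s where "s = e / 2"
  have s: "0 < s" "s < e" using e by (simp_all add: s_def)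
  \<comment> \<open>Steps of length \<open>s\<close> along the two sides that lead to the same point
    of \<open>M\<close>.\<close>
  define u v where "u = s *\<^sub>R rot n" and "v = (\<sigma> * s) *\<^sub>R rot n'"
  have uv: "norm u < e" "norm v < e" "u \<bullet> n = 0" "v \<bullet> n' = 0" "u \<bullet> rot n = s" "v \<bullet> rot n' = \<sigma> * s"
    "u \<bullet> u = s * s" "v \<bullet> v = s * s"
    using s \<sigma> n by (auto simp: u_def v_def)
  have 1: "x + u \<in> base_triangle f \<inter> ball x e" unfolding bf using uv by (simp add: dist_norm flip: n_def)
  have 2: "y + v \<in> base_triangle g \<inter> ball y e" unfolding bg using uv by (simp add: dist_norm flip: n'_def)
  have "(dist (place f (x + u)) (place g (y + v)))\<^sup>2 = (s - \<sigma> * (\<sigma> * s))\<^sup>2"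
    using dev[OF 1 2] by (simp add: uv flip: n_def n'_def)
  also have "\<dots> = 0" using \<sigma> by auto
  finally have "place f (x + u) = place g (y + v)" by simp
  then have "apex_sqdist r f (x + u) = apex_sqdist r g (y + v)"
    using apex_sqdist_well_defined[OF f _ g] 1 2 by blast
  then have "u \<bullet> (fst (apex r f) - x) = v \<bullet> (fst (apex r g) - y)"
    using apex_sqdist_side[OF f x g y m] by (simp add: apex_sqdist_add uv)
  then have "s * (rot n \<bullet> (fst (apex r f) - x)) = s * (\<sigma> * (rot n' \<bullet> (fst (apex r g) - y)))"
    by (simp add: u_def v_def mult_ac)
  then show ?thesis using s by (simp add: n_def n'_def inner_commute)
qed

text \<open>Every side over the edge contains a preimage of the point, and there are only two
  preimages, each on one side. The two sides differ, since \<open>place\<close> is injective on a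
  single open side, so the sum has exactly two terms.\<close>

lemma edge_angle_pair:
  assumes f: "f \<in> T" and x: "x \<in> open_side f k" and g: "g \<in> T" and y: "y \<in> open_side g l"
    and m: "place f x = place g y" and ne: "(f, x) \<noteq> (g, y)"
  shows "edge_angle T r (open_edge f k) = base_angle r f k + base_angle r g l"
proof -
  note ncf = noncollinear[OF f] and ncg = noncollinear[OF g]
  have yb: "y \<in> base_triangle g" using y open_side_subset[OF ncg] by blast
  have edge: "open_edge f k = open_edge g l" by (rule open_edge_eq[OF f g x y m])
  have kl: "(f, k) \<noteq> (g, l)"
  proof
    assume eq: "(f, k) = (g, l)"
    then have "x = y" using inj_onD[OF place_inj_side[OF f, of k], of x y] x y m by auto
    then show False using eq ne by auto
  qed
  have "{(f', k'). f' \<in> T \<and> open_edge f' k' = open_edge f k} = {(f, k), (g, l)}"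
  proof (intro equalityI subsetI)
    fix c assume "c \<in> {(f', k'). f' \<in> T \<and> open_edge f' k' = open_edge f k}"
    then obtain f' k' where c: "c = (f', k')" "f' \<in> T" "open_edge f' k' = open_edge f k" by auto
    have "place f x \<in> open_edge f' k'" unfolding c(3) using x by (simp add: open_edge_def)
    then obtain x' where x': "x' \<in> open_side f' k'" "place f' x' = place f x" by (auto simp: open_edge_def)
    then have "(f', x') \<in> preimages (place f x)"
      using c(2) open_side_subset[OF noncollinear[OF c(2)], of k'] by (auto simp: preimages_def)
    then have "(f', x') = (f, x) \<or> (f', x') = (g, y)"
      unfolding preimages_pair[OF f x g yb m ne] by blast
    then show "c \<in> {(f, k), (g, l)}"
      using open_side_unique[OF ncf x, of k'] open_side_unique[OF ncg y, of l]
        open_side_unique[OF ncg y, of k'] x'(1) c(1) by auto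
  qed (use f g edge in auto)
  then show ?thesis unfolding edge_angle_def using kl by simp
qed

text \<open>With equal tangential parts both apices have the same distance \<open>\<rho>\<close>
  from the line of the edge, so the two angles are the arc cosines of \<open>d / \<rho>\<close> and
  \<open>d' / \<rho>\<close>; their sum is at most \<open>pi\<close> exactly if
  \<open>d + d'\<close> is nonnegative. Along the inner normals the squared distance has slopes
  \<open>- 2 * d\<close> and \<open>- 2 * d'\<close>, so this is the downward jump of the
  slope.\<close>

lemma apex_normal_sum_nonneg:
  assumes f: "f \<in> T" and x: "x \<in> open_side f k" and g: "g \<in> T" and y: "y \<in> open_side g l"
    and m: "place f x = place g y" and ne: "(f, x) \<noteq> (g, y)"
    and convex: "edge_angle T r (open_edge f k) \<le> pi"
    and tan: "((fst (apex r f) - x) \<bullet> rot (side_normal f k))\<^sup>2 = ((fst (apex r g) - y) \<bullet> rot (side_normal g l))\<^sup>2"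
  shows "0 \<le> (fst (apex r f) - x) \<bullet> side_normal f k + (fst (apex r g) - y) \<bullet> side_normal g l"
proof -
  note ncf = noncollinear[OF f] and ncg = noncollinear[OF g]
  define d d' where "d = (fst (apex r f) - x) \<bullet> side_normal f k" and "d' = (fst (apex r g) - y) \<bullet> side_normal g l"
  define h h' where "h = snd (apex r f)" and "h' = snd (apex r g)"
  have "apex_sqdist r f x = d\<^sup>2 + ((fst (apex r f) - x) \<bullet> rot (side_normal f k))\<^sup>2 + h\<^sup>2"
    unfolding apex_sqdist_eq d_def h_def
    by (subst orthonormal_inner[OF norm_side_normal[OF ncf, of k]]) (simp add: power2_eq_square)
  moreover have "apex_sqdist r g y = d'\<^sup>2 + ((fst (apex r g) - y) \<bullet> rot (side_normal g l))\<^sup>2 + h'\<^sup>2"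
    unfolding apex_sqdist_eq d'_def h'_def
    by (subst orthonormal_inner[OF norm_side_normal[OF ncg, of l]]) (simp add: power2_eq_square)
  ultimately have eq: "d\<^sup>2 + h\<^sup>2 = d'\<^sup>2 + h'\<^sup>2" using apex_sqdist_side[OF f x g y m] tan by linarith
  define \<rho> where "\<rho> = sqrt (d\<^sup>2 + h\<^sup>2)"
  have \<rho>: "0 < \<rho>" using apex_height[OF f] by (simp add: \<rho>_def h_def add_nonneg_pos)
  have le: "\<bar>d\<bar> \<le> \<rho>" "\<bar>d'\<bar> \<le> \<rho>"
    unfolding \<rho>_def by (simp add: real_le_rsqrt) (simp add: eq real_le_rsqrt)
  have "base_angle r f k = arccos (d / \<rho>)" "base_angle r g l = arccos (d' / \<rho>)"
    using base_angle_eq[OF ncf x, of r] base_angle_eq[OF ncg y, of r] eq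
    by (simp_all add: \<rho>_def d_def d'_def h_def h'_def)
  then have "arccos (d / \<rho>) \<le> pi - arccos (d' / \<rho>)"
    using convex edge_angle_pair[OF f x g y m ne] by simp
  also have "\<dots> = arccos (- (d' / \<rho>))"
    using le \<rho> by (subst arccos_minus) (auto simp: field_simps abs_le_iff)
  finally have "- (d' / \<rho>) \<le> d / \<rho>"
    using le \<rho> by (subst (asm) arccos_le_mono) (auto simp: field_simps)
  then show ?thesis using \<rho> unfolding d_def[symmetric] d'_def[symmetric] by (simp add: field_simps)
qed

text \<open>Two vectors of length \<open>\<tau>\<close> at distance \<open>2 * \<tau>\<close> are
  opposite, by the parallelogram law.\<close>

lemma midpoint_same_face:
  assumes v: "norm v = \<tau>" "norm v' = \<tau>" "norm (v - v') = 2 * \<tau>"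
  shows "apex_sqdist r f (x + v) + apex_sqdist r f (x + v') = 2 * apex_sqdist r f x + 2 * \<tau>\<^sup>2"
proof -
  have "(norm (v + v'))\<^sup>2 + (norm (v - v'))\<^sup>2 = 2 * (norm v)\<^sup>2 + 2 * (norm v')\<^sup>2"
    by (simp add: power2_norm_eq_inner inner_add_left inner_add_right inner_diff_left inner_diff_right)
  then have "(norm (v + v'))\<^sup>2 = 0" unfolding v by (simp add: power2_eq_square)
  then have "v' = - v" by (simp add: add_eq_0_iff)
  then show ?thesis
    using apex_sqdist_parallelogram[of r f x v] v(1) by (simp flip: power2_norm_eq_inner)
qed

text \<open>The midpoint condition forces the unfolded displacements to be opposite. Their
  tangential contributions then cancel, and the normal ones combine to a nonnegative multiple of the
  sum bounded in \<open>apex_normal_sum_nonneg\<close>.\<close>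

lemma midpoint_adjacent_faces:
  assumes f: "f \<in> T" and x: "x \<in> open_side f k" and g: "g \<in> T" and y: "y \<in> open_side g l"
    and m: "place f x = place g y" and ne: "(f, x) \<noteq> (g, y)"
    and convex: "edge_angle T r (open_edge f k) \<le> pi"
  obtains e where "0 < e" "\<And>u v \<tau>. u \<in> base_triangle f \<inter> ball x e \<Longrightarrow> v \<in> base_triangle g \<inter> ball y e \<Longrightarrow>
      dist x u = \<tau> \<Longrightarrow> dist y v = \<tau> \<Longrightarrow> dist (place f u) (place g v) = 2 * \<tau> \<Longrightarrow>
      apex_sqdist r f u + apex_sqdist r g v \<le> 2 * apex_sqdist r f x + 2 * \<tau>\<^sup>2"
proof -
  note ncf = noncollinear[OF f] and ncg = noncollinear[OF g]
  obtain e \<sigma> where e: "0 < e" "\<sigma> = 1 \<or> \<sigma> = (-1::real)"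
    "base_triangle f \<inter> ball x e = {u \<in> ball x e. 0 \<le> (u - x) \<bullet> side_normal f k}"
    "base_triangle g \<inter> ball y e = {v \<in> ball y e. 0 \<le> (v - y) \<bullet> side_normal g l}"
    "\<And>u v. u \<in> base_triangle f \<inter> ball x e \<Longrightarrow> v \<in> base_triangle g \<inter> ball y e \<Longrightarrow>
      (dist (place f u) (place g v))\<^sup>2 =
      ((u - x) \<bullet> side_normal f k + (v - y) \<bullet> side_normal g l)\<^sup>2 +
      ((u - x) \<bullet> rot (side_normal f k) - \<sigma> * ((v - y) \<bullet> rot (side_normal g l)))\<^sup>2"
    by (rule edge_development[OF f x g y m ne]) blast
  define n n' where "n = side_normal f k" and "n' = side_normal g l"
  have n: "norm n = 1" "norm n' = 1"
    using norm_side_normal[OF ncf] norm_side_normal[OF ncg] by (simp_all add: n_def n'_def)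
  define p q where "p = fst (apex r f) - x" and "q = fst (apex r g) - y"
  have tan: "p \<bullet> rot n = \<sigma> * (q \<bullet> rot n')"
    unfolding p_def q_def n_def n'_def by (rule apex_tangential_match[OF f x g y m e])
  have nonneg: "0 \<le> p \<bullet> n + q \<bullet> n'"
    unfolding p_def q_def n_def n'_def
  proof (rule apex_normal_sum_nonneg[OF f x g y m ne convex])
    show "((fst (apex r f) - x) \<bullet> rot (side_normal f k))\<^sup>2 = ((fst (apex r g) - y) \<bullet> rot (side_normal g l))\<^sup>2"
      using tan e(2) unfolding p_def q_def n_def n'_def by auto
  qed
  show ?thesis
  proof (rule that[OF e(1)])
    fix u v \<tau>
    assume u: "u \<in> base_triangle f \<inter> ball x e" and v: "v \<in> base_triangle g \<inter> ball y e"
      and \<tau>: "dist x u = \<tau>" "dist y v = \<tau>" "dist (place f u) (place g v) = 2 * \<tau>"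
    define \<beta> \<alpha> \<beta>' \<alpha>' where defs: "\<beta> = (u - x) \<bullet> n" "\<alpha> = (u - x) \<bullet> rot n"
      "\<beta>' = (v - y) \<bullet> n'" "\<alpha>' = (v - y) \<bullet> rot n'"
    have uu: "(u - x) \<bullet> (u - x) = \<tau>\<^sup>2" "(v - y) \<bullet> (v - y) = \<tau>\<^sup>2"
      using \<tau>(1,2) by (simp_all add: dist_norm norm_minus_commute flip: power2_norm_eq_inner)
    then have 1: "\<beta>\<^sup>2 + \<alpha>\<^sup>2 = \<tau>\<^sup>2" "\<beta>'\<^sup>2 + \<alpha>'\<^sup>2 = \<tau>\<^sup>2"
      using orthonormal_inner[OF n(1), of "u - x" "u - x"] orthonormal_inner[OF n(2), of "v - y" "v - y"]
      by (simp_all add: defs power2_eq_square)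
    have 2: "4 * \<tau>\<^sup>2 = (\<beta> + \<beta>')\<^sup>2 + (\<alpha> - \<sigma> * \<alpha>')\<^sup>2"
      using e(5)[OF u v] \<tau>(3) by (simp add: defs n_def n'_def power_mult_distrib)
    \<comment> \<open>Parallelogram law for the two unfolded vectors: one diagonal has the full
      length \<open>2 * \<tau>\<close>, so the other one vanishes.\<close>
    have "(\<beta> - \<beta>')\<^sup>2 + (\<alpha> + \<sigma> * \<alpha>')\<^sup>2 = 2 * (\<beta>\<^sup>2 + \<alpha>\<^sup>2) + 2 * (\<beta>'\<^sup>2 + \<alpha>'\<^sup>2) - ((\<beta> + \<beta>')\<^sup>2 + (\<alpha> - \<sigma> * \<alpha>')\<^sup>2)"
      using e(2) by (auto simp: power2_eq_square algebra_simps)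
    also have "\<dots> = 0" unfolding 1 2[symmetric] by simp
    finally have 3: "\<beta>' = \<beta>" "\<alpha> = - \<sigma> * \<alpha>'" by (simp_all add: sum_power2_eq_zero_iff)
    have \<beta>: "0 \<le> \<beta>" using u unfolding e(3) by (simp add: defs n_def)
    have "(u - x) \<bullet> p = \<beta> * (p \<bullet> n) + \<alpha> * (p \<bullet> rot n)" "(v - y) \<bullet> q = \<beta>' * (q \<bullet> n') + \<alpha>' * (q \<bullet> rot n')"
      using orthonormal_inner[OF n(1), of "u - x" p] orthonormal_inner[OF n(2), of "v - y" q] by (simp_all add: defs)
    then have "(u - x) \<bullet> p + (v - y) \<bullet> q = \<beta> * (p \<bullet> n + q \<bullet> n')"
      using 3 tan e(2) by (auto simp: algebra_simps)
    then have "0 \<le> (u - x) \<bullet> p + (v - y) \<bullet> q" using \<beta> nonneg by simp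
    moreover have "apex_sqdist r f u = apex_sqdist r f x + \<tau>\<^sup>2 - 2 * ((u - x) \<bullet> p)"
      "apex_sqdist r g v = apex_sqdist r g y + \<tau>\<^sup>2 - 2 * ((v - y) \<bullet> q)"
      using apex_sqdist_add[of r f x "u - x"] apex_sqdist_add[of r g y "v - y"] uu by (simp_all add: p_def q_def)
    ultimately show "apex_sqdist r f u + apex_sqdist r g v \<le> 2 * apex_sqdist r f x + 2 * \<tau>\<^sup>2"
      using apex_sqdist_side[OF f x g y m] by linarith
  qed
qed

text \<open>The hypotheses on \<open>m1\<close> and \<open>m2\<close> mention only distances in
  \<open>M\<close>, not faces of \<open>T\<close>. This lets the inequality be used along segments
  that come from a different triangulation.\<close>

lemma boundary_sqdist_midpoint:
  assumes convex: "\<And>e. e \<in> edges T \<Longrightarrow> edge_angle T r e \<le> pi"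
    and m: "m \<in> M" "m \<notin> vertices T"
  obtains d where "0 < d" "\<And>m1 m2 \<tau>. m1 \<in> M \<Longrightarrow> m2 \<in> M \<Longrightarrow> dist m m1 = \<tau> \<Longrightarrow> dist m m2 = \<tau> \<Longrightarrow>
      dist m1 m2 = 2 * \<tau> \<Longrightarrow> \<tau> < d \<Longrightarrow>
      boundary_sqdist T r m1 + boundary_sqdist T r m2 \<le> 2 * boundary_sqdist T r m + 2 * \<tau>\<^sup>2"
proof -
  \<comment> \<open>It is not known in advance over which preimages of \<open>m\<close> the points
    \<open>m1\<close> and \<open>m2\<close> will be seen, so one radius must work for all pairs.
    Equal preimages give a segment within one face, distinct ones a segment across an edge.\<close>
  define P where "P = (\<lambda>((f :: 'a face, x), (g :: 'a face, y)) d. \<forall>u\<in>base_triangle f \<inter> ball x d.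
    \<forall>v\<in>base_triangle g \<inter> ball y d. \<forall>\<tau>. dist x u = \<tau> \<longrightarrow> dist y v = \<tau> \<longrightarrow>
    dist (place f u) (place g v) = 2 * \<tau> \<longrightarrow>
    apex_sqdist r f u + apex_sqdist r g v \<le> 2 * boundary_sqdist T r m + 2 * \<tau>\<^sup>2)"
  obtain e where e: "e > 0" "\<And>c. c \<in> preimages m \<times> preimages m \<Longrightarrow> P c e"
  proof (rule finite_uniform_radius[of "preimages m \<times> preimages m" P])
    show "finite (preimages m \<times> preimages m)" using finite_preimages[OF m] by simp
    fix c assume c: "c \<in> preimages m \<times> preimages m"
    obtain f x g y where cf: "c = ((f, x), (g, y))" by (metis surj_pair)
    have fx: "(f, x) \<in> preimages m" and gy: "(g, y) \<in> preimages m" using c by (simp_all add: cf)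
    have f: "f \<in> T" "x \<in> base_triangle f" "place f x = m" and g: "g \<in> T" "y \<in> base_triangle g" "place g y = m"
      using fx gy by (simp_all add: preimages_def)
    have sq: "boundary_sqdist T r m = apex_sqdist r f x" using boundary_sqdist_place[OF f(1,2)] f(3) by simp
    have nc: "x \<notin> range (corner f)" "y \<notin> range (corner g)"
      using non_vertex_iff[OF f(1,2)] non_vertex_iff[OF g(1,2)] f(3) g(3) m(2) by auto
    show "\<exists>d>0. P c d"
    proof (cases "(f, x) = (g, y)")
      case True
      have "x \<in> base_triangle f - range (corner f)" using f nc by simp
      then obtain d where d: "0 < d" "\<And>u v. u \<in> base_triangle f \<inter> ball x d \<Longrightarrow> v \<in> base_triangle f \<inter> ball x d \<Longrightarrow>
          dist (place f u) (place f v) = dist u v"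
        by (rule place_local_isometry[OF f(1)]) blast
      have "apex_sqdist r f u + apex_sqdist r f v \<le> 2 * apex_sqdist r f x + 2 * \<tau>\<^sup>2"
        if uv: "u \<in> base_triangle f \<inter> ball x d" "v \<in> base_triangle f \<inter> ball x d"
          and \<tau>: "dist x u = \<tau>" "dist x v = \<tau>" "dist (place f u) (place f v) = 2 * \<tau>" for u v \<tau>
      proof -
        have "norm (u - x) = \<tau>" "norm (v - x) = \<tau>" "norm ((u - x) - (v - x)) = 2 * \<tau>"
          using \<tau> d(2)[OF uv] by (simp_all add: dist_norm norm_minus_commute)
        then show ?thesis using midpoint_same_face[of "u - x" \<tau> "v - x" f x] by simp
      qed
      then have "P c d" unfolding P_def cf prod.case sq using True by blast
      then show ?thesis using d(1) by blast
    next
      case False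
      have "x \<notin> interior (base_triangle f)"
        using preimages_interior[OF f(1), of x] gy False f(3) by auto
      then obtain k where x: "x \<in> open_side f k"
        using base_triangle_cases[OF noncollinear[OF f(1)] f(2)] nc(1) by blast
      have "y \<notin> interior (base_triangle g)"
        using preimages_interior[OF g(1), of y] fx False g(3) by auto
      then obtain l where y: "y \<in> open_side g l"
        using base_triangle_cases[OF noncollinear[OF g(1)] g(2)] nc(2) by blast
      have "open_edge f k \<in> edges T" using f(1) by (auto simp: edges_def)
      note cv = convex[OF this]
      have "place f x = place g y" using f g by simp
      obtain d where d: "0 < d" "\<And>u v \<tau>. u \<in> base_triangle f \<inter> ball x d \<Longrightarrow> v \<in> base_triangle g \<inter> ball y d \<Longrightarrow>
        dist x u = \<tau> \<Longrightarrow> dist y v = \<tau> \<Longrightarrow> dist (place f u) (place g v) = 2 * \<tau> \<Longrightarrow>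
        apex_sqdist r f u + apex_sqdist r g v \<le> 2 * apex_sqdist r f x + 2 * \<tau>\<^sup>2"
        by (rule midpoint_adjacent_faces[OF f(1) x g(1) y \<open>place f x = place g y\<close> False cv]) blast
      have "P c d" unfolding P_def cf prod.case sq using d(2) by blast
      then show ?thesis using d(1) by blast
    qed
  qed (auto simp: P_def)
  obtain d where d: "0 < d" "\<And>m'. m' \<in> M \<Longrightarrow> dist m' m < d \<Longrightarrow>
    \<exists>f x x'. (f, x) \<in> preimages m \<and> (f, x') \<in> preimages m' \<and> dist x x' = dist m m' \<and> dist x x' < e"
    by (rule isometric_nearby[OF m e(1)]) blast
  show ?thesis
  proof (rule that[OF d(1)])
    fix m1 m2 \<tau> assume a: "m1 \<in> M" "m2 \<in> M" "dist m m1 = \<tau>" "dist m m2 = \<tau>" "dist m1 m2 = 2 * \<tau>" "\<tau> < d"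
    obtain f x u where f: "(f, x) \<in> preimages m" "(f, u) \<in> preimages m1" "dist x u = \<tau>" "\<tau> < e"
      using d(2)[OF a(1)] a by (metis dist_commute)
    obtain g y v where g: "(g, y) \<in> preimages m" "(g, v) \<in> preimages m2" "dist y v = \<tau>"
      using d(2)[OF a(2)] a by (metis dist_commute)
    have fu: "f \<in> T" "u \<in> base_triangle f" "place f u = m1" and gv: "g \<in> T" "v \<in> base_triangle g" "place g v = m2"
      using f(2) g(2) by (simp_all add: preimages_def)
    have "P ((f, x), (g, y)) e" using e(2) f(1) g(1) by blast
    moreover have "u \<in> base_triangle f \<inter> ball x e" "v \<in> base_triangle g \<inter> ball y e" using fu gv f g by simp_all
    moreover have "dist (place f u) (place g v) = 2 * \<tau>" using fu gv a by simp
    ultimately have "apex_sqdist r f u + apex_sqdist r g v \<le> 2 * boundary_sqdist T r m + 2 * \<tau>\<^sup>2"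
      unfolding P_def prod.case using f(3) g(3) by blast
    then show "boundary_sqdist T r m1 + boundary_sqdist T r m2 \<le> 2 * boundary_sqdist T r m + 2 * \<tau>\<^sup>2"
      using boundary_sqdist_place[OF fu(1,2)] boundary_sqdist_place[OF gv(1,2)] fu(3) gv(3) by simp
  qed
qed

end

lemma convex_boundary_sqdist_maximal:
  assumes 1: "polyhedral_couple M T r" and 2: "polyhedral_couple M T' r"
    and convex: "\<And>e. e \<in> edges T \<Longrightarrow> edge_angle T r e \<le> pi" and m: "m \<in> M"
  shows "boundary_sqdist T' r m \<le> boundary_sqdist T r m"
proof -
  interpret A: polyhedral_couple M T r by (rule 1)
  interpret B: polyhedral_couple M T' r by (rule 2)
  have vert: "vertices T' = vertices T"
    using A.tri B.tri by (simp add: geodesic_triangulation_def)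
  obtain g y where g: "g \<in> T'" "y \<in> base_triangle g" "place g y = m" by (rule B.preimages_nonempty[OF m])
  note nc = B.noncollinear[OF g(1)]
  \<comment> \<open>On the face \<open>g\<close> the second term has second difference exactly
    \<open>2 * (norm v)\<^sup>2\<close>, the same amount that
    \<open>boundary_sqdist_midpoint\<close> allows for the first; so \<open>F\<close> satisfies the
    midpoint inequality without an error term.\<close>
  define F where "F = (\<lambda>u. boundary_sqdist T r (place g u) - apex_sqdist r g u)"
  have "0 \<le> F y"
  proof (rule midpoint_concave_nonneg[of "base_triangle g" F "range (corner g)"])
    show "compact (base_triangle g)" by (rule compact_base_triangle[OF nc])
    have "place g ` base_triangle g \<subseteq> M" using B.place_in[OF g(1)] by blast
    then show "continuous_on (base_triangle g) F"
      unfolding F_def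
      by (intro continuous_intros continuous_on_compose2[OF A.continuous_boundary_sqdist B.place_cont[OF g(1)]])
    show "0 \<le> F u" if "u \<in> range (corner g) \<inter> base_triangle g" for u
    proof -
      have "place g u \<in> vertices T'" using B.corner_vertex[OF g(1)] that by blast
      then show ?thesis
        using A.boundary_sqdist_vertex[of "place g u"] B.apex_sqdist_vertex[OF g(1), of u] that vert
        by (simp add: F_def)
    qed
    fix u assume u: "u \<in> base_triangle g - range (corner g)"
    have uM: "place g u \<in> M" "place g u \<notin> vertices T"
      using u B.place_in[OF g(1)] B.non_vertex_iff[OF g(1)] vert by auto
    obtain w where w: "w \<noteq> 0" "\<And>t. \<bar>t\<bar> \<le> 1 \<Longrightarrow> u + t *\<^sub>R w \<in> base_triangle g"
      by (rule non_corner_segment[OF nc u]) blast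
    obtain e where e: "0 < e" "\<And>a b. a \<in> base_triangle g \<inter> ball u e \<Longrightarrow> b \<in> base_triangle g \<inter> ball u e \<Longrightarrow>
      dist (place g a) (place g b) = dist a b"
      by (rule B.place_local_isometry[OF g(1) u]) blast
    obtain d where d: "0 < d" "\<And>m1 m2 \<tau>. m1 \<in> M \<Longrightarrow> m2 \<in> M \<Longrightarrow> dist (place g u) m1 = \<tau> \<Longrightarrow>
      dist (place g u) m2 = \<tau> \<Longrightarrow> dist m1 m2 = 2 * \<tau> \<Longrightarrow> \<tau> < d \<Longrightarrow>
      boundary_sqdist T r m1 + boundary_sqdist T r m2 \<le> 2 * boundary_sqdist T r (place g u) + 2 * \<tau>\<^sup>2"
      by (rule A.boundary_sqdist_midpoint[OF convex uM]) blast+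
    \<comment> \<open>Keeps the symmetric pair in the triangle and makes the step at most half of
      both local radii.\<close>
    define t where "t = min 1 (min e d / (2 * norm w))"
    have t: "0 < t" "t \<le> 1" using e(1) d(1) w(1) by (auto simp: t_def)
    have "t * norm w \<le> min e d / 2"
    proof -
      have "t \<le> min e d / (2 * norm w)" by (simp add: t_def)
      then show ?thesis using w(1) by (simp add: field_simps)
    qed
    moreover have "0 < min e d" using e d by simp
    ultimately have tw: "t * norm w < min e d" by linarith
    define v where "v = t *\<^sub>R w"
    have v: "v \<noteq> 0" "norm v < e" "norm v < d" using t w(1) tw by (simp_all add: v_def)
    have mem: "u + v \<in> base_triangle g \<inter> ball u e" "u - v \<in> base_triangle g \<inter> ball u e" "u \<in> base_triangle g \<inter> ball u e"
      using w(2)[of t] w(2)[of "- t"] t v u e(1) by (simp_all add: v_def dist_norm)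
    have "boundary_sqdist T r (place g (u + v)) + boundary_sqdist T r (place g (u - v))
        \<le> 2 * boundary_sqdist T r (place g u) + 2 * (norm v)\<^sup>2"
    proof (rule d(2))
      show "place g (u + v) \<in> M" "place g (u - v) \<in> M" using mem B.place_in[OF g(1)] by auto
      show "dist (place g u) (place g (u + v)) = norm v" "dist (place g u) (place g (u - v)) = norm v"
        using e(2)[OF mem(3) mem(1)] e(2)[OF mem(3) mem(2)] by (simp_all add: dist_norm)
      have "dist (u + v) (u - v) = norm (2 *\<^sub>R v)" by (simp add: dist_norm scaleR_2)
      then show "dist (place g (u + v)) (place g (u - v)) = 2 * norm v"
        using e(2)[OF mem(1) mem(2)] by simp
    qed (rule v(3))
    then have "F (u + v) + F (u - v) \<le> 2 * F u"
      using apex_sqdist_parallelogram[of r g u v] by (simp add: F_def power2_norm_eq_inner)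
    then show "\<exists>v. v \<noteq> 0 \<and> u + v \<in> base_triangle g \<and> u - v \<in> base_triangle g \<and> F (u + v) + F (u - v) \<le> 2 * F u"
      using v(1) mem by blast
  qed (rule g(2))
  then show ?thesis using B.boundary_sqdist_place[OF g(1,2)] g(3) by (simp add: F_def)
qed

section \<open>The glued polyhedron\<close>

text \<open>Meant for \<open>D x y\<close> the glued distance between two points of a path. An end
  of the path may lie over a vertex, where the local comparison fails; so the Lipschitz bound is
  added up on an inner interval only, and the ends contribute an arbitrarily small amount.\<close>

lemma path_length_bound:
  fixes D :: "real \<Rightarrow> real \<Rightarrow> real"
  assumes L: "0 \<le> L"
    and tri: "\<And>x y z. x \<in> {0..1} \<Longrightarrow> y \<in> {0..1} \<Longrightarrow> z \<in> {0..1} \<Longrightarrow> D x z \<le> D x y + D y z"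
    and loc: "\<And>x. 0 < x \<Longrightarrow> x < 1 \<Longrightarrow>
      \<exists>d>0. \<forall>y\<in>{0..1}. \<bar>y - x\<bar> < d \<longrightarrow> D x y \<le> L * \<bar>y - x\<bar> \<and> D y x \<le> L * \<bar>y - x\<bar>"
    and start: "\<And>e. 0 < e \<Longrightarrow> \<exists>d>0. \<forall>y\<in>{0..1}. y < d \<longrightarrow> D 0 y \<le> e"
    and finish: "\<And>e. 0 < e \<Longrightarrow> \<exists>d>0. \<forall>y\<in>{0..1}. 1 - y < d \<longrightarrow> D y 1 \<le> e"
  shows "D 0 1 \<le> L"
proof (rule field_le_epsilon)
  fix e :: real assume "0 < e"
  then have e2: "0 < e / 2" by simp
  obtain d1 where d1: "d1 > 0" "\<forall>y\<in>{0..1}. y < d1 \<longrightarrow> D 0 y \<le> e / 2" using start[OF e2] by blast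
  obtain d2 where d2: "d2 > 0" "\<forall>y\<in>{0..1}. 1 - y < d2 \<longrightarrow> D y 1 \<le> e / 2" using finish[OF e2] by blast
  \<comment> \<open>The thirds put \<open>a\<close> and \<open>b\<close> on the two sides of the
    middle, so that \<open>[a, b]\<close> is an interval within the interior.\<close>
  define a where "a = min d1 1 / 3"
  define b where "b = 1 - min d2 1 / 3"
  have ab: "0 < a" "a < d1" "a \<le> b" "b < 1" "1 - b < d2" using d1(1) d2(1) by (auto simp: a_def b_def min_def)
  \<comment> \<open>The bounds are part of \<open>P\<close> because the triangle inequality is
    available only for parameters in the unit interval.\<close>
  define P where "P = (\<lambda>x y. 0 \<le> x \<and> x \<le> y \<and> y \<le> 1 \<and> D x y \<le> L * (y - x))"
  have "P a b"
    using ab(3)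
  proof (induction rule: Bolzano)
    case (trans x y z)
    then show ?case using tri[of x y z] by (auto simp: P_def right_diff_distrib)
  next
    case (local x)
    then have x: "0 < x" "x < 1" using ab by linarith+
    obtain d where d: "d > 0" "\<forall>y\<in>{0..1}. \<bar>y - x\<bar> < d \<longrightarrow> D x y \<le> L * \<bar>y - x\<bar> \<and> D y x \<le> L * \<bar>y - x\<bar>"
      using loc[OF x] by blast
    have "P u v" if uv: "u \<le> x" "x \<le> v" "v - u < min d (min x (1 - x))" for u v
    proof -
      have r: "0 \<le> u" "v \<le> 1" "\<bar>u - x\<bar> < d" "\<bar>v - x\<bar> < d" using uv by auto
      moreover have "u \<in> {0..1}" "v \<in> {0..1}" using r uv x by auto
      ultimately have "D u x \<le> L * \<bar>u - x\<bar>" "D x v \<le> L * \<bar>v - x\<bar>" using d(2) by blast+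
      then have "D u x \<le> L * (x - u)" "D x v \<le> L * (v - x)" using uv by auto
      moreover have "D u v \<le> D u x + D x v" using r uv x by (intro tri) auto
      ultimately have "D u v \<le> L * (v - u)" by (simp add: right_diff_distrib)
      then show ?thesis using r uv by (simp add: P_def)
    qed
    then show ?case using d(1) x by (intro exI[of _ "min d (min x (1 - x))"]) auto
  qed
  then have "D a b \<le> L * (b - a)" by (simp add: P_def)
  also have "\<dots> \<le> L" using L ab by (intro mult_left_le) auto
  finally have "D a b \<le> L" .
  moreover have "D 0 a \<le> e / 2" "D b 1 \<le> e / 2" using d1(2) d2(2) ab by auto
  moreover have "D 0 1 \<le> D 0 a + D a 1" "D a 1 \<le> D a b + D b 1" using ab by (auto intro!: tri)
  ultimately show "D 0 1 \<le> L + e" by linarith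
qed

lemma chain_length_nonneg: "chain_length T r X Y l \<Longrightarrow> 0 \<le> l"
  by (induction rule: chain_length.induct) auto

lemma chain_length_segment:
  assumes "X \<in> glued_polyhedron T r" "Z \<in> glued_polyhedron T r" "(f, p) \<in> X" "(f, q) \<in> Z"
  shows "chain_length T r X Z (dist p q)"
  using chain_length.step[OF chain_length.start[OF assms(1)] assms(2-4)] by simp

lemma chain_length_trans:
  "chain_length T r Y Z l' \<Longrightarrow> chain_length T r X Y l \<Longrightarrow> chain_length T r X Z (l + l')"
proof (induction rule: chain_length.induct)
  case (step Y Y' l' Z f p q)
  then show ?case using chain_length.step[of T r X Y' "l + l'" Z f p q] by (simp add: add.assoc)
qed simp

lemma glued_dist_le: "chain_length T r X Y l \<Longrightarrow> glued_dist T r X Y \<le> l"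
  unfolding glued_dist_def
  by (intro cInf_lower bdd_belowI[of _ 0]) (auto dest: chain_length_nonneg)

text \<open>The law of cosines at the apex. Only the two distances to the apex and the distance of
  the base points enter, so points over corresponding parts of two different polytopes can be
  compared.\<close>

lemma dist_ray_point:
  "(dist (ray_point r f x t) (ray_point r f y s))\<^sup>2 =
    t\<^sup>2 * apex_sqdist r f x + s\<^sup>2 * apex_sqdist r f y
    - t * s * (apex_sqdist r f x + apex_sqdist r f y - (dist x y)\<^sup>2)"
proof -
  define A B where "A = (x, 0) - apex r f" and "B = (y, 0) - apex r f"
  have AB: "apex_sqdist r f x = A \<bullet> A" "apex_sqdist r f y = B \<bullet> B"
    by (simp_all add: apex_sqdist_def A_def B_def dist_norm norm_minus_commute flip: power2_norm_eq_inner)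
  have "A - B = (x - y, 0)" by (simp add: A_def B_def)
  then have "(dist x y)\<^sup>2 = (A - B) \<bullet> (A - B)" by (simp add: dist_norm inner_prod_def power2_norm_eq_inner)
  then have xy: "(dist x y)\<^sup>2 = A \<bullet> A + B \<bullet> B - 2 * (A \<bullet> B)"
    by (simp add: inner_diff_left inner_diff_right inner_commute)
  have "ray_point r f x t - ray_point r f y s = t *\<^sub>R A - s *\<^sub>R B"
    by (simp add: ray_point_def A_def B_def algebra_simps)
  then have "(dist (ray_point r f x t) (ray_point r f y s))\<^sup>2 = (t *\<^sub>R A - s *\<^sub>R B) \<bullet> (t *\<^sub>R A - s *\<^sub>R B)"
    by (simp add: dist_norm power2_norm_eq_inner)
  also have "\<dots> = t\<^sup>2 * (A \<bullet> A) + s\<^sup>2 * (B \<bullet> B) - 2 * t * s * (A \<bullet> B)"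
    by (simp add: inner_diff_left inner_diff_right inner_commute power2_eq_square algebra_simps)
  finally show ?thesis unfolding AB xy by (simp add: algebra_simps)
qed

lemma dist_ray_point_eqI:
  assumes "apex_sqdist r f x = apex_sqdist r' g u" "apex_sqdist r f y = apex_sqdist r' g v" "dist x y = dist u v"
  shows "dist (ray_point r f x t) (ray_point r f y s) = dist (ray_point r' g u t) (ray_point r' g v s)"
  using dist_ray_point[of r f x t y s] dist_ray_point[of r' g u t v s] assms
  by (metis power2_eq_iff_nonneg zero_le_dist)

lemma ray_point_0 [simp]: "ray_point r f x 0 = apex r f"
  by (rule prod_eqI) (simp_all add: ray_point_def)

lemma ray_point_1 [simp]: "ray_point r f x 1 = (x, 0)"
  by (simp add: ray_point_def)

lemma dist_ray_point_same: "dist (ray_point r f x t) (ray_point r f x s) = \<bar>t - s\<bar> * sqrt (apex_sqdist r f x)"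
proof -
  have "ray_point r f x t - ray_point r f x s = (s - t) *\<^sub>R (apex r f - (x, 0))"
    by (simp add: ray_point_def algebra_simps)
  then show ?thesis by (simp add: dist_norm apex_sqdist_def abs_minus_commute)
qed

lemma dist_ray_point_le:
  assumes "0 \<le> s" "s \<le> 1"
  shows "dist (ray_point r f x t) (ray_point r f y s) \<le> \<bar>t - s\<bar> * sqrt (apex_sqdist r f x) + dist x y"
proof -
  have "ray_point r f x s - ray_point r f y s = s *\<^sub>R (x - y, 0)"
    by (simp add: ray_point_def algebra_simps)
  then have "dist (ray_point r f x s) (ray_point r f y s) = s * dist x y"
    using assms by (simp add: dist_norm norm_Pair)
  also have "\<dots> \<le> dist x y" using assms by (simp add: mult_left_le_one_le)
  finally show ?thesis
    using dist_triangle[of "ray_point r f x t" "ray_point r f y s" "ray_point r f x s"]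
      dist_ray_point_same[of r f x t s] by linarith
qed

text \<open>The glued polyhedron as a cone over \<open>M\<close>. The coordinates \<open>m\<close>
  and \<open>t\<close> do not refer to faces, so the map between two polytopes can simply keep them;
  at \<open>t = 0\<close> every \<open>m\<close> gives the apex.\<close>

definition cone_class :: "'a face set \<Rightarrow> ('a \<Rightarrow> real) \<Rightarrow> 'a \<Rightarrow> real \<Rightarrow> ('a face \<times> (real^2) \<times> real) set" where
  "cone_class T r m t = {(f, ray_point r f x t) | f x. f \<in> T \<and> x \<in> base_triangle f \<and> (t = 0 \<or> place f x = m)}"

lemma cone_classI:
  "f \<in> T \<Longrightarrow> x \<in> base_triangle f \<Longrightarrow> t = 0 \<or> place f x = m \<Longrightarrow> (f, ray_point r f x t) \<in> cone_class T r m t"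
  unfolding cone_class_def by blast

lemma cone_class_0: "cone_class T r m 0 = cone_class T r m' 0"
  by (simp add: cone_class_def)

context polyhedral_couple
begin

lemma ray_point_inj:
  assumes "f \<in> T" and eq: "ray_point r f x t = ray_point r f y s"
  shows "t = s \<and> (t = 0 \<or> x = y)"
proof -
  have "(1 - t) * snd (apex r f) = (1 - s) * snd (apex r f)"
    using arg_cong[OF eq, of snd] by (simp add: ray_point_def)
  then have "t = s" using apex_height[OF assms(1)] by simp
  then show ?thesis using arg_cong[OF eq, of fst] by (auto simp: ray_point_def)
qed

lemma gluing_class:
  assumes f: "f \<in> T" "x \<in> base_triangle f" and t: "0 \<le> t" "t \<le> 1"
  shows "gluing T r `` {(f, ray_point r f x t)} = cone_class T r (place f x) t"
proof (intro equalityI subsetI)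
  fix c assume "c \<in> gluing T r `` {(f, ray_point r f x t)}"
  then have "((f, ray_point r f x t), c) \<in> gluing T r" by simp
  then obtain g y z s where c: "c = (g, ray_point r g y s)" "ray_point r f x t = ray_point r f z s"
      "g \<in> T" "y \<in> base_triangle g" "s = 0 \<or> place f z = place g y"
    unfolding gluing_def by blast
  then have "t = s \<and> (t = 0 \<or> x = z)" using ray_point_inj[OF f(1)] by blast
  then show "c \<in> cone_class T r (place f x) t" using c by (auto intro!: cone_classI)
next
  fix c assume "c \<in> cone_class T r (place f x) t"
  then obtain g y where "c = (g, ray_point r g y t)" "g \<in> T" "y \<in> base_triangle g" "t = 0 \<or> place f x = place g y"
    unfolding cone_class_def by fastforce
  then show "c \<in> gluing T r `` {(f, ray_point r f x t)}" using gluingI[OF f(1) _ f(2) _ t] by auto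
qed

lemma cone_class_in:
  assumes m: "m \<in> M" and t: "0 \<le> t" "t \<le> 1"
  shows "cone_class T r m t \<in> glued_polyhedron T r"
proof -
  obtain f x where f: "f \<in> T" "x \<in> base_triangle f" "place f x = m" by (rule preimages_nonempty[OF m])
  have "(f, ray_point r f x t) \<in> pyramids T r" using f t by (intro pyramidsI) auto
  then have "gluing T r `` {(f, ray_point r f x t)} \<in> glued_polyhedron T r"
    unfolding glued_polyhedron_def by (rule quotientI)
  then show ?thesis using gluing_class[OF f(1,2) t] f(3) by simp
qed

lemma glued_polyhedronE:
  assumes "X \<in> glued_polyhedron T r"
  obtains m t where "m \<in> M" "0 \<le> t" "t \<le> 1" "X = cone_class T r m t"
proof -
  obtain c where c: "c \<in> pyramids T r" "X = gluing T r `` {c}"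
    using assms unfolding glued_polyhedron_def by (rule quotientE)
  then obtain f x t where f: "f \<in> T" "x \<in> base_triangle f" "0 \<le> t" "t \<le> 1" "c = (f, ray_point r f x t)"
    unfolding pyramids_def pyramid_eq by blast
  then have "X = cone_class T r (place f x) t" using c(2) gluing_class[OF f(1-4)] by simp
  then show ?thesis using that place_in[OF f(1,2)] f(3,4) by blast
qed

lemma cone_class_eqD:
  assumes m: "m \<in> M" and eq: "cone_class T r m t = cone_class T r m' t'"
  shows "t = t' \<and> (t = 0 \<or> m = m')"
proof -
  obtain f x where f: "f \<in> T" "x \<in> base_triangle f" "place f x = m" by (rule preimages_nonempty[OF m])
  then have "(f, ray_point r f x t) \<in> cone_class T r m' t'" using cone_classI[of f T x t m r] eq by simp
  then obtain y where y: "ray_point r f x t = ray_point r f y t'" "t' = 0 \<or> place f y = m'"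
    unfolding cone_class_def by blast
  then have "t = t' \<and> (t = 0 \<or> x = y)" using ray_point_inj[OF f(1)] by blast
  then show ?thesis using y f by auto
qed

lemma boundary_point_cone_class: "boundary_point T r m = cone_class T r m 1"
  by (auto simp: boundary_point_def cone_class_def)

lemma apex_point_cone_class: "apex_point T r = cone_class T r m 0"
  using corner_mem[OF noncollinear] by (fastforce simp: apex_point_def cone_class_def)

text \<open>Two segments through the apex connect any two points, so the infimum that defines
  \<open>glued_dist\<close> is over a nonempty set.\<close>

lemma chain_exists:
  assumes "X \<in> glued_polyhedron T r" "Y \<in> glued_polyhedron T r"
  obtains l where "chain_length T r X Y l"
proof -
  obtain m t where X: "m \<in> M" "0 \<le> t" "t \<le> 1" "X = cone_class T r m t" by (rule glued_polyhedronE[OF assms(1)])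
  obtain m' t' where Y: "m' \<in> M" "0 \<le> t'" "t' \<le> 1" "Y = cone_class T r m' t'" by (rule glued_polyhedronE[OF assms(2)])
  obtain f x where f: "f \<in> T" "x \<in> base_triangle f" "place f x = m" by (rule preimages_nonempty[OF X(1)])
  obtain g y where g: "g \<in> T" "y \<in> base_triangle g" "place g y = m'" by (rule preimages_nonempty[OF Y(1)])
  define A where "A = cone_class T r m 0"
  have A: "A \<in> glued_polyhedron T r" using cone_class_in[OF X(1)] by (simp add: A_def)
  have "(f, ray_point r f x 0) \<in> A" "(g, ray_point r g y 0) \<in> A"
    unfolding A_def using f g by (auto intro: cone_classI simp del: ray_point_0)
  moreover have "(f, ray_point r f x t) \<in> X" "(g, ray_point r g y t') \<in> Y"
    using X Y f g by (auto intro: cone_classI)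
  ultimately have "chain_length T r X A (dist (ray_point r f x t) (ray_point r f x 0))"
    "chain_length T r A Y (dist (ray_point r g y 0) (ray_point r g y t'))"
    using assms A by (auto intro: chain_length_segment)
  then show ?thesis using that chain_length_trans by blast
qed

lemma glued_dist_greatest:
  assumes X: "X \<in> glued_polyhedron T r" "Y \<in> glued_polyhedron T r"
    and "\<And>l. chain_length T r X Y l \<Longrightarrow> c \<le> l"
  shows "c \<le> glued_dist T r X Y"
proof -
  obtain l where "chain_length T r X Y l" by (rule chain_exists[OF X])
  then show ?thesis unfolding glued_dist_def using assms(3) by (intro cInf_greatest) auto
qed

lemma glued_dist_triangle:
  assumes X: "X \<in> glued_polyhedron T r" and Y: "Y \<in> glued_polyhedron T r" and Z: "Z \<in> glued_polyhedron T r"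
  shows "glued_dist T r X Z \<le> glued_dist T r X Y + glued_dist T r Y Z"
proof -
  have "glued_dist T r X Z - l \<le> glued_dist T r Y Z" if l: "chain_length T r X Y l" for l
  proof (rule glued_dist_greatest[OF Y Z])
    fix l' assume "chain_length T r Y Z l'"
    then show "glued_dist T r X Z - l \<le> l'" using glued_dist_le[OF chain_length_trans[OF _ l]] by fastforce
  qed
  then have "glued_dist T r X Z - glued_dist T r Y Z \<le> glued_dist T r X Y"
    by (intro glued_dist_greatest[OF X Y]) (simp add: algebra_simps)
  then show ?thesis by simp
qed

lemma glued_dist_segment:
  assumes f: "f \<in> T" "x \<in> base_triangle f" "y \<in> base_triangle f" and t: "0 \<le> t" "t \<le> 1" and s: "0 \<le> s" "s \<le> 1"
  shows "glued_dist T r (cone_class T r (place f x) t) (cone_class T r (place f y) s)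
    \<le> dist (ray_point r f x t) (ray_point r f y s)"
proof (rule glued_dist_le, rule chain_length_segment)
  show "(f, ray_point r f x t) \<in> cone_class T r (place f x) t" by (rule cone_classI) (use f in auto)
  show "(f, ray_point r f y s) \<in> cone_class T r (place f y) s" by (rule cone_classI) (use f in auto)
qed (intro cone_class_in place_in assms)+

text \<open>Within one pyramid the distance to the apex changes by at most the length of a segment,
  and it is the same at glued points; a chain from the apex is thus no shorter than the distance
  reached.\<close>

lemma radius_le_chain_length:
  assumes "chain_length T r (apex_point T r) Z l" "f \<in> T" "x \<in> base_triangle f" "(f, ray_point r f x t) \<in> Z"
  shows "t * sqrt (apex_sqdist r f x) \<le> l"
proof -
  \<comment> \<open>All representatives of the end point are covered, because the next segment may
    start from a representative in another pyramid.\<close>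
  have "\<forall>f x t. f \<in> T \<longrightarrow> x \<in> base_triangle f \<longrightarrow> (f, ray_point r f x t) \<in> Z \<longrightarrow> t * sqrt (apex_sqdist r f x) \<le> l"
    if "chain_length T r X Z l" "X = apex_point T r" for X
    using that
  proof (induction rule: chain_length.induct)
    case (start X)
    have "t = 0" if "f \<in> T" "(f, ray_point r f x t) \<in> X" for f x t
    proof -
      have "ray_point r f x t = ray_point r f x 0" using that start by (simp add: apex_point_def)
      then show ?thesis using ray_point_inj[OF that(1)] by blast
    qed
    then show ?case by (metis mult_zero_left order_refl)
  next
    case (step X Y l Z f p q)
    obtain m t where Y: "m \<in> M" "0 \<le> t" "t \<le> 1" "Y = cone_class T r m t"
    proof -
      have "Y \<in> glued_polyhedron T r" using step.hyps(1) by (cases rule: chain_length.cases) auto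
      then show thesis by (rule glued_polyhedronE) (rule that)
    qed
    obtain x where x: "f \<in> T" "x \<in> base_triangle f" "p = ray_point r f x t"
      using step.hyps(3) unfolding Y(4) cone_class_def by blast
    obtain m' t' where Z: "m' \<in> M" "0 \<le> t'" "t' \<le> 1" "Z = cone_class T r m' t'"
      by (rule glued_polyhedronE[OF step.hyps(2)])
    obtain y where y: "y \<in> base_triangle f" "t' = 0 \<or> place f y = m'" "q = ray_point r f y t'"
      using step.hyps(4) unfolding Z(4) cone_class_def by blast
    have rad: "dist (apex r f) (ray_point r f z s) = s * sqrt (apex_sqdist r f z)" if "0 \<le> s" for z s f
      using dist_ray_point_same[of r f z 0 s] that by simp
    have "t * sqrt (apex_sqdist r f x) \<le> l" using step.IH step.prems x step.hyps(3) by blast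
    then have q: "t' * sqrt (apex_sqdist r f y) \<le> l + dist p q"
      using rad[OF Y(2), of f x] rad[OF Z(2), of f y] dist_triangle[of "apex r f" q p] x y by simp
    show ?case
    proof (intro allI impI)
      fix g z u assume g: "g \<in> T" "z \<in> base_triangle g" "(g, ray_point r g z u) \<in> Z"
      then obtain z' where z': "z' \<in> base_triangle g" "t' = 0 \<or> place g z' = m'" "ray_point r g z u = ray_point r g z' t'"
        unfolding Z(4) cone_class_def by blast
      then have u: "u = t' \<and> (u = 0 \<or> z = z')" using ray_point_inj[OF g(1)] by blast
      show "u * sqrt (apex_sqdist r g z) \<le> l + dist p q"
      proof (cases "u = 0")
        case True
        then show ?thesis using chain_length_nonneg[OF step.hyps(1)] by simp
      next
        case False
        then have "place g z = place f y" "u = t'" using u z' y by auto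
        then show ?thesis using q apex_sqdist_well_defined[OF g(1,2) x(1) y(1)] by simp
      qed
    qed
  qed
  then show ?thesis using assms by blast
qed

text \<open>Recovers the radii from the glued metric and the marked points. The upper bound is the
  side edge of a pyramid, the lower one is \<open>radius_le_chain_length\<close>.\<close>

lemma glued_dist_apex_vertex:
  assumes v: "v \<in> vertices T"
  shows "glued_dist T r (apex_point T r) (boundary_point T r v) = r v"
proof -
  obtain f k where f: "f \<in> T" "v = place f (corner f k)" using v by (auto simp: vertices_def)
  have c: "corner f k \<in> base_triangle f" by (rule corner_mem[OF noncollinear[OF f(1)]])
  then have vM: "v \<in> M" using place_in[OF f(1)] f(2) by simp
  have "v \<in> singular_points M" using v tri by (simp add: geodesic_triangulation_def)
  then have "0 < r v" using couple by (auto simp: couples_def PiE_def Pi_def)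
  moreover have "apex_sqdist r f (corner f k) = (r v)\<^sup>2" using apex_sqdist_corner[OF f(1)] f(2) by simp
  ultimately have sq: "sqrt (apex_sqdist r f (corner f k)) = r v" by simp
  have in1: "cone_class T r v 0 \<in> glued_polyhedron T r" "cone_class T r v 1 \<in> glued_polyhedron T r"
    using cone_class_in[OF vM] by auto
  show ?thesis
    unfolding boundary_point_cone_class
  proof (rule antisym)
    show "glued_dist T r (apex_point T r) (cone_class T r v 1) \<le> r v"
      using glued_dist_segment[OF f(1) c c, of 0 1] dist_ray_point_same[of r f "corner f k" 0 1] sq f(2)
      unfolding apex_point_cone_class[of v] by simp
    show "r v \<le> glued_dist T r (apex_point T r) (cone_class T r v 1)"
    proof (rule glued_dist_greatest)
      show "apex_point T r \<in> glued_polyhedron T r" unfolding apex_point_cone_class[of v] by (rule in1)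
      fix l assume l: "chain_length T r (apex_point T r) (cone_class T r v 1) l"
      have "(f, ray_point r f (corner f k) 1) \<in> cone_class T r v 1"
        by (rule cone_classI) (use f c in auto)
      then show "r v \<le> l" using radius_le_chain_length[OF l f(1) c] sq by fastforce
    qed (rule in1)
  qed
qed

text \<open>Continuity of the cone coordinates for the glued metric, also over vertices. Both orders
  of the arguments are bounded, since \<open>path_length_bound\<close> does not assume
  \<open>D\<close> to be symmetric.\<close>

lemma glued_dist_cone_class_small:
  assumes m: "m \<in> M" and t: "0 \<le> t" "t \<le> 1" and e: "0 < e"
  obtains d where "0 < d" "\<And>m' t'. m' \<in> M \<Longrightarrow> 0 \<le> t' \<Longrightarrow> t' \<le> 1 \<Longrightarrow> dist m' m < d \<Longrightarrow> \<bar>t' - t\<bar> < d \<Longrightarrow>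
    glued_dist T r (cone_class T r m t) (cone_class T r m' t') \<le> e \<and>
    glued_dist T r (cone_class T r m' t') (cone_class T r m t) \<le> e"
proof -
  have "0 < e / 2" using e by simp
  then obtain d where d: "0 < d" "\<And>m'. m' \<in> M \<Longrightarrow> dist m' m < d \<Longrightarrow>
    \<exists>f x x'. (f, x) \<in> preimages m \<and> (f, x') \<in> preimages m' \<and> dist x x' < e / 2"
    by (rule cover_nearby[where m = m]) blast
  define R where "R = sqrt (boundary_sqdist T r m)"
  \<comment> \<open>One half of \<open>e\<close> pays for the move along the ray, at most
    \<open>d' * R\<close>, the other for the move in the base. Adding 1 keeps the denominator
    positive.\<close>
  define d' where "d' = min d (e / (2 * (\<bar>R\<bar> + 1)))"
  show ?thesis
  proof (rule that)
    show "0 < d'" using d(1) e by (simp add: d'_def)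
    fix m' t' assume m': "m' \<in> M" "dist m' m < d'" and t': "0 \<le> t'" "t' \<le> 1" "\<bar>t' - t\<bar> < d'"
    obtain f x x' where f: "(f, x) \<in> preimages m" "(f, x') \<in> preimages m'" "dist x x' < e / 2"
      using d(2)[of m'] m' by (auto simp: d'_def)
    have fx: "f \<in> T" "x \<in> base_triangle f" "place f x = m" "x' \<in> base_triangle f" "place f x' = m'"
      using f by (simp_all add: preimages_def)
    have "sqrt (apex_sqdist r f x) = R" using boundary_sqdist_place[OF fx(1,2)] fx(3) by (simp add: R_def)
    moreover from this have "0 \<le> R" using apex_sqdist_pos[OF fx(1), of x] by (metis less_imp_le real_sqrt_ge_zero)
    ultimately have "dist (ray_point r f x t) (ray_point r f x' t') \<le> \<bar>t - t'\<bar> * R + dist x x'"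
      using dist_ray_point_le[OF t'(1,2), of r f x t x'] by simp
    also have "\<bar>t - t'\<bar> * R \<le> (e / (2 * (\<bar>R\<bar> + 1))) * (\<bar>R\<bar> + 1)"
      using t'(3) e \<open>0 \<le> R\<close> by (intro mult_mono) (auto simp: d'_def abs_minus_commute)
    also have "\<dots> = e / 2" by (simp add: field_simps)
    finally have le: "dist (ray_point r f x t) (ray_point r f x' t') \<le> e" using f(3) by simp
    show "glued_dist T r (cone_class T r m t) (cone_class T r m' t') \<le> e \<and>
      glued_dist T r (cone_class T r m' t') (cone_class T r m t) \<le> e"
      using glued_dist_segment[OF fx(1,2,4) t t'(1,2)] glued_dist_segment[OF fx(1,4,2) t'(1,2) t] le fx(3,5)
      by (simp add: dist_commute)
  qed
qed

end

section \<open>Comparison of two polytopes\<close>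

text \<open>A corner is the only point of the triangle where its barycentric coordinate reaches the
  maximum 1, and an affine function attains its maximum inside a segment only if it is constant
  there.\<close>

lemma open_segment_not_corner:
  assumes nc: "\<not> collinear (range (corner f))" and xy: "x \<in> base_triangle f" "y \<in> base_triangle f"
    and z: "z \<in> open_segment x y"
  shows "z \<notin> range (corner f)"
proof
  assume "z \<in> range (corner f)"
  then obtain k where k: "z = corner f k" by blast
  obtain s where s: "x \<noteq> y" "0 < s" "s < 1" "z = (1 - s) *\<^sub>R x + s *\<^sub>R y" using z by (auto simp: in_segment)
  have le: "bary f j u \<le> 1" if "u \<in> base_triangle f" for j u
  proof -
    have "0 \<le> bary f (j + 1) u" "0 \<le> bary f (j + 2) u" using that base_triangle_bary[OF nc] by auto
    then show ?thesis using bary_sum_shift[OF nc, of j u] by linarith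
  qed
  have "z = x + s *\<^sub>R (y - x)" by (simp add: s(4) algebra_simps)
  then have "bary f k z = bary f k x + s * (bary f k y - bary f k x)"
    unfolding bary_diff by (simp add: bary_add)
  then have eq: "(1 - s) * (1 - bary f k x) + s * (1 - bary f k y) = 0"
    using k bary_corner[OF nc, of k k] by (simp add: algebra_simps)
  have "0 \<le> (1 - s) * (1 - bary f k x)" "0 \<le> s * (1 - bary f k y)" using le xy s by simp_all
  then have "(1 - s) * (1 - bary f k x) = 0" "s * (1 - bary f k y) = 0" using eq by linarith+
  then have one: "bary f k x = 1" "bary f k y = 1" using s by simp_all
  have "u = corner f k" if u: "u \<in> base_triangle f" "bary f k u = 1" for u
  proof -
    have "0 \<le> bary f (k + 1) u" "0 \<le> bary f (k + 2) u" using u base_triangle_bary[OF nc] by auto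
    then have "bary f (k + 1) u = 0" "bary f (k + 2) u = 0" using bary_sum_shift[OF nc, of k u] u(2) by linarith+
    then show ?thesis using bary_expansion_shift[OF nc, of u k] u(2) by simp
  qed
  then show False using one xy s(1) by metis
qed

text \<open>
  A segment in a pyramid of \<open>T\<close> crosses several pyramids of \<open>T'\<close>; over a point that is not a
  vertex it is still locally isometric, because there \<open>M\<close> and the distances to the apex are the same.
\<close>

lemma glued_dist_transfer_segment:
  assumes 1: "polyhedral_couple M T r" and 2: "polyhedral_couple M T' r'"
    and eq: "\<And>m. m \<in> M \<Longrightarrow> boundary_sqdist T r m = boundary_sqdist T' r' m"
    and f: "f \<in> T" and x: "x \<in> base_triangle f" and y: "y \<in> base_triangle f"
    and t: "0 \<le> t" "t \<le> 1" and s: "0 \<le> s" "s \<le> 1"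
  shows "glued_dist T' r' (cone_class T' r' (place f x) t) (cone_class T' r' (place f y) s)
    \<le> dist (ray_point r f x t) (ray_point r f y s)"
proof -
  interpret A: polyhedral_couple M T r by (rule 1)
  interpret B: polyhedral_couple M T' r' by (rule 2)
  note nc = A.noncollinear[OF f]
  have sq: "apex_sqdist r f u = boundary_sqdist T' r' (place f u)" if "u \<in> base_triangle f" for u
    using A.boundary_sqdist_place[OF f that] eq A.place_in[OF f that] by simp
  \<comment> \<open>Points on one ray from the apex stay in one pyramid of \<open>T'\<close>. This
    also settles segments that end at the apex, where the base point may be chosen freely.\<close>
  have ray: "glued_dist T' r' (cone_class T' r' (place f u) t) (cone_class T' r' (place f u) s)
    \<le> dist (ray_point r f u t) (ray_point r f u s)" if u: "u \<in> base_triangle f" for u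
  proof -
    obtain g w where g: "g \<in> T'" "w \<in> base_triangle g" "place g w = place f u"
      by (rule B.preimages_nonempty[OF A.place_in[OF f u]])
    have "apex_sqdist r f u = apex_sqdist r' g w" using sq[OF u] B.boundary_sqdist_place[OF g(1,2)] g(3) by simp
    then have "dist (ray_point r f u t) (ray_point r f u s) = dist (ray_point r' g w t) (ray_point r' g w s)"
      by (intro dist_ray_point_eqI) auto
    then show ?thesis using B.glued_dist_segment[OF g(1,2,2) t s] g(3) by simp
  qed
  show ?thesis
  proof (cases "t = 0 \<or> s = 0 \<or> x = y")
    case True
    then show ?thesis
    proof (elim disjE)
      assume "t = 0"
      then show ?thesis using ray[OF y] cone_class_0[of T' r' "place f x" "place f y"] by simp
    next
      assume "s = 0"
      then show ?thesis using ray[OF x] cone_class_0[of T' r' "place f x" "place f y"] by simp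
    next
      assume "x = y"
      then show ?thesis using ray[OF x] by simp
    qed
  next
    case False
    then have ts: "0 < t" "0 < s" "x \<noteq> y" using t s by auto
    \<comment> \<open>The segment from \<open>p\<close> to \<open>q\<close> in cone coordinates. The
      weight \<open>\<tau> l\<close> of the base is affine in \<open>l\<close>; dividing by it gives
      \<open>z l\<close>, the central projection of the point from the apex, and
      \<open>\<kappa> l\<close> is its position between \<open>x\<close> and \<open>y\<close>. The
      division requires \<open>t\<close> and \<open>s\<close> to be positive.\<close>
    define \<tau> where "\<tau> = (\<lambda>l. (1 - l) * t + l * s)"
    define \<kappa> where "\<kappa> = (\<lambda>l. l * s / \<tau> l)"
    define z where "z = (\<lambda>l. (1 - \<kappa> l) *\<^sub>R x + \<kappa> l *\<^sub>R y)"
    define p q where "p = ray_point r f x t" and "q = ray_point r f y s"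
    define G where "G = (\<lambda>l. cone_class T' r' (place f (z l)) (\<tau> l))"
    have \<tau>: "0 < \<tau> l" "\<tau> l \<le> 1" if "l \<in> {0..1}" for l
    proof -
      show "0 < \<tau> l"
      proof (cases "l = 0")
        case False
        then have "0 < l * s" "0 \<le> (1 - l) * t" using that ts by auto
        then show ?thesis by (simp add: \<tau>_def)
      qed (simp add: \<tau>_def ts)
      show "\<tau> l \<le> 1" unfolding \<tau>_def using that t s by (intro convex_bound_le) auto
    qed
    have \<kappa>: "0 \<le> \<kappa> l" "\<kappa> l \<le> 1" if "l \<in> {0..1}" for l
    proof -
      show "0 \<le> \<kappa> l" using \<tau>[OF that] that s by (simp add: \<kappa>_def)
      have "l * s \<le> \<tau> l" using that t by (simp add: \<tau>_def)
      then show "\<kappa> l \<le> 1" using \<tau>[OF that] by (simp add: \<kappa>_def)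
    qed
    have \<kappa>01: "0 < \<kappa> l" "\<kappa> l < 1" if "0 < l" "l < 1" for l
    proof -
      show "0 < \<kappa> l" using \<tau>[of l] that ts by (simp add: \<kappa>_def)
      have "l * s < \<tau> l" using that ts by (simp add: \<tau>_def)
      then show "\<kappa> l < 1" using \<tau>[of l] that by (simp add: \<kappa>_def)
    qed
    have zb: "z l \<in> base_triangle f" if "l \<in> {0..1}" for l
    proof -
      have "convex (base_triangle f)" by (simp add: base_triangle_def)
      then show ?thesis unfolding z_def using \<kappa>[OF that] x y by (intro convexD) auto
    qed
    have znc: "z l \<notin> range (corner f)" if "0 < l" "l < 1" for l
    proof (rule open_segment_not_corner[OF nc x y])
      show "z l \<in> open_segment x y"
        unfolding in_segment z_def using ts(3) \<kappa>01[OF that] by auto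
    qed
    have pt: "(1 - l) *\<^sub>R p + l *\<^sub>R q = ray_point r f (z l) (\<tau> l)" if l: "l \<in> {0..1}" for l
    proof -
      have k: "\<tau> l * \<kappa> l = l * s" "\<tau> l * (1 - \<kappa> l) = (1 - l) * t"
        using \<tau>(1)[OF l] by (simp_all add: \<kappa>_def right_diff_distrib) (simp add: \<tau>_def)
      have "\<tau> l *\<^sub>R z l = (\<tau> l * (1 - \<kappa> l)) *\<^sub>R x + (\<tau> l * \<kappa> l) *\<^sub>R y"
        by (simp add: z_def scaleR_add_right)
      also have "\<dots> = ((1 - l) * t) *\<^sub>R x + (l * s) *\<^sub>R y" by (simp only: k)
      finally have z: "\<tau> l *\<^sub>R z l = ((1 - l) * t) *\<^sub>R x + (l * s) *\<^sub>R y" .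
      have "1 - \<tau> l = (1 - l) * (1 - t) + l * (1 - s)" by (simp add: \<tau>_def algebra_simps)
      have "(1 - l) *\<^sub>R p + l *\<^sub>R q = ((1 - l) * (1 - t) + l * (1 - s)) *\<^sub>R apex r f
          + (((1 - l) * t) *\<^sub>R x + (l * s) *\<^sub>R y, 0)"
        unfolding p_def q_def ray_point_def by (intro prod_eqI) (simp_all add: algebra_simps)
      also have "\<dots> = (1 - \<tau> l) *\<^sub>R apex r f + (\<tau> l *\<^sub>R z l, 0)"
        by (simp only: z \<open>1 - \<tau> l = _\<close>)
      finally show ?thesis by (simp add: ray_point_def)
    qed
    have dpt: "dist (ray_point r f (z l) (\<tau> l)) (ray_point r f (z l') (\<tau> l')) = dist p q * \<bar>l' - l\<bar>"
      if "l \<in> {0..1}" "l' \<in> {0..1}" for l l'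
    proof -
      have "((1 - l) *\<^sub>R p + l *\<^sub>R q) - ((1 - l') *\<^sub>R p + l' *\<^sub>R q) = (l' - l) *\<^sub>R (p - q)"
        by (simp add: algebra_simps)
      then show ?thesis unfolding pt[OF that(1), symmetric] pt[OF that(2), symmetric]
        by (simp add: dist_norm mult.commute)
    qed
    have cont: "continuous_on {0..1} z" "continuous_on {0..1} \<tau>"
    proof -
      show c: "continuous_on {0..1} \<tau>" unfolding \<tau>_def by (intro continuous_intros)
      have "\<forall>l\<in>{0..1}. \<tau> l \<noteq> 0" using \<tau>(1) by fastforce
      then have "continuous_on {0..1} \<kappa>" unfolding \<kappa>_def by (intro continuous_intros c) auto
      then show "continuous_on {0..1} z" unfolding z_def by (intro continuous_intros)
    qed
    have cz: "\<exists>d>0. \<forall>l'\<in>{0..1}. \<bar>l' - l\<bar> < d \<longrightarrow> dist (z l') (z l) < e" if "l \<in> {0..1}" "0 < e" for l e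
      using cont(1) that unfolding continuous_on_iff dist_real_def by blast
    have Gin: "G l \<in> glued_polyhedron T' r'" if "l \<in> {0..1}" for l
      unfolding G_def using A.place_in[OF f zb[OF that]] \<tau>[OF that] by (intro B.cone_class_in) auto
    \<comment> \<open>Continuity at every parameter, including the ends, which may lie over
      vertices.\<close>
    have small: "\<exists>d>0. \<forall>l'\<in>{0..1}. \<bar>l' - l\<bar> < d \<longrightarrow>
        glued_dist T' r' (G l) (G l') \<le> e \<and> glued_dist T' r' (G l') (G l) \<le> e"
      if l: "l \<in> {0..1}" and e: "0 < e" for l e
    proof -
      have \<tau>l: "0 \<le> \<tau> l" "\<tau> l \<le> 1" using \<tau>[OF l] by auto
      obtain d where d: "0 < d" "\<And>m' t'. m' \<in> M \<Longrightarrow> 0 \<le> t' \<Longrightarrow> t' \<le> 1 \<Longrightarrow> dist m' (place f (z l)) < d \<Longrightarrow>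
        \<bar>t' - \<tau> l\<bar> < d \<Longrightarrow>
        glued_dist T' r' (cone_class T' r' (place f (z l)) (\<tau> l)) (cone_class T' r' m' t') \<le> e \<and>
        glued_dist T' r' (cone_class T' r' m' t') (cone_class T' r' (place f (z l)) (\<tau> l)) \<le> e"
        by (rule B.glued_dist_cone_class_small[OF A.place_in[OF f zb[OF l]] \<tau>l e]) blast
      have "continuous_on {0..1} (\<lambda>l. place f (z l))"
        by (rule continuous_on_compose2[OF A.place_cont[OF f] cont(1)]) (use zb in auto)
      then obtain d1 where d1: "d1 > 0" "\<forall>l'\<in>{0..1}. \<bar>l' - l\<bar> < d1 \<longrightarrow> dist (place f (z l')) (place f (z l)) < d"
        using l d(1) unfolding continuous_on_iff dist_real_def by blast
      obtain d2 where d2: "d2 > 0" "\<forall>l'\<in>{0..1}. \<bar>l' - l\<bar> < d2 \<longrightarrow> \<bar>\<tau> l' - \<tau> l\<bar> < d"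
        using cont(2) l d(1) unfolding continuous_on_iff dist_real_def by blast
      have "glued_dist T' r' (G l) (G l') \<le> e \<and> glued_dist T' r' (G l') (G l) \<le> e"
        if l': "l' \<in> {0..1}" "\<bar>l' - l\<bar> < min d1 d2" for l'
        unfolding G_def using d1(2) d2(2) l' \<tau>[OF l'(1)] A.place_in[OF f zb[OF l'(1)]]
        by (intro d(2)) auto
      then show ?thesis using d1(1) d2(1) by (intro exI[of _ "min d1 d2"]) simp
    qed
    have "glued_dist T' r' (G 0) (G 1) \<le> dist p q"
    proof (rule path_length_bound[where D = "\<lambda>l l'. glued_dist T' r' (G l) (G l')"])
      show "glued_dist T' r' (G a) (G c) \<le> glued_dist T' r' (G a) (G b) + glued_dist T' r' (G b) (G c)"
        if "a \<in> {0..1}" "b \<in> {0..1}" "c \<in> {0..1}" for a b c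
        using that by (intro B.glued_dist_triangle Gin)
      show "\<exists>d>0. \<forall>l'\<in>{0..1}. l' < d \<longrightarrow> glued_dist T' r' (G 0) (G l') \<le> e" if e: "0 < e" for e
      proof -
        obtain d where d: "d > 0" "\<forall>l'\<in>{0..1}. \<bar>l' - 0\<bar> < d \<longrightarrow>
          glued_dist T' r' (G 0) (G l') \<le> e \<and> glued_dist T' r' (G l') (G 0) \<le> e"
          using small[of 0 e] e by auto
        then show ?thesis by (intro exI[of _ d]) auto
      qed
      show "\<exists>d>0. \<forall>l'\<in>{0..1}. 1 - l' < d \<longrightarrow> glued_dist T' r' (G l') (G 1) \<le> e" if e: "0 < e" for e
      proof -
        obtain d where d: "d > 0" "\<forall>l'\<in>{0..1}. \<bar>l' - 1\<bar> < d \<longrightarrow>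
          glued_dist T' r' (G 1) (G l') \<le> e \<and> glued_dist T' r' (G l') (G 1) \<le> e"
          using small[of 1 e] e by auto
        then show ?thesis by (intro exI[of _ d]) auto
      qed
      show "\<exists>d>0. \<forall>l'\<in>{0..1}. \<bar>l' - l\<bar> < d \<longrightarrow>
          glued_dist T' r' (G l) (G l') \<le> dist p q * \<bar>l' - l\<bar> \<and>
          glued_dist T' r' (G l') (G l) \<le> dist p q * \<bar>l' - l\<bar>" if l01: "0 < l" "l < 1" for l
      proof -
        have l: "l \<in> {0..1}" using l01 by simp
        define m where "m = place f (z l)"
        have m: "m \<in> M" "m \<notin> vertices T"
          using A.place_in[OF f zb[OF l]] A.non_vertex_iff[OF f zb[OF l]] znc[OF l01] by (auto simp: m_def)
        then have m': "m \<notin> vertices T'"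
          using A.tri B.tri by (simp add: geodesic_triangulation_def)
        have "z l \<in> base_triangle f - range (corner f)" using zb[OF l] znc[OF l01] by simp
        then obtain e where e: "0 < e" "\<And>a b. a \<in> base_triangle f \<inter> ball (z l) e \<Longrightarrow>
            b \<in> base_triangle f \<inter> ball (z l) e \<Longrightarrow> dist (place f a) (place f b) = dist a b"
          by (rule A.place_local_isometry[OF f]) blast
        \<comment> \<open>Near \<open>m\<close> the distance is realised inside one face of
          \<open>T'\<close> by lifts at exactly that distance, which makes the law of cosines
          applicable there; the bound 1 stands for any positive number.\<close>
        obtain d where d: "0 < d" "\<And>m'. m' \<in> M \<Longrightarrow> dist m' m < d \<Longrightarrow>
            \<exists>g w w'. (g, w) \<in> B.preimages m \<and> (g, w') \<in> B.preimages m' \<and> dist w w' = dist m m' \<and> dist w w' < 1"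
          by (rule B.isometric_nearby[OF m(1) m' zero_less_one]) blast
        have "0 < min e d" using e(1) d(1) by simp
        then obtain d' where d': "d' > 0" "\<forall>l'\<in>{0..1}. \<bar>l' - l\<bar> < d' \<longrightarrow> dist (z l') (z l) < min e d"
          using cz[OF l] by blast
        have "glued_dist T' r' (G l) (G l') \<le> dist p q * \<bar>l' - l\<bar> \<and>
            glued_dist T' r' (G l') (G l) \<le> dist p q * \<bar>l' - l\<bar>" if l': "l' \<in> {0..1}" "\<bar>l' - l\<bar> < d'" for l'
        proof -
          define m1 where "m1 = place f (z l')"
          have zz: "dist (z l') (z l) < min e d" using d'(2) l' by blast
          have dm: "dist m1 m = dist (z l') (z l)"
            unfolding m_def m1_def using zz zb[OF l] zb[OF l'(1)] e(1) by (intro e(2)) (auto simp: dist_commute)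
          have m1: "m1 \<in> M" using A.place_in[OF f zb[OF l'(1)]] by (simp add: m1_def)
          have "dist m1 m < d" using dm zz by simp
          then obtain g w w' where g: "(g, w) \<in> B.preimages m" "(g, w') \<in> B.preimages m1" "dist w w' = dist m m1"
            using d(2)[OF m1] by blast
          have gw: "g \<in> T'" "w \<in> base_triangle g" "place g w = m" "w' \<in> base_triangle g" "place g w' = m1"
            using g by (simp_all add: B.preimages_def)
          have "apex_sqdist r f (z l) = apex_sqdist r' g w" "apex_sqdist r f (z l') = apex_sqdist r' g w'"
            using sq[OF zb[OF l]] sq[OF zb[OF l'(1)]] B.boundary_sqdist_place[OF gw(1,2)]
              B.boundary_sqdist_place[OF gw(1,4)] gw(3,5) by (simp_all add: m_def m1_def)
          moreover have "dist (z l) (z l') = dist w w'" using dm g(3) by (simp add: dist_commute)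
          ultimately have "dist (ray_point r' g w (\<tau> l)) (ray_point r' g w' (\<tau> l')) = dist p q * \<bar>l' - l\<bar>"
            using dist_ray_point_eqI dpt[OF l l'(1)] by metis
          then show ?thesis
            using B.glued_dist_segment[OF gw(1,2,4), of "\<tau> l" "\<tau> l'"]
              B.glued_dist_segment[OF gw(1,4,2), of "\<tau> l'" "\<tau> l"] gw(3,5) \<tau>[OF l] \<tau>[OF l'(1)]
            by (simp add: G_def m_def m1_def dist_commute)
        qed
        then show ?thesis using d'(1) by blast
      qed
    qed simp
    moreover have "G 0 = cone_class T' r' (place f x) t" "G 1 = cone_class T' r' (place f y) s"
      using ts by (simp_all add: G_def z_def \<kappa>_def \<tau>_def)
    ultimately show ?thesis by (simp add: p_def q_def)
  qed
qed

text \<open>Each segment of a chain in one polytope bounds the distance of the corresponding points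
  in the other, and the triangle inequality adds these bounds up along the chain.\<close>

lemma glued_dist_transfer_le:
  assumes 1: "polyhedral_couple M T r" and 2: "polyhedral_couple M T' r'"
    and eq: "\<And>m. m \<in> M \<Longrightarrow> boundary_sqdist T r m = boundary_sqdist T' r' m"
    and m: "m \<in> M" "m' \<in> M" and t: "0 \<le> t" "t \<le> 1" "0 \<le> t'" "t' \<le> 1"
  shows "glued_dist T' r' (cone_class T' r' m t) (cone_class T' r' m' t')
    \<le> glued_dist T r (cone_class T r m t) (cone_class T r m' t')"
proof -
  interpret A: polyhedral_couple M T r by (rule 1)
  interpret B: polyhedral_couple M T' r' by (rule 2)
  have class_eq: "cone_class T' r' m t = cone_class T' r' (place f x) t"
    if "t = 0 \<or> place f x = m" for m t and f :: "'a face" and x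
    using that cone_class_0 by (metis (no_types))
  \<comment> \<open>The end point of the chain varies in the induction, and its cone coordinates are
    not unique at the apex; so the bound is claimed for all coordinates of \<open>Y\<close>.\<close>
  have bound: "\<forall>m'\<in>M. \<forall>t'\<in>{0..1}. Y = cone_class T r m' t' \<longrightarrow>
      glued_dist T' r' (cone_class T' r' m t) (cone_class T' r' m' t') \<le> l"
    if "chain_length T r X Y l" "X = cone_class T r m t" for X Y l
    using that
  proof (induction rule: chain_length.induct)
    case (start X)
    have "glued_dist T' r' (cone_class T' r' m t) (cone_class T' r' m' t') \<le> 0"
      if m': "m' \<in> M" "t' \<in> {0..1}" "X = cone_class T r m' t'" for m' t'
    proof -
      have "t = t' \<and> (t = 0 \<or> m = m')" using A.cone_class_eqD[OF m(1)] m'(3) start(2) by metis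
      then have "cone_class T' r' m' t' = cone_class T' r' m t" using cone_class_0 by metis
      moreover have "chain_length T' r' (cone_class T' r' m t) (cone_class T' r' m t) 0"
        by (intro chain_length.start B.cone_class_in m t)
      ultimately show ?thesis using glued_dist_le by fastforce
    qed
    then show ?case by blast
  next
    case (step X Y l Z f p q)
    obtain m1 t1 where Y: "m1 \<in> M" "0 \<le> t1" "t1 \<le> 1" "Y = cone_class T r m1 t1"
    proof -
      have "Y \<in> glued_polyhedron T r" using step.hyps(1) by (cases rule: chain_length.cases) auto
      then show thesis by (rule A.glued_polyhedronE) (rule that)
    qed
    obtain x where x: "f \<in> T" "x \<in> base_triangle f" "p = ray_point r f x t1" "t1 = 0 \<or> place f x = m1"
      using step.hyps(3) unfolding Y(4) cone_class_def by blast
    have "glued_dist T' r' (cone_class T' r' m t) (cone_class T' r' m2 t2) \<le> l + dist p q"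
      if m2: "m2 \<in> M" "t2 \<in> {0..1}" "Z = cone_class T r m2 t2" for m2 t2
    proof -
      obtain y where y: "y \<in> base_triangle f" "q = ray_point r f y t2" "t2 = 0 \<or> place f y = m2"
        using step.hyps(4) unfolding m2(3) cone_class_def by blast
      have t2: "0 \<le> t2" "t2 \<le> 1" using m2(2) by auto
      have "glued_dist T' r' (cone_class T' r' m t) (cone_class T' r' m1 t1) \<le> l"
        using step.IH step.prems Y by simp
      moreover have "glued_dist T' r' (cone_class T' r' m1 t1) (cone_class T' r' m2 t2) \<le> dist p q"
        unfolding class_eq[OF x(4)] class_eq[OF y(3)] x(3) y(2)
        by (rule glued_dist_transfer_segment[OF 1 2 eq x(1,2) y(1) Y(2,3) t2])
      moreover have "glued_dist T' r' (cone_class T' r' m t) (cone_class T' r' m2 t2)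
        \<le> glued_dist T' r' (cone_class T' r' m t) (cone_class T' r' m1 t1)
          + glued_dist T' r' (cone_class T' r' m1 t1) (cone_class T' r' m2 t2)"
        by (intro B.glued_dist_triangle B.cone_class_in m t Y t2 m2)
      ultimately show ?thesis by linarith
    qed
    then show ?case by blast
  qed
  show ?thesis
  proof (rule A.glued_dist_greatest)
    fix l assume "chain_length T r (cone_class T r m t) (cone_class T r m' t') l"
    then show "glued_dist T' r' (cone_class T' r' m t) (cone_class T' r' m' t') \<le> l"
      using bound m(2) t(3,4) by auto
  qed (intro A.cone_class_in m t)+
qed

lemma couple_equivI:
  assumes 1: "polyhedral_couple M T r" and 2: "polyhedral_couple M T' r'" and M: "M \<noteq> {}"
    and eq: "\<And>m. m \<in> M \<Longrightarrow> boundary_sqdist T r m = boundary_sqdist T' r' m"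
  shows "((T, r), (T', r')) \<in> couple_equiv M"
proof -
  interpret A: polyhedral_couple M T r by (rule 1)
  interpret B: polyhedral_couple M T' r' by (rule 2)
  have dist_eq: "glued_dist T' r' (cone_class T' r' m t) (cone_class T' r' m' t')
      = glued_dist T r (cone_class T r m t) (cone_class T r m' t')"
    if "m \<in> M" "m' \<in> M" "0 \<le> t" "t \<le> 1" "0 \<le> t'" "t' \<le> 1" for m m' t t'
    using glued_dist_transfer_le[OF 1 2 eq that] glued_dist_transfer_le[OF 2 1 eq[symmetric] that] by simp
  \<comment> \<open>Keeps the cone coordinates. They are ambiguous only at the apex, where every
    choice gives the same image.\<close>
  define \<Phi> where "\<Phi> = (\<lambda>X. case SOME (m, t). m \<in> M \<and> X = cone_class T r m t of (m, t) \<Rightarrow> cone_class T' r' m t)"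
  have \<Phi>: "\<Phi> (cone_class T r m t) = cone_class T' r' m t" if m: "m \<in> M" for m t
  proof -
    define c where "c = (SOME (m', t'). m' \<in> M \<and> cone_class T r m t = cone_class T r m' t')"
    have "case c of (m', t') \<Rightarrow> m' \<in> M \<and> cone_class T r m t = cone_class T r m' t'"
      unfolding c_def by (rule someI[of _ "(m, t)"]) (use m in simp)
    then obtain m' t' where c: "c = (m', t')" "m' \<in> M" "cone_class T r m t = cone_class T r m' t'"
      by (cases c) auto
    have "t = t' \<and> (t = 0 \<or> m = m')" by (rule A.cone_class_eqD[OF m c(3)])
    then have "cone_class T' r' m' t' = cone_class T' r' m t" using cone_class_0 by metis
    then show ?thesis unfolding \<Phi>_def c_def[symmetric] c(1) by simp
  qed
  have "bij_betw \<Phi> (glued_polyhedron T r) (glued_polyhedron T' r')"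
    unfolding bij_betw_def
  proof
    show "inj_on \<Phi> (glued_polyhedron T r)"
    proof (rule inj_onI)
      fix X Y assume X: "X \<in> glued_polyhedron T r" and Y: "Y \<in> glued_polyhedron T r" and eq: "\<Phi> X = \<Phi> Y"
      obtain m t where X': "m \<in> M" "0 \<le> t" "t \<le> 1" "X = cone_class T r m t" by (rule A.glued_polyhedronE[OF X])
      obtain m' t' where Y': "m' \<in> M" "0 \<le> t'" "t' \<le> 1" "Y = cone_class T r m' t'" by (rule A.glued_polyhedronE[OF Y])
      have "t = t' \<and> (t = 0 \<or> m = m')"
        using eq X' Y' by (intro B.cone_class_eqD[OF X'(1)]) (simp add: \<Phi>)
      then show "X = Y" using X' Y' cone_class_0 by metis
    qed
    show "\<Phi> ` glued_polyhedron T r = glued_polyhedron T' r'"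
    proof (intro equalityI subsetI)
      fix X assume "X \<in> \<Phi> ` glued_polyhedron T r"
      then obtain Y where Y: "Y \<in> glued_polyhedron T r" "X = \<Phi> Y" by blast
      obtain m t where "m \<in> M" "0 \<le> t" "t \<le> 1" "Y = cone_class T r m t" by (rule A.glued_polyhedronE[OF Y(1)])
      then show "X \<in> glued_polyhedron T' r'" using Y(2) by (simp add: \<Phi> B.cone_class_in)
    next
      fix X assume X: "X \<in> glued_polyhedron T' r'"
      obtain m t where "m \<in> M" "0 \<le> t" "t \<le> 1" "X = cone_class T' r' m t" by (rule B.glued_polyhedronE[OF X])
      then show "X \<in> \<Phi> ` glued_polyhedron T r" using \<Phi> A.cone_class_in by (metis imageI)
    qed
  qed
  moreover have "glued_dist T' r' (\<Phi> X) (\<Phi> Y) = glued_dist T r X Y"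
    if X: "X \<in> glued_polyhedron T r" and Y: "Y \<in> glued_polyhedron T r" for X Y
  proof -
    obtain m t where X': "m \<in> M" "0 \<le> t" "t \<le> 1" "X = cone_class T r m t" by (rule A.glued_polyhedronE[OF X])
    obtain m' t' where Y': "m' \<in> M" "0 \<le> t'" "t' \<le> 1" "Y = cone_class T r m' t'" by (rule A.glued_polyhedronE[OF Y])
    show ?thesis using dist_eq[OF X'(1) Y'(1) X'(2,3) Y'(2,3)] X' Y' by (simp add: \<Phi>)
  qed
  moreover have "\<Phi> (boundary_point T r m) = boundary_point T' r' m" if "m \<in> M" for m
    using \<Phi>[OF that] by (simp add: A.boundary_point_cone_class B.boundary_point_cone_class)
  moreover have "\<Phi> (apex_point T r) = apex_point T' r'"
  proof -
    obtain m where "m \<in> M" using M by blast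
    then show ?thesis using \<Phi>[of m 0] A.apex_point_cone_class[of m] B.apex_point_cone_class[of m] by simp
  qed
  ultimately show ?thesis
    unfolding couple_equiv_def using A.couple B.couple by blast
qed

section \<open>Radii and convex representatives of an equivalence class\<close>

lemma polyhedral_coupleI:
  assumes "polyhedral_metric M" "(T, r) \<in> couples M"
  shows "polyhedral_couple M T r"
  using assms by unfold_locales (auto simp: couples_def)

text \<open>An equivalence respects apex and boundary points and preserves distances, hence also
  those computed in \<open>glued_dist_apex_vertex\<close>. Extensionality turns agreement on the
  singular points into equality of functions.\<close>

lemma couple_equiv_radii:
  assumes M: "polyhedral_metric M" and eq: "((T, r), (T', r')) \<in> couple_equiv M"
  shows "r = r'"
proof -
  have c: "(T, r) \<in> couples M" "(T', r') \<in> couples M" using eq by (auto simp: couple_equiv_def)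
  interpret A: polyhedral_couple M T r by (rule polyhedral_coupleI[OF M c(1)])
  interpret B: polyhedral_couple M T' r' by (rule polyhedral_coupleI[OF M c(2)])
  obtain \<Phi> where \<Phi>: "\<forall>X \<in> glued_polyhedron T r. \<forall>Y \<in> glued_polyhedron T r.
      glued_dist T' r' (\<Phi> X) (\<Phi> Y) = glued_dist T r X Y"
    "\<forall>x\<in>M. \<Phi> (boundary_point T r x) = boundary_point T' r' x" "\<Phi> (apex_point T r) = apex_point T' r'"
    using eq unfolding couple_equiv_def by blast
  have sing: "vertices T = singular_points M" "vertices T' = singular_points M"
    using A.tri B.tri by (simp_all add: geodesic_triangulation_def)
  have "r \<in> singular_points M \<rightarrow>\<^sub>E {0<..}" "r' \<in> singular_points M \<rightarrow>\<^sub>E {0<..}"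
    using c by (auto simp: couples_def)
  then show ?thesis
  proof (rule PiE_ext)
    fix v assume v: "v \<in> singular_points M"
    then have vM: "v \<in> M" by (simp add: singular_points_def)
    then have "M \<noteq> {}" by blast
    then have "glued_dist T' r' (apex_point T' r') (boundary_point T' r' v) = glued_dist T r (apex_point T r) (boundary_point T r v)"
      using \<Phi> vM apex_point_in[OF c(1)] boundary_point_in[OF c(1) vM] by metis
    then show "r v = r' v" using A.glued_dist_apex_vertex[of v] B.glued_dist_apex_vertex[of v] v sing by simp
  qed
qed

text \<open>Convexity of \<open>P\<close> provides a couple with angles at most \<open>pi\<close>,
  but its triangulation may differ from \<open>T\<close>. It has the same radii because both couples
  lie in one equivalence class.\<close>

lemma convex_representative:
  assumes M: "M \<noteq> {}" "polyhedral_metric M" and P: "generalized_convex_polytope M P" "(T, r) \<in> P"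
  obtains T0 where "(T0, r) \<in> P" "polyhedral_couple M T0 r" "\<And>e. e \<in> edges T0 \<Longrightarrow> edge_angle T0 r e \<le> pi"
proof -
  have gp: "P \<in> couples M // couple_equiv M"
    using P by (simp add: generalized_convex_polytope_def generalized_polytopes_def)
  obtain T0 r0 where 0: "(T0, r0) \<in> P" "\<forall>e \<in> edges T0. edge_angle T0 r0 e \<le> pi"
    using P unfolding generalized_convex_polytope_def by blast
  have eq: "((T0, r0), (T, r)) \<in> couple_equiv M"
    using in_quotient_imp_in_rel[OF equiv_couple_equiv[OF M(1)] gp] 0(1) P(2) by simp
  then have "r0 = r" by (rule couple_equiv_radii[OF M(2)])
  moreover have "(T0, r0) \<in> couples M" using eq by (auto simp: couple_equiv_def)
  ultimately show ?thesis using that[of T0] 0 polyhedral_coupleI[OF M(2)] by blast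
qed

theorem proposition1:
  fixes M :: "'a::metric_space set"
    and P P' :: "('a face set \<times> ('a \<Rightarrow> real)) set"
    and T T' :: "'a face set" and r r' :: "'a \<Rightarrow> real"
  assumes "M homeomorphic sphere (0 :: real^3) 1"
    and "polyhedral_metric M"
    and "generalized_convex_polytope M P" and "generalized_convex_polytope M P'"
    and "(T, r) \<in> P" and "(T', r') \<in> P'"
    and "r = r'"
  shows "P = P'"
proof -
  have M: "M \<noteq> {}" using assms(1) homeomorphic_empty(2) by fastforce
  obtain S where S: "(S, r) \<in> P" "polyhedral_couple M S r" "\<And>e. e \<in> edges S \<Longrightarrow> edge_angle S r e \<le> pi"
    by (rule convex_representative[OF M assms(2,3,5)]) blast
  obtain S' where S': "(S', r) \<in> P'" "polyhedral_couple M S' r" "\<And>e. e \<in> edges S' \<Longrightarrow> edge_angle S' r e \<le> pi"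
    by (rule convex_representative[OF M assms(2,4,6)[folded assms(7)]]) blast
  have "boundary_sqdist S r m = boundary_sqdist S' r m" if "m \<in> M" for m
    using convex_boundary_sqdist_maximal[OF S(2) S'(2) S(3) that]
      convex_boundary_sqdist_maximal[OF S'(2) S(2) S'(3) that] by simp
  then have "((S, r), (S', r)) \<in> couple_equiv M" by (rule couple_equivI[OF S(2) S'(2) M])
  moreover have "P \<in> couples M // couple_equiv M" "P' \<in> couples M // couple_equiv M"
    using assms(3,4) by (simp_all add: generalized_convex_polytope_def generalized_polytopes_def)
  ultimately show ?thesis
    using quotient_eqI[OF equiv_couple_equiv[OF M]] S(1) S'(1) by blast
qed

end
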